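(* Assume that for every $m\in\mathbb{N}$ and every $\beta\ge 0$ the minimum $\lambda_m^*(\beta)=\min\{\lambda_m(\Omega,\beta) : \Omega\subset\mathbb{R}^2 \text{ bounded and open},\ |\Omega|=1\}$ is attained. Let $n\ge 2$ be an integer and $B\ge 0$. Suppose that the problem $$\lambda_n^*(B)=\min_{\substack{\Omega \text{ open},\\ |\Omega|=1}}\lambda_n(\Omega,B)$$ is minimized by a set which is the union of two disjoint open sets, each of positive measure. Then $$\lambda_n^*(B)=\min_{\substack{1\le i\le \lfloor n/2\rfloor,\\ t\in(0,1)}}\ \max\left\{\frac{\lambda_i^*(tB)}{t},\ \frac{\lambda_{n-i}^*((1-t)B)}{1-t}\right\}.$$ Moreover, if $(i^*,t^* )$ is a solution pair of this min-max problem (i.e. a pair at which the minimum on the right-hand side is attained), then corresponding minimizers of $\lambda_n(\cdot,B)$ among open sets of measure $1$ are given by $$\Omega_n^*(B)=(t^* )^{1/2}\,\Omega_{i^*}^*(t^*B)\ \cup\ (1-t^* )^{1/2}\,\Omega_{n-i^*}^*((1-t^* )B),$$ where $\Omega_{i^*}^*(t^*B)$ is any minimizer for $\lambda_{i^*}^*(t^*B)$, $\Omega_{n-i^*}^*((1-t^* )B)$ is any minimizer for $\lambda_{n-i^*}^*((1-t^* )B)$, and the two scaled sets are translated so as to be disjoint; that is, every such set attains $\lambda_n^*(B)$.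
   Context: For a bounded open set $\Omega\subset\mathbb{R}^2$ and $B\in\mathbb{R}$, let $A(x_1,x_2)=\frac{B}{2}(-x_2,x_1)^T$. The magnetic Dirichlet Laplacian $H_B^\Omega$ with constant magnetic field $B$ is the self-adjoint operator in $L^2(\Omega)$ obtained as the Friedrichs extension of the quadratic form $a[u]=\int_\Omega |(-i\nabla+A)u|^2\,dx$, $u\in C_0^\infty(\Omega)$. Its spectrum is purely discrete, and $0<\lambda_1(\Omega,B)\le\lambda_2(\Omega,B)\le\dots$ denote its eigenvalues in increasing order, counted with multiplicity. These eigenvalues are invariant under rigid motions of $\Omega$. $|\Omega|$ denotes Lebesgue measure, and $s\Omega=\{sx : x\in\Omega\}$ for $s>0$. For $n\in\mathbb{N}=\{1,2,\dots\}$ and $B\ge 0$, $\lambda_n^*(B):=\min\{\lambda_n(\Omega,B) : \Omega\subset\mathbb{R}^2\text{ (bounded) open},\ |\Omega|=1\}$, and $\Omega_n^*(B)$ denotes any (possibly non-unique) minimizer of this problem. Existence of minimizers for all $n\in\mathbb{N}$ and $B\ge0$ is a standing assumption. *)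

theory Defs
  imports "HOL-Analysis.Analysis" "HOL-Library.Extended_Nat"
begin

section \<open>Smooth functions with compact support\<close>

definition partial :: "2 \<Rightarrow> (real^2 \<Rightarrow> complex) \<Rightarrow> real^2 \<Rightarrow> complex" where
  "partial j u x = frechet_derivative u (at x) (axis j 1)"

text \<open>All iterated partial derivatives exist and are (totally) differentiable, hence
  continuous: this is smoothness of class C-infinity on the whole plane.\<close>

definition smooth_fun :: "(real^2 \<Rightarrow> complex) \<Rightarrow> bool" where
  "smooth_fun u \<longleftrightarrow> (\<forall>js x. foldr partial js u differentiable (at x))"

definition test_fun :: "(real^2) set \<Rightarrow> (real^2 \<Rightarrow> complex) \<Rightarrow> bool" where
  "test_fun \<Omega> u \<longleftrightarrow>
     smooth_fun u \<and> compact (closure {x. u x \<noteq> 0}) \<and> closure {x. u x \<noteq> 0} \<subseteq> \<Omega>"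


section \<open>The space of square-integrable functions\<close>

text \<open>Elements of the Hilbert space are represented by functions on the plane. Their values
  outside \<Omega> are irrelevant, and functions agreeing almost everywhere on \<Omega> represent the same
  element; linear independence below is therefore taken modulo null sets.\<close>

definition L2_fun :: "(real^2) set \<Rightarrow> (real^2 \<Rightarrow> complex) \<Rightarrow> bool" where
  "L2_fun \<Omega> u \<longleftrightarrow>
     u \<in> borel_measurable (lebesgue_on \<Omega>) \<and> integrable (lebesgue_on \<Omega>) (\<lambda>x. (cmod (u x))\<^sup>2)"

definition L2_inner ::
  "(real^2) set \<Rightarrow> (real^2 \<Rightarrow> complex) \<Rightarrow> (real^2 \<Rightarrow> complex) \<Rightarrow> complex" where
  "L2_inner \<Omega> u v = integral\<^sup>L (lebesgue_on \<Omega>) (\<lambda>x. u x * cnj (v x))"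

definition L2_convergent_to ::
  "(real^2) set \<Rightarrow> (nat \<Rightarrow> real^2 \<Rightarrow> complex) \<Rightarrow> (real^2 \<Rightarrow> complex) \<Rightarrow> bool" where
  "L2_convergent_to \<Omega> \<phi> u \<longleftrightarrow>
     (\<lambda>k. integral\<^sup>L (lebesgue_on \<Omega>) (\<lambda>x. (cmod (\<phi> k x - u x))\<^sup>2)) \<longlonglongrightarrow> 0"

definition L2_independent ::
  "(real^2) set \<Rightarrow> nat \<Rightarrow> (nat \<Rightarrow> real^2 \<Rightarrow> complex) \<Rightarrow> bool" where
  "L2_independent \<Omega> k u \<longleftrightarrow>
     (\<forall>c :: nat \<Rightarrow> complex.
        (AE x in lebesgue_on \<Omega>. (\<Sum>j<k. c j * u j x) = 0) \<longrightarrow> (\<forall>j<k. c j = 0))"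


section \<open>The magnetic Dirichlet Laplacian\<close>

definition vector_potential :: "real \<Rightarrow> real^2 \<Rightarrow> real^2" where
  "vector_potential B x = (B / 2) *\<^sub>R vector [- (x $ 2), x $ 1]"

definition magnetic_gradient :: "real \<Rightarrow> (real^2 \<Rightarrow> complex) \<Rightarrow> 2 \<Rightarrow> real^2 \<Rightarrow> complex" where
  "magnetic_gradient B u j x =
     - \<i> * partial j u x + complex_of_real (vector_potential B x $ j) * u x"

text \<open>The sesquilinear form on test functions whose diagonal is the quadratic form a[u].\<close>

definition magnetic_form ::
  "(real^2) set \<Rightarrow> real \<Rightarrow> (real^2 \<Rightarrow> complex) \<Rightarrow> (real^2 \<Rightarrow> complex) \<Rightarrow> complex" where
  "magnetic_form \<Omega> B u v =
     integral\<^sup>L (lebesgue_on \<Omega>)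
       (\<lambda>x. \<Sum>j\<in>UNIV. magnetic_gradient B u j x * cnj (magnetic_gradient B v j x))"

text \<open>Closure of the form: u lies in its domain iff u is an L2-limit of test functions that
  form a Cauchy sequence for the form. The closed form is the limit of the form values,
  which does not depend on the approximating sequences as the form is closable.\<close>

definition form_approx ::
  "(real^2) set \<Rightarrow> real \<Rightarrow> (nat \<Rightarrow> real^2 \<Rightarrow> complex) \<Rightarrow> (real^2 \<Rightarrow> complex) \<Rightarrow> bool" where
  "form_approx \<Omega> B \<phi> u \<longleftrightarrow>
     (\<forall>k. test_fun \<Omega> (\<phi> k)) \<and> L2_convergent_to \<Omega> \<phi> u \<and>
     (\<forall>e>0. \<exists>N. \<forall>k\<ge>N. \<forall>l\<ge>N.
        cmod (magnetic_form \<Omega> B (\<lambda>x. \<phi> k x - \<phi> l x) (\<lambda>x. \<phi> k x - \<phi> l x)) < e)"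

definition form_domain :: "(real^2) set \<Rightarrow> real \<Rightarrow> (real^2 \<Rightarrow> complex) set" where
  "form_domain \<Omega> B = {u. L2_fun \<Omega> u \<and> (\<exists>\<phi>. form_approx \<Omega> B \<phi> u)}"

definition closed_form ::
  "(real^2) set \<Rightarrow> real \<Rightarrow> (real^2 \<Rightarrow> complex) \<Rightarrow> (real^2 \<Rightarrow> complex) \<Rightarrow> complex" where
  "closed_form \<Omega> B u v =
     (THE z. \<exists>\<phi> \<psi>. form_approx \<Omega> B \<phi> u \<and> form_approx \<Omega> B \<psi> v \<and>
        (\<lambda>k. magnetic_form \<Omega> B (\<phi> k) (\<psi> k)) \<longlonglongrightarrow> z)"

text \<open>The graph of the Friedrichs extension, i.e. of the self-adjoint operator associated with
  the closed form: (u, f) belongs to it iff u is in the operator domain and is mapped to f.\<close>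

definition magnetic_Laplacian ::
  "(real^2) set \<Rightarrow> real \<Rightarrow> ((real^2 \<Rightarrow> complex) \<times> (real^2 \<Rightarrow> complex)) set" where
  "magnetic_Laplacian \<Omega> B =
     {(u, f). u \<in> form_domain \<Omega> B \<and> L2_fun \<Omega> f \<and>
        (\<forall>v\<in>form_domain \<Omega> B. closed_form \<Omega> B u v = L2_inner \<Omega> f v)}"


section \<open>Eigenvalues\<close>

definition eigenspace :: "(real^2) set \<Rightarrow> real \<Rightarrow> real \<Rightarrow> (real^2 \<Rightarrow> complex) set" where
  "eigenspace \<Omega> B \<mu> = {u. (u, \<lambda>x. complex_of_real \<mu> * u x) \<in> magnetic_Laplacian \<Omega> B}"

text \<open>The dimension of the eigenspace; it is zero if \<mu> is not an eigenvalue.\<close>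

definition multiplicity_of :: "(real^2) set \<Rightarrow> real \<Rightarrow> real \<Rightarrow> enat" where
  "multiplicity_of \<Omega> B \<mu> =
     Sup {enat k | k. \<exists>u. (\<forall>j<k. u j \<in> eigenspace \<Omega> B \<mu>) \<and> L2_independent \<Omega> k u}"

definition eigenvalue_enumeration :: "(real^2) set \<Rightarrow> real \<Rightarrow> (nat \<Rightarrow> real) \<Rightarrow> bool" where
  "eigenvalue_enumeration \<Omega> B l \<longleftrightarrow>
     mono l \<and>
     (\<forall>\<mu>. finite {k. l k = \<mu>} \<and> multiplicity_of \<Omega> B \<mu> = enat (card {k. l k = \<mu>}))"

text \<open>The index n starts at 1. The enumeration is unique if it exists, and it exists for every
  nonempty bounded open \<Omega> because the spectrum is purely discrete.\<close>

definition magnetic_eigenvalue :: "nat \<Rightarrow> (real^2) set \<Rightarrow> real \<Rightarrow> real" where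
  "magnetic_eigenvalue n \<Omega> B = (THE l. eigenvalue_enumeration \<Omega> B l) (n - 1)"


section \<open>Minimization among sets of unit measure\<close>

definition admissible :: "(real^2) set \<Rightarrow> bool" where
  "admissible \<Omega> \<longleftrightarrow> open \<Omega> \<and> bounded \<Omega> \<and> measure lebesgue \<Omega> = 1"

definition is_minimizer :: "nat \<Rightarrow> real \<Rightarrow> (real^2) set \<Rightarrow> bool" where
  "is_minimizer n B \<Omega> \<longleftrightarrow> is_arg_min (\<lambda>\<Omega>. magnetic_eigenvalue n \<Omega> B) admissible \<Omega>"

definition minimal_eigenvalue :: "nat \<Rightarrow> real \<Rightarrow> real" where
  "minimal_eigenvalue n B = (LEAST x. \<exists>\<Omega>. admissible \<Omega> \<and> x = magnetic_eigenvalue n \<Omega> B)"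

definition splitting_pairs :: "nat \<Rightarrow> (nat \<times> real) set" where
  "splitting_pairs n = {1..n div 2} \<times> {0<..<1}"

definition splitting_value :: "nat \<Rightarrow> real \<Rightarrow> nat \<times> real \<Rightarrow> real" where
  "splitting_value n B = (\<lambda>(i, t).
     max (minimal_eigenvalue i (t * B) / t)
         (minimal_eigenvalue (n - i) ((1 - t) * B) / (1 - t)))"

definition scaled_translate :: "real \<Rightarrow> real^2 \<Rightarrow> (real^2) set \<Rightarrow> (real^2) set" where
  "scaled_translate s a \<Omega> = (\<lambda>x. a + s *\<^sub>R x) ` \<Omega>"

end

theory Submission
  imports Defs "HOL-Library.Function_Algebras"
begin

text \<open>
  The eigenvalues are governed by three properties of the closed magnetic form. By the min-max
  principle (\<open>eigenvalue_le_iff\<close>), the n-th eigenvalue of a bounded open set \<open>\<Omega>\<close> is at most \<open>\<mu>\<close>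
  iff its form domain contains an n-dimensional space on which the Rayleigh quotient is at most
  \<open>\<mu>\<close>. A dilation by s turns the field \<open>s\<^sup>2 B\<close> into B, and a translation is undone by a gauge
  factor, so the n-th eigenvalue of \<open>a + s \<Omega>\<close> at field B is that of \<open>\<Omega>\<close> at field \<open>s\<^sup>2 B\<close>,
  divided by \<open>s\<^sup>2\<close> (\<open>eigenvalue_scaling\<close>). On a disjoint union the form decouples, so the n-th
  eigenvalue of \<open>S \<union> S'\<close> is at most the maximum of the i-th of S and the (n - i)-th of S', and for
  a suitable i (possibly 0 or n) it also dominates both (\<open>union_eigenvalue_le\<close>,
  \<open>union_eigenvalue_ge\<close>).

  Placing scaled minimizers side by side shows that every splitting value bounds the minimal
  eigenvalue from above; a pair that attains the minimum thereby yields a minimizer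
  (\<open>splitting_configuration\<close>). Conversely, a minimizer that is a disjoint union of S, of measure t,
  and S', of measure 1 - t, has for a suitable i the i-th eigenvalue of S and the (n - i)-th of S'
  below the minimal eigenvalue, and by scaling these dominate the two entries of the splitting
  value at (i, t) (\<open>component_lower_bound\<close>). Exchanging the two components if necessary gives
  \<open>i \<le> n div 2\<close>.

  The point that needs an idea is to exclude i = 0 and i = n, where a single component of measure
  less than 1 would already have n eigenvalues up to the minimal one. Without a field a dilation of
  that component would lower its n-th eigenvalue, but with a field the dilated set sees a different
  field. Instead, some set W of arbitrarily little more measure than the component \<open>\<Omega>\<close> has a strictly
  smaller n-th eigenvalue (\<open>enlarged_domain_smaller_eigenvalue\<close>): let W be the union of infinitely
  many translates of \<open>\<Omega>\<close> by tiny amounts \<open>r k\<close> in one direction. Were the n-th eigenvalue of W not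
  smaller than that of \<open>\<Omega>\<close>, say \<open>\<mu>\<close>, equality in the min-max principle would produce, for each k, an
  eigenfunction of W for \<open>\<mu>\<close> that is a gauged translate by \<open>r k\<close> of an element of one fixed
  n-dimensional space on \<open>\<Omega>\<close>. The right edges of the supports of the nonzero elements of that
  space take at most n values, so infinitely many of
  the translated functions have distinct right edges and are linearly independent. This contradicts
  the finite multiplicity of \<open>\<mu>\<close>.

  All this rests on the existence of the eigenvalue sequence, which is defined through the
  multiplicities of an operator. The form on test functions is closable by integration by parts
  (\<open>mform_closable\<close>), the space of square-integrable functions is complete (\<open>L2_complete\<close>), and on a
  bounded set the form domain embeds compactly (\<open>Rellich\<close>). In this situation successive
  minimization of the Rayleigh quotient exhausts the spectrum (\<open>spectral_resolution\<close>).
\<close>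

section \<open>Hermitian forms\<close>

definition form_norm :: "('v \<Rightarrow> 'v \<Rightarrow> complex) \<Rightarrow> 'v \<Rightarrow> real" where
  "form_norm h u = sqrt (Re (h u u))"

definition form_Cauchy :: "('v::ab_group_add \<Rightarrow> 'v \<Rightarrow> complex) \<Rightarrow> (nat \<Rightarrow> 'v) \<Rightarrow> bool" where
  "form_Cauchy h s \<longleftrightarrow> (\<forall>e>0. \<exists>N. \<forall>k\<ge>N. \<forall>l\<ge>N. form_norm h (s k - s l) < e)"

text \<open>The norm of such a form may vanish on nonzero vectors: functions that agree almost
  everywhere are kept apart, and everything is stated modulo vectors of norm zero.\<close>

locale hermitian_form = vector_space sc
  for sc :: "complex \<Rightarrow> 'v::ab_group_add \<Rightarrow> 'v" +
  fixes D :: "'v set" and h :: "'v \<Rightarrow> 'v \<Rightarrow> complex"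
  assumes sub: "subspace D"
    and add_left: "u \<in> D \<Longrightarrow> v \<in> D \<Longrightarrow> w \<in> D \<Longrightarrow> h (u + v) w = h u w + h v w"
    and scale_left: "u \<in> D \<Longrightarrow> w \<in> D \<Longrightarrow> h (sc c u) w = c * h u w"
    and herm: "u \<in> D \<Longrightarrow> v \<in> D \<Longrightarrow> h v u = cnj (h u v)"
    and nonneg: "u \<in> D \<Longrightarrow> 0 \<le> Re (h u u)"
begin

lemma D_simps [simp]:
  shows "0 \<in> D" "u \<in> D \<Longrightarrow> v \<in> D \<Longrightarrow> u + v \<in> D" "u \<in> D \<Longrightarrow> sc c u \<in> D"
    "u \<in> D \<Longrightarrow> v \<in> D \<Longrightarrow> u - v \<in> D" "u \<in> D \<Longrightarrow> - u \<in> D"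
    "(\<And>i. i \<in> I \<Longrightarrow> f i \<in> D) \<Longrightarrow> sum f I \<in> D"
  using sub by (auto intro: subspace_0 subspace_add subspace_scale subspace_diff subspace_neg subspace_sum)

lemma add_right: "u \<in> D \<Longrightarrow> v \<in> D \<Longrightarrow> w \<in> D \<Longrightarrow> h w (u + v) = h w u + h w v"
  by (metis D_simps(2) add_left complex_cnj_add complex_cnj_cnj herm)

lemma scale_right: "u \<in> D \<Longrightarrow> w \<in> D \<Longrightarrow> h w (sc c u) = cnj c * h w u"
  by (metis D_simps(3) complex_cnj_mult herm scale_left)

lemma diff_left: "u \<in> D \<Longrightarrow> v \<in> D \<Longrightarrow> w \<in> D \<Longrightarrow> h (u - v) w = h u w - h v w"
  by (metis D_simps(4) add_left add_diff_cancel_right' diff_add_cancel)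

lemma diff_right: "u \<in> D \<Longrightarrow> v \<in> D \<Longrightarrow> w \<in> D \<Longrightarrow> h w (u - v) = h w u - h w v"
  by (metis D_simps(4) add_right add_diff_cancel_right' diff_add_cancel)

lemma zero_left [simp]: "w \<in> D \<Longrightarrow> h 0 w = 0"
  using diff_left[of w w w] by simp

lemma zero_right [simp]: "w \<in> D \<Longrightarrow> h w 0 = 0"
  using diff_right[of w w w] by simp

lemma sum_left:
  "finite I \<Longrightarrow> (\<And>i. i \<in> I \<Longrightarrow> f i \<in> D) \<Longrightarrow> w \<in> D \<Longrightarrow> h (sum f I) w = (\<Sum>i\<in>I. h (f i) w)"
  by (induction I rule: finite_induct) (auto simp: add_left)

lemma sum_right:
  "finite I \<Longrightarrow> (\<And>i. i \<in> I \<Longrightarrow> f i \<in> D) \<Longrightarrow> w \<in> D \<Longrightarrow> h w (sum f I) = (\<Sum>i\<in>I. h w (f i))"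
  by (induction I rule: finite_induct) (auto simp: add_right)

lemma form_norm_nonneg [simp]: "u \<in> D \<Longrightarrow> 0 \<le> form_norm h u"
  by (simp add: form_norm_def nonneg)

lemma form_norm_sq: "u \<in> D \<Longrightarrow> (form_norm h u)\<^sup>2 = Re (h u u)"
  by (simp add: form_norm_def nonneg)

lemma self_real: "u \<in> D \<Longrightarrow> h u u = of_real ((form_norm h u)\<^sup>2)"
  using herm[of u u] by (auto simp: complex_eq_iff form_norm_sq)

lemma form_norm_zero [simp]: "form_norm h 0 = 0"
  by (simp add: form_norm_def)

lemma form_norm_scale: "u \<in> D \<Longrightarrow> form_norm h (sc c u) = cmod c * form_norm h u"
proof -
  assume u: "u \<in> D"
  have "h (sc c u) (sc c u) = c * cnj c * h u u"
    using u by (simp add: scale_left scale_right)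
  also have "\<dots> = of_real ((cmod c)\<^sup>2 * Re (h u u))"
    using self_real[OF u] form_norm_sq[OF u] by (simp only: complex_norm_square[symmetric]) simp
  finally show ?thesis
    by (simp add: form_norm_def real_sqrt_mult)
qed

lemma quadratic_diff:
  assumes "u \<in> D" "v \<in> D"
  shows "Re (h (u - sc t v) (u - sc t v)) =
    Re (h u u) - 2 * Re (cnj t * h u v) + (cmod t)\<^sup>2 * Re (h v v)"
proof -
  have 1: "h (u - sc t v) (u - sc t v) =
      h u u - cnj t * h u v - (t * h v u - t * cnj t * h v v)"
    using assms by (simp add: diff_left diff_right scale_left scale_right algebra_simps)
  have 2: "Re (t * h v u) = Re (cnj t * h u v)"
    using herm[OF assms] by (simp add: algebra_simps)
  have 3: "Re (t * cnj t * h v v) = (cmod t)\<^sup>2 * Re (h v v)"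
    using self_real[OF assms(2)] form_norm_sq[OF assms(2)] by (simp only: complex_norm_square[symmetric]) simp
  show ?thesis unfolding 1 using 2 3 by simp
qed

text \<open>The form is nonnegative at \<open>u - t v\<close>, where t is a real multiple s of
  \<open>h u v\<close>; the best s gives the inequality, and for \<open>h v v = 0\<close> a
  large s shows \<open>h u v = 0\<close>.\<close>

lemma Cauchy_Schwarz:
  assumes u: "u \<in> D" and v: "v \<in> D"
  shows "cmod (h u v) \<le> form_norm h u * form_norm h v"
proof -
  let ?z = "h u v" and ?a = "Re (h u u)" and ?b = "Re (h v v)"
  have *: "0 \<le> ?a - 2 * s * (cmod ?z)\<^sup>2 + s\<^sup>2 * (cmod ?z)\<^sup>2 * ?b" for s
  proof -
    have "cnj (of_real s * ?z) * ?z = of_real (s * (cmod ?z)\<^sup>2)"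
      by (simp add: complex_norm_square mult.commute mult.left_commute del: of_real_power)
    then have "Re (cnj (of_real s * ?z) * ?z) = s * (cmod ?z)\<^sup>2"
      by (metis Re_complex_of_real)
    then show ?thesis
      using nonneg[of "u - sc (of_real s * ?z) v"] quadratic_diff[OF u v, of "of_real s * ?z"] u v
      by (simp add: norm_mult power_mult_distrib)
  qed
  have "(cmod ?z)\<^sup>2 \<le> ?a * ?b"
  proof (cases "?b = 0")
    case True
    have "cmod ?z = 0"
    proof (rule ccontr)
      assume "cmod ?z \<noteq> 0"
      then have "(cmod ?z)\<^sup>2 > 0" by simp
      then show False
        using *[of "(?a + 1) / (2 * (cmod ?z)\<^sup>2)"] True by (simp add: field_simps)
    qed
    then show ?thesis using True by simp
  next
    case False
    then have b: "?b > 0" using nonneg[OF v] by simp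
    have e: "(1 / ?b)\<^sup>2 * (cmod ?z)\<^sup>2 * ?b = (cmod ?z)\<^sup>2 / ?b"
      using b by (simp add: power2_eq_square)
    have "(cmod ?z)\<^sup>2 / ?b \<le> ?a"
      using *[of "1 / ?b"] unfolding e by simp
    then show ?thesis using b by (simp add: field_simps)
  qed
  then have "sqrt ((cmod ?z)\<^sup>2) \<le> sqrt (?a * ?b)"
    by (rule real_sqrt_le_mono)
  then show ?thesis by (simp add: form_norm_def real_sqrt_mult)
qed

lemma form_norm_triangle:
  assumes u: "u \<in> D" and v: "v \<in> D"
  shows "form_norm h (u + v) \<le> form_norm h u + form_norm h v"
proof -
  have "(form_norm h (u + v))\<^sup>2 = Re (h u u) + Re (h u v) + Re (h v u) + Re (h v v)"
    using u v by (simp add: form_norm_sq add_left add_right)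
  also have "\<dots> = (form_norm h u)\<^sup>2 + 2 * Re (h u v) + (form_norm h v)\<^sup>2"
    using herm[OF u v] by (simp add: form_norm_sq u v)
  also have "\<dots> \<le> (form_norm h u + form_norm h v)\<^sup>2"
    using Cauchy_Schwarz[OF u v] complex_Re_le_cmod[of "h u v"] by (simp add: power2_sum)
  finally show ?thesis
    by (rule power2_le_imp_le) (use u v in simp)
qed

lemma form_norm_minus_commute:
  assumes "u \<in> D" "v \<in> D" shows "form_norm h (u - v) = form_norm h (v - u)"
  using form_norm_scale[of "v - u" "-1"] assms by simp

lemma form_norm_triangle_sub:
  assumes "u \<in> D" "v \<in> D" "w \<in> D"
  shows "form_norm h (u - w) \<le> form_norm h (u - v) + form_norm h (v - w)"
  using form_norm_triangle[of "u - v" "v - w"] assms by simp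

lemma form_norm_diff_le:
  assumes "u \<in> D" "v \<in> D"
  shows "\<bar>form_norm h u - form_norm h v\<bar> \<le> form_norm h (u - v)"
  using form_norm_triangle[of "u - v" v] form_norm_triangle[of "v - u" u]
    form_norm_minus_commute[of u v] assms by simp

lemma parallelogram:
  assumes "u \<in> D" "v \<in> D"
  shows "Re (h (u - v) (u - v)) = 2 * Re (h u u) + 2 * Re (h v v) - Re (h (u + v) (u + v))"
  using assms by (simp add: add_left add_right diff_left diff_right)

lemma form_Cauchy_bounded:
  assumes "\<And>k. s k \<in> D" "form_Cauchy h s"
  obtains C where "C > 0" "\<And>k. form_norm h (s k) \<le> C"
proof -
  obtain N where N: "\<And>k. k \<ge> N \<Longrightarrow> form_norm h (s k - s N) < 1"
    using assms(2) unfolding form_Cauchy_def by (meson order_refl zero_less_one)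
  let ?C = "1 + Max ((\<lambda>k. form_norm h (s k)) ` {..N})"
  have M: "form_norm h (s k) \<le> Max ((\<lambda>k. form_norm h (s k)) ` {..N})" if "k \<le> N" for k
    using that by (intro Max_ge) auto
  have "form_norm h (s k) \<le> ?C" for k
  proof (cases "k \<le> N")
    case True then show ?thesis using M[OF True] by linarith
  next
    case False
    then have "form_norm h (s k - s N) < 1" using N by simp
    then show ?thesis using form_norm_diff_le[of "s k" "s N"] M[of N] assms(1)[of k] assms(1)[of N]
      by linarith
  qed
  moreover have "?C > 0" using M[of N] form_norm_nonneg[OF assms(1), of N] by linarith
  ultimately show ?thesis using that by blast
qed

lemma form_Cauchy_diff:
  assumes "\<And>k. s k \<in> D" "form_Cauchy h s" "\<And>k. t k \<in> D" "form_Cauchy h t"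
  shows "form_Cauchy h (\<lambda>k. s k - t k)"
  unfolding form_Cauchy_def
proof (intro allI impI)
  fix e :: real assume "e > 0"
  then obtain M N where M: "\<And>k l. k \<ge> M \<Longrightarrow> l \<ge> M \<Longrightarrow> form_norm h (s k - s l) < e/2"
    and N: "\<And>k l. k \<ge> N \<Longrightarrow> l \<ge> N \<Longrightarrow> form_norm h (t k - t l) < e/2"
    using assms(2,4) unfolding form_Cauchy_def by (meson half_gt_zero)
  have "form_norm h (s k - t k - (s l - t l)) < e" if "k \<ge> max M N" "l \<ge> max M N" for k l
  proof -
    have e: "s k - t k - (s l - t l) = (s k - s l) + (t l - t k)" by simp
    have "form_norm h (s k - t k - (s l - t l)) \<le> form_norm h (s k - s l) + form_norm h (t l - t k)"
      using form_norm_triangle[of "s k - s l" "t l - t k"] assms(1,3)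
      unfolding e by simp
    then show ?thesis using M[of k l] N[of l k] that by simp
  qed
  then show "\<exists>N. \<forall>k\<ge>N. \<forall>l\<ge>N. form_norm h (s k - t k - (s l - t l)) < e" by blast
qed

lemma form_Cauchy_scale:
  assumes "\<And>k. s k \<in> D" "form_Cauchy h s"
  shows "form_Cauchy h (\<lambda>k. sc c (s k))"
  unfolding form_Cauchy_def
proof (intro allI impI)
  fix e :: real assume "e > 0"
  moreover have "cmod c + 1 > 0" by (simp add: add_nonneg_pos)
  ultimately obtain N where N: "\<And>k l. k \<ge> N \<Longrightarrow> l \<ge> N \<Longrightarrow> form_norm h (s k - s l) < e / (cmod c + 1)"
    using assms(2) unfolding form_Cauchy_def by (meson divide_pos_pos)
  have "form_norm h (sc c (s k) - sc c (s l)) < e" if "k \<ge> N" "l \<ge> N" for k l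
  proof -
    have "form_norm h (sc c (s k) - sc c (s l)) = cmod c * form_norm h (s k - s l)"
      using assms(1) by (simp add: form_norm_scale flip: scale_right_diff_distrib)
    also have "\<dots> \<le> (cmod c + 1) * form_norm h (s k - s l)"
      using assms(1) by (simp add: mult_right_mono)
    also have "\<dots> < e"
      using N[OF that] \<open>cmod c + 1 > 0\<close> by (simp add: field_simps)
    finally show ?thesis .
  qed
  then show "\<exists>N. \<forall>k\<ge>N. \<forall>l\<ge>N. form_norm h (sc c (s k) - sc c (s l)) < e" by blast
qed

lemma form_Cauchy_add:
  assumes "\<And>k. s k \<in> D" "form_Cauchy h s" "\<And>k. t k \<in> D" "form_Cauchy h t"
  shows "form_Cauchy h (\<lambda>k. s k + t k)"
  using form_Cauchy_diff[of s "\<lambda>k. sc (-1) (t k)"] form_Cauchy_scale[of t "-1"] assms by simp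

lemma form_Cauchy_const: "form_Cauchy h (\<lambda>k. u)"
  by (simp add: form_Cauchy_def)

lemma form_convergent_imp_Cauchy:
  assumes "\<And>k. s k \<in> D" "u \<in> D" "(\<lambda>k. form_norm h (s k - u)) \<longlonglongrightarrow> 0"
  shows "form_Cauchy h s"
  unfolding form_Cauchy_def
proof (intro allI impI)
  fix e :: real assume "e > 0"
  then have "eventually (\<lambda>k. form_norm h (s k - u) < e/2) sequentially"
    using assms(3) by (intro order_tendstoD) auto
  then obtain N where N: "\<And>k. k \<ge> N \<Longrightarrow> form_norm h (s k - u) < e/2"
    by (auto simp: eventually_sequentially)
  have "form_norm h (s k - s l) < e" if "k \<ge> N" "l \<ge> N" for k l
    using form_norm_triangle_sub[of "s k" u "s l"] form_norm_minus_commute[of "s l" u] N[of k] N[of l] that assms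
    by fastforce
  then show "\<exists>N. \<forall>k\<ge>N. \<forall>l\<ge>N. form_norm h (s k - s l) < e" by blast
qed

lemma tendsto_form_norm:
  assumes "\<And>k. s k \<in> D" "u \<in> D" "(\<lambda>k. form_norm h (s k - u)) \<longlonglongrightarrow> 0"
  shows "(\<lambda>k. form_norm h (s k)) \<longlonglongrightarrow> form_norm h u"
proof (rule LIM_zero_cancel, rule Lim_null_comparison[OF _ assms(3)])
  show "\<forall>\<^sub>F k in sequentially. norm (form_norm h (s k) - form_norm h u) \<le> form_norm h (s k - u)"
    using form_norm_diff_le assms by simp
qed

lemma tendsto_form:
  assumes s: "\<And>k. s k \<in> D" "u \<in> D" "(\<lambda>k. form_norm h (s k - u)) \<longlonglongrightarrow> 0"
    and t: "\<And>k. t k \<in> D" "v \<in> D" "(\<lambda>k. form_norm h (t k - v)) \<longlonglongrightarrow> 0"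
  shows "(\<lambda>k. h (s k) (t k)) \<longlonglongrightarrow> h u v"
proof (rule LIM_zero_cancel, rule Lim_null_comparison)
  show "\<forall>\<^sub>F k in sequentially. norm (h (s k) (t k) - h u v) \<le>
      form_norm h (s k - u) * form_norm h (t k) + form_norm h u * form_norm h (t k - v)"
  proof (intro always_eventually allI)
    fix k
    have "h (s k) (t k) - h u v = h (s k - u) (t k) + h u (t k - v)"
      using s t by (simp add: diff_left diff_right)
    then have "norm (h (s k) (t k) - h u v) \<le> norm (h (s k - u) (t k)) + norm (h u (t k - v))"
      by (simp add: norm_triangle_ineq)
    also have "\<dots> \<le> form_norm h (s k - u) * form_norm h (t k) + form_norm h u * form_norm h (t k - v)"
      using s t by (intro add_mono Cauchy_Schwarz) auto
    finally show "norm (h (s k) (t k) - h u v) \<le>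
      form_norm h (s k - u) * form_norm h (t k) + form_norm h u * form_norm h (t k - v)" .
  qed
  show "(\<lambda>k. form_norm h (s k - u) * form_norm h (t k) + form_norm h u * form_norm h (t k - v)) \<longlonglongrightarrow> 0"
    using tendsto_add[OF tendsto_mult[OF s(3) tendsto_form_norm[OF t]] tendsto_mult_left[OF t(3), of "form_norm h u"]]
    by simp
qed

lemma hermitian_form_subspace:
  assumes "subspace D'" "D' \<subseteq> D" shows "hermitian_form sc D' h"
proof
  show "h v u = cnj (h u v)" if "u \<in> D'" "v \<in> D'" for u v
    using that assms(2) herm[of u v] by blast
next
  show "h (u + v) w = h u w + h v w" if "u \<in> D'" "v \<in> D'" "w \<in> D'" for u v w
    using that assms(2) add_left[of u v w] by blast
next
  show "h (sc c u) w = c * h u w" if "u \<in> D'" "w \<in> D'" for u w c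
    using that assms(2) scale_left[of u w c] by blast
qed (use assms nonneg in auto)

end

section \<open>The closure of a closable form\<close>

text \<open>The abstract situation of the Friedrichs extension: a form q on a space T of smooth
  vectors inside a complete space H. Closability says that completing T in the combined norm of
  ip and q does not leave H.\<close>

locale closable_form = vector_space sc + ip: hermitian_form sc H ip + q: hermitian_form sc T q
  for sc :: "complex \<Rightarrow> 'v::ab_group_add \<Rightarrow> 'v" and H T ip q +
  assumes T_sub_H: "T \<subseteq> H"
    and closable: "(\<And>k. s k \<in> T) \<Longrightarrow> (\<lambda>k. form_norm ip (s k)) \<longlonglongrightarrow> 0 \<Longrightarrow> form_Cauchy q s
      \<Longrightarrow> (\<lambda>k. form_norm q (s k)) \<longlonglongrightarrow> 0"
    and H_complete: "(\<And>k. s k \<in> H) \<Longrightarrow> form_Cauchy ip s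
      \<Longrightarrow> \<exists>u\<in>H. (\<lambda>k. form_norm ip (s k - u)) \<longlonglongrightarrow> 0"
begin

definition approx :: "(nat \<Rightarrow> 'v) \<Rightarrow> 'v \<Rightarrow> bool" where
  "approx s u \<longleftrightarrow> (\<forall>k. s k \<in> T) \<and> (\<lambda>k. form_norm ip (s k - u)) \<longlonglongrightarrow> 0 \<and> form_Cauchy q s"

definition Dom :: "'v set" where "Dom = {u \<in> H. \<exists>s. approx s u}"

definition Q :: "'v \<Rightarrow> 'v \<Rightarrow> complex" where
  "Q u v = (THE z. \<exists>s t. approx s u \<and> approx t v \<and> (\<lambda>k. q (s k) (t k)) \<longlonglongrightarrow> z)"

lemma T_in_H [simp, intro]: "u \<in> T \<Longrightarrow> u \<in> H" using T_sub_H by blast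

lemma approx_T: "approx s u \<Longrightarrow> s k \<in> T" by (simp add: approx_def)

lemma approx_const: "u \<in> T \<Longrightarrow> approx (\<lambda>k. u) u"
  by (simp add: approx_def q.form_Cauchy_const)

lemma approx_diff:
  assumes "u \<in> H" "v \<in> H" "approx s u" "approx t v"
  shows "approx (\<lambda>k. s k - t k) (u - v)"
proof -
  have *: "s k \<in> T" "t k \<in> T" "s k \<in> H" "t k \<in> H" for k using assms by (auto simp: approx_def)
  have "(\<lambda>k. form_norm ip (s k - t k - (u - v))) \<longlonglongrightarrow> 0"
  proof (rule Lim_null_comparison)
    show "\<forall>\<^sub>F k in sequentially. norm (form_norm ip (s k - t k - (u - v))) \<le>
        form_norm ip (s k - u) + form_norm ip (t k - v)"
    proof (intro always_eventually allI)
      fix k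
      have e: "s k - t k - (u - v) = (s k - u) + (v - t k)" by simp
      show "norm (form_norm ip (s k - t k - (u - v))) \<le> form_norm ip (s k - u) + form_norm ip (t k - v)"
        using ip.form_norm_triangle[of "s k - u" "v - t k"] ip.form_norm_minus_commute[of v "t k"] * assms(1,2)
        unfolding e by (simp add: ip.D_simps)
    qed
    show "(\<lambda>k. form_norm ip (s k - u) + form_norm ip (t k - v)) \<longlonglongrightarrow> 0"
      using assms by (auto simp: approx_def intro!: tendsto_add_zero)
  qed
  then show ?thesis
    using assms * q.form_Cauchy_diff[of s t] by (auto simp: approx_def)
qed

lemma approx_scale:
  assumes "u \<in> H" "approx s u"
  shows "approx (\<lambda>k. sc c (s k)) (sc c u)"
proof -
  have *: "s k \<in> T" "s k \<in> H" for k using assms by (auto simp: approx_def)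
  have "(\<lambda>k. form_norm ip (sc c (s k) - sc c u)) = (\<lambda>k. cmod c * form_norm ip (s k - u))"
    using * assms(1) by (simp add: ip.form_norm_scale flip: scale_right_diff_distrib)
  then show ?thesis
    using assms * q.form_Cauchy_scale[of s c] tendsto_mult_left[of "\<lambda>k. form_norm ip (s k - u)" 0 sequentially "cmod c"]
    by (auto simp: approx_def)
qed

lemma approx_zero_null:
  assumes "approx s 0" shows "(\<lambda>k. form_norm q (s k)) \<longlonglongrightarrow> 0"
  using assms closable[of s] by (simp add: approx_def)

lemma approx_add:
  assumes "u \<in> H" "v \<in> H" "approx s u" "approx t v"
  shows "approx (\<lambda>k. s k + t k) (u + v)"
  using approx_diff[OF assms(1) _ assms(3), of "- v" "\<lambda>k. sc (-1) (t k)"] approx_scale[OF assms(2,4), of "-1"] assms(2)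
  by simp

lemma approx_form_convergent:
  assumes "u \<in> H" "v \<in> H" "approx s u" "approx t v"
  shows "\<exists>z. (\<lambda>k. q (s k) (t k)) \<longlonglongrightarrow> z"
proof -
  have s: "s k \<in> T" "form_Cauchy q s" and t: "t k \<in> T" "form_Cauchy q t" for k
    using assms by (auto simp: approx_def)
  obtain A where A: "A > 0" "\<And>k. form_norm q (s k) \<le> A" using q.form_Cauchy_bounded s by blast
  obtain C where C: "C > 0" "\<And>k. form_norm q (t k) \<le> C" using q.form_Cauchy_bounded t by blast
  have "Cauchy (\<lambda>k. q (s k) (t k))"
  proof (rule metric_CauchyI)
    fix e :: real assume "e > 0"
    obtain M where M: "\<And>k l. k \<ge> M \<Longrightarrow> l \<ge> M \<Longrightarrow> form_norm q (s k - s l) < e / (2 * C)"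
      using s(2) \<open>e > 0\<close> C(1) unfolding form_Cauchy_def by (metis divide_pos_pos mult_pos_pos zero_less_numeral)
    obtain N where N: "\<And>k l. k \<ge> N \<Longrightarrow> l \<ge> N \<Longrightarrow> form_norm q (t k - t l) < e / (2 * A)"
      using t(2) \<open>e > 0\<close> A(1) unfolding form_Cauchy_def by (metis divide_pos_pos mult_pos_pos zero_less_numeral)
    have "dist (q (s k) (t k)) (q (s l) (t l)) < e" if kl: "k \<ge> max M N" "l \<ge> max M N" for k l
    proof -
      have "q (s k) (t k) - q (s l) (t l) = q (s k - s l) (t k) + q (s l) (t k - t l)"
        using s t by (simp add: q.diff_left q.diff_right)
      then have "dist (q (s k) (t k)) (q (s l) (t l)) \<le> cmod (q (s k - s l) (t k)) + cmod (q (s l) (t k - t l))"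
        by (simp add: dist_norm norm_triangle_ineq)
      also have "\<dots> \<le> form_norm q (s k - s l) * form_norm q (t k) + form_norm q (s l) * form_norm q (t k - t l)"
        using s t by (intro add_mono q.Cauchy_Schwarz) auto
      also have "\<dots> \<le> form_norm q (s k - s l) * C + A * form_norm q (t k - t l)"
        using s t A C by (intro add_mono mult_left_mono mult_right_mono) auto
      also have "\<dots> < e / (2 * C) * C + A * (e / (2 * A))"
        using kl A C M[of k l] N[of k l] by (intro add_strict_mono mult_strict_right_mono mult_strict_left_mono) auto
      also have "\<dots> = e" using A C by simp
      finally show ?thesis .
    qed
    then show "\<exists>M. \<forall>m\<ge>M. \<forall>n\<ge>M. dist (q (s m) (t m)) (q (s n) (t n)) < e" by blast
  qed
  then show ?thesis by (simp add: Cauchy_convergent_iff convergent_def)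
qed

text \<open>Two approximating sequences of the same vector differ by a null sequence for ip that
  is Cauchy for q; by closability it is null for q as well.\<close>

lemma approx_form_unique:
  assumes "u \<in> H" "v \<in> H" and s: "approx s u" "approx s' u" and t: "approx t v" "approx t' v"
    and lim: "(\<lambda>k. q (s k) (t k)) \<longlonglongrightarrow> z" "(\<lambda>k. q (s' k) (t' k)) \<longlonglongrightarrow> z'"
  shows "z = z'"
proof -
  have T: "s k \<in> T" "t k \<in> T" "s' k \<in> T" "t' k \<in> T" for k using s t by (auto simp: approx_def)
  have ds: "(\<lambda>k. form_norm q (s k - s' k)) \<longlonglongrightarrow> 0"
    using approx_zero_null[of "\<lambda>k. s k - s' k"] approx_diff[OF assms(1,1) s] by simp
  have dt: "(\<lambda>k. form_norm q (t k - t' k)) \<longlonglongrightarrow> 0"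
    using approx_zero_null[of "\<lambda>k. t k - t' k"] approx_diff[OF assms(2,2) t] by simp
  obtain A where A: "\<And>k. form_norm q (s' k) \<le> A" using q.form_Cauchy_bounded[of s'] s T unfolding approx_def by metis
  obtain C where C: "\<And>k. form_norm q (t k) \<le> C" using q.form_Cauchy_bounded[of t] t T unfolding approx_def by metis
  have "(\<lambda>k. q (s k) (t k) - q (s' k) (t' k)) \<longlonglongrightarrow> 0"
  proof (rule Lim_null_comparison)
    show "\<forall>\<^sub>F k in sequentially. norm (q (s k) (t k) - q (s' k) (t' k)) \<le>
        form_norm q (s k - s' k) * C + A * form_norm q (t k - t' k)"
    proof (intro always_eventually allI)
      fix k
      have "q (s k) (t k) - q (s' k) (t' k) = q (s k - s' k) (t k) + q (s' k) (t k - t' k)"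
        using T by (simp add: q.diff_left q.diff_right)
      then have "norm (q (s k) (t k) - q (s' k) (t' k)) \<le> cmod (q (s k - s' k) (t k)) + cmod (q (s' k) (t k - t' k))"
        by (simp add: norm_triangle_ineq)
      also have "\<dots> \<le> form_norm q (s k - s' k) * form_norm q (t k) + form_norm q (s' k) * form_norm q (t k - t' k)"
        using T by (intro add_mono q.Cauchy_Schwarz) auto
      also have "\<dots> \<le> form_norm q (s k - s' k) * C + A * form_norm q (t k - t' k)"
        using T A C by (intro add_mono mult_left_mono mult_right_mono) auto
      finally show "norm (q (s k) (t k) - q (s' k) (t' k)) \<le>
        form_norm q (s k - s' k) * C + A * form_norm q (t k - t' k)" .
    qed
    show "(\<lambda>k. form_norm q (s k - s' k) * C + A * form_norm q (t k - t' k)) \<longlonglongrightarrow> 0"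
      using tendsto_add[OF tendsto_mult_right[OF ds, of C] tendsto_mult_left[OF dt, of A]] by simp
  qed
  moreover have "(\<lambda>k. q (s k) (t k) - q (s' k) (t' k)) \<longlonglongrightarrow> z - z'"
    using lim by (rule tendsto_diff)
  ultimately show ?thesis using LIMSEQ_unique by fastforce
qed

lemma approx_form_limit:
  assumes "u \<in> H" "v \<in> H" "approx s u" "approx t v"
  shows "(\<lambda>k. q (s k) (t k)) \<longlonglongrightarrow> Q u v"
proof -
  obtain z where z: "(\<lambda>k. q (s k) (t k)) \<longlonglongrightarrow> z" using approx_form_convergent[OF assms] by blast
  have "Q u v = z" unfolding Q_def
    using z assms approx_form_unique[OF assms(1,2)] by (intro the_equality) blast+
  then show ?thesis using z by simp
qed

lemma Q_on_T: "u \<in> T \<Longrightarrow> v \<in> T \<Longrightarrow> Q u v = q u v"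
  using approx_form_limit[OF _ _ approx_const approx_const, of u v] LIMSEQ_unique tendsto_const by blast

lemma T_in_Dom: "u \<in> T \<Longrightarrow> u \<in> Dom"
  unfolding Dom_def using approx_const by blast

lemma Dom_in_H [simp, intro]: "u \<in> Dom \<Longrightarrow> u \<in> H"
  by (simp add: Dom_def)

lemma hermitian_Q: "hermitian_form sc Dom Q"
proof
  show "subspace Dom"
    unfolding subspace_def
  proof (intro conjI ballI allI)
    show "0 \<in> Dom" using T_in_Dom[of 0] by simp
  next
    fix u v assume uv: "u \<in> Dom" "v \<in> Dom"
    then obtain s t where "approx s u" "approx t v" unfolding Dom_def by blast
    then have "approx (\<lambda>k. s k + t k) (u + v)" using uv by (intro approx_add) auto
    then show "u + v \<in> Dom" using uv unfolding Dom_def by auto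
  next
    fix c u assume u: "u \<in> Dom"
    then obtain s where "approx s u" unfolding Dom_def by blast
    then have "approx (\<lambda>k. sc c (s k)) (sc c u)" using u by (intro approx_scale) auto
    then show "sc c u \<in> Dom" using u unfolding Dom_def by auto
  qed
next
  fix u v w assume uvw: "u \<in> Dom" "v \<in> Dom" "w \<in> Dom"
  then obtain r s t where a: "approx r u" "approx s v" "approx t w" unfolding Dom_def by blast
  have "(\<lambda>k. q (r k + s k) (t k)) \<longlonglongrightarrow> Q (u + v) w"
    using a uvw by (intro approx_form_limit approx_add) auto
  moreover have "(\<lambda>k. q (r k + s k) (t k)) \<longlonglongrightarrow> Q u w + Q v w"
    using tendsto_add[OF approx_form_limit[OF _ _ a(1,3)] approx_form_limit[OF _ _ a(2,3)]] uvw a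
    by (simp add: q.add_left approx_T)
  ultimately show "Q (u + v) w = Q u w + Q v w" using LIMSEQ_unique by blast
next
  fix u w c assume uw: "u \<in> Dom" "w \<in> Dom"
  then obtain r t where a: "approx r u" "approx t w" unfolding Dom_def by blast
  have "(\<lambda>k. q (sc c (r k)) (t k)) \<longlonglongrightarrow> Q (sc c u) w"
    using a uw by (intro approx_form_limit approx_scale) auto
  moreover have "(\<lambda>k. q (sc c (r k)) (t k)) \<longlonglongrightarrow> c * Q u w"
    using tendsto_mult_left[OF approx_form_limit[OF _ _ a]] uw a by (simp add: q.scale_left approx_T)
  ultimately show "Q (sc c u) w = c * Q u w" using LIMSEQ_unique by blast
next
  fix u v assume uv: "u \<in> Dom" "v \<in> Dom"
  then obtain r t where a: "approx r u" "approx t v" unfolding Dom_def by blast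
  have "q (t k) (r k) = cnj (q (r k) (t k))" for k using a q.herm approx_T by blast
  then have "(\<lambda>k. q (t k) (r k)) \<longlonglongrightarrow> cnj (Q u v)"
    using tendsto_cnj[OF approx_form_limit[OF _ _ a]] uv by simp
  then show "Q v u = cnj (Q u v)" using approx_form_limit[OF _ _ a(2,1)] uv LIMSEQ_unique by blast
next
  fix u assume u: "u \<in> Dom"
  then obtain r where a: "approx r u" unfolding Dom_def by blast
  then have "(\<lambda>k. Re (q (r k) (r k))) \<longlonglongrightarrow> Re (Q u u)"
    using approx_form_limit[OF _ _ a a] u by (intro tendsto_Re) auto
  then show "0 \<le> Re (Q u u)" using a q.nonneg approx_T by (intro LIMSEQ_le_const) auto
qed

sublocale Q: hermitian_form sc Dom Q by (rule hermitian_Q)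

lemma approx_norm_limit:
  assumes "u \<in> H" "approx s u" shows "(\<lambda>k. form_norm q (s k)) \<longlonglongrightarrow> form_norm Q u"
  using approx_form_limit[OF assms(1,1) assms(2,2)] unfolding form_norm_def
  by (intro tendsto_real_sqrt tendsto_Re)

text \<open>For fixed k, the differences \<open>s k - s l\<close> approximate \<open>s k -
  u\<close>, so the q-Cauchy condition on s survives the limit in l.\<close>

lemma approx_Q_limit:
  assumes u: "u \<in> H" and s: "approx s u" shows "(\<lambda>k. form_norm Q (s k - u)) \<longlonglongrightarrow> 0"
proof (rule LIMSEQ_I)
  fix e :: real assume "e > 0"
  obtain N where N: "\<And>k l. k \<ge> N \<Longrightarrow> l \<ge> N \<Longrightarrow> form_norm q (s k - s l) < e/2"
    using s \<open>e > 0\<close> unfolding approx_def form_Cauchy_def by (meson half_gt_zero)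
  have "norm (form_norm Q (s k - u) - 0) < e" if k: "k \<ge> N" for k
  proof -
    have T: "s k \<in> T" using s approx_T by blast
    have D: "u \<in> Dom" "s k \<in> Dom" using u s T T_in_Dom unfolding Dom_def by blast+
    have "(\<lambda>l. form_norm q (s k - s l)) \<longlonglongrightarrow> form_norm Q (s k - u)"
      using T u s by (intro approx_norm_limit approx_diff approx_const) auto
    then have "form_norm Q (s k - u) \<le> e/2"
      using N[OF k] by (intro LIMSEQ_le_const2) (auto intro!: exI[of _ N] less_imp_le)
    then show ?thesis using \<open>e > 0\<close> D by simp
  qed
  then show "\<exists>N. \<forall>k\<ge>N. norm (form_norm Q (s k - u) - 0) < e" by blast
qed

lemma Dom_approximation:
  assumes u: "u \<in> Dom" and e: "e > 0"
  obtains t where "t \<in> T" "form_norm ip (u - t) < e" "form_norm Q (u - t) < e"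
proof -
  obtain s where s: "approx s u" using u unfolding Dom_def by blast
  have "\<forall>\<^sub>F k in sequentially. form_norm ip (s k - u) < e"
    using s e by (intro order_tendstoD) (auto simp: approx_def)
  moreover have "\<forall>\<^sub>F k in sequentially. form_norm Q (s k - u) < e"
    using approx_Q_limit[OF _ s] u e by (intro order_tendstoD) auto
  ultimately have "\<forall>\<^sub>F k in sequentially. form_norm ip (s k - u) < e \<and> form_norm Q (s k - u) < e"
    by eventually_elim simp
  then obtain k where k: "form_norm ip (s k - u) < e" "form_norm Q (s k - u) < e"
    using eventually_happens by fastforce
  moreover have "s k \<in> T" using s approx_T by blast
  ultimately show ?thesis
    using that[of "s k"] u T_in_Dom ip.form_norm_minus_commute[of u "s k"] Q.form_norm_minus_commute[of u "s k"]
    by auto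
qed

text \<open>A Cauchy sequence of the domain is shadowed by a sequence in T with the same limit,
  which approximates that limit in the sense of \<open>approx\<close>.\<close>

lemma Dom_complete:
  assumes s: "\<And>k. s k \<in> Dom" and c: "form_Cauchy ip s" "form_Cauchy Q s"
  shows "\<exists>u\<in>Dom. (\<lambda>k. form_norm ip (s k - u)) \<longlonglongrightarrow> 0 \<and> (\<lambda>k. form_norm Q (s k - u)) \<longlonglongrightarrow> 0"
proof -
  have "\<exists>t\<in>T. form_norm ip (s k - t) < inverse (Suc k) \<and> form_norm Q (s k - t) < inverse (Suc k)" for k
    using Dom_approximation[OF s[of k], of "inverse (Suc k)"] by (metis inverse_positive_iff_positive of_nat_0_less_iff zero_less_Suc)
  then obtain t where t: "\<And>k. t k \<in> T" "\<And>k. form_norm ip (s k - t k) < inverse (Suc k)"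
    "\<And>k. form_norm Q (s k - t k) < inverse (Suc k)" by metis
  have TD: "t k \<in> Dom" for k using t T_in_Dom by blast
  have ip0: "(\<lambda>k. form_norm ip (s k - t k)) \<longlonglongrightarrow> 0"
    using t(2) s t(1) by (intro tendsto_sandwich[OF always_eventually always_eventually tendsto_const LIMSEQ_inverse_real_of_nat])
      (auto intro: less_imp_le)
  have Q0: "(\<lambda>k. form_norm Q (s k - t k)) \<longlonglongrightarrow> 0"
    using t(3) s TD by (intro tendsto_sandwich[OF always_eventually always_eventually tendsto_const LIMSEQ_inverse_real_of_nat])
      (auto intro: less_imp_le)
  obtain u where u: "u \<in> H" "(\<lambda>k. form_norm ip (s k - u)) \<longlonglongrightarrow> 0"
    using H_complete[of s] s c(1) by auto
  have "form_Cauchy Q (\<lambda>k. s k - (s k - t k))"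
  proof (rule Q.form_Cauchy_diff)
    show "form_Cauchy Q (\<lambda>k. s k - t k)"
      using Q.form_convergent_imp_Cauchy[of "\<lambda>k. s k - t k" 0] Q0 s TD by simp
  qed (use s TD c in auto)
  then have "form_Cauchy Q t" by simp
  moreover have "form_norm Q (t k - t l) = form_norm q (t k - t l)" for k l
    using t(1) by (simp add: form_norm_def Q_on_T)
  ultimately have "form_Cauchy q t" by (simp add: form_Cauchy_def)
  moreover have "(\<lambda>k. form_norm ip (t k - u)) \<longlonglongrightarrow> 0"
  proof (rule Lim_null_comparison)
    show "\<forall>\<^sub>F k in sequentially. norm (form_norm ip (t k - u)) \<le> form_norm ip (s k - t k) + form_norm ip (s k - u)"
      using ip.form_norm_triangle_sub[of "t _" "s _" u] ip.form_norm_minus_commute[of "t _" "s _"] s t(1) u(1)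
      by (intro always_eventually allI) (fastforce simp: ip.D_simps)
    show "(\<lambda>k. form_norm ip (s k - t k) + form_norm ip (s k - u)) \<longlonglongrightarrow> 0"
      using tendsto_add[OF ip0 u(2)] by simp
  qed
  ultimately have a: "approx t u" using t(1) by (simp add: approx_def)
  then have uD: "u \<in> Dom" using u(1) unfolding Dom_def by blast
  have "(\<lambda>k. form_norm Q (s k - u)) \<longlonglongrightarrow> 0"
  proof (rule Lim_null_comparison)
    show "\<forall>\<^sub>F k in sequentially. norm (form_norm Q (s k - u)) \<le> form_norm Q (s k - t k) + form_norm Q (t k - u)"
      using Q.form_norm_triangle_sub[of "s _" "t _" u] s TD uD
      by (intro always_eventually allI) (fastforce simp: Q.D_simps)
    show "(\<lambda>k. form_norm Q (s k - t k) + form_norm Q (t k - u)) \<longlonglongrightarrow> 0"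
      using tendsto_add[OF Q0 approx_Q_limit[OF u(1) a]] by simp
  qed
  then show ?thesis using uD u(2) by blast
qed

end

section \<open>Spectral resolution of a form with compact embedding\<close>

text \<open>Gaussian elimination: the last equation is solved for one unknown, which leaves a
  system with one equation and one unknown less.\<close>

lemma homogeneous_system_nontrivial:
  fixes A :: "nat \<Rightarrow> 'i \<Rightarrow> 'a::field"
  assumes "finite J" "m < card J"
  shows "\<exists>c. (\<exists>j\<in>J. c j \<noteq> 0) \<and> (\<forall>i<m. (\<Sum>j\<in>J. A i j * c j) = 0)"
  using assms
proof (induction m arbitrary: A J)
  case 0
  then obtain j where "j \<in> J" by fastforce
  then show ?case by (intro exI[of _ "\<lambda>_. 1"]) auto
next
  case (Suc m)
  show ?case
  proof (cases "\<forall>j\<in>J. A m j = 0")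
    case True
    obtain c where "\<exists>j\<in>J. c j \<noteq> 0" "\<forall>i<m. (\<Sum>j\<in>J. A i j * c j) = 0"
      using Suc.IH[of J A] Suc.prems by auto
    then show ?thesis using True by (intro exI[of _ c]) (auto simp: less_Suc_eq)
  next
    case False
    then obtain p where p: "p \<in> J" "A m p \<noteq> 0" by blast
    \<comment> \<open>the equations after elimination of the unknown p by means of equation
      m\<close>
    define A' where "A' = (\<lambda>i j. A i j - A i p / A m p * A m j)"
    have "m < card (J - {p})" "finite (J - {p})" using Suc.prems p by auto
    then obtain c where c: "\<exists>j\<in>J - {p}. c j \<noteq> 0" "\<And>i. i < m \<Longrightarrow> (\<Sum>j\<in>J - {p}. A' i j * c j) = 0"
      using Suc.IH[of "J - {p}" A'] by auto
    define s where "s = (\<Sum>j\<in>J - {p}. A m j * c j)"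
    define c' where "c' = c(p := - s / A m p)"
    have split: "(\<Sum>j\<in>J. A i j * c' j) = A i p * (- s / A m p) + (\<Sum>j\<in>J - {p}. A i j * c j)" for i
      using Suc.prems(1) p(1) unfolding c'_def by (subst sum.remove[of J p]) (auto intro!: sum.cong)
    have "(\<Sum>j\<in>J. A i j * c' j) = 0" if "i < Suc m" for i
    proof (cases "i = m")
      case True
      then show ?thesis using split[of m] p(2) by (simp add: s_def)
    next
      case False
      then have "0 = (\<Sum>j\<in>J - {p}. A i j * c j - A i p / A m p * (A m j * c j))"
        using c(2)[of i] that by (simp add: A'_def algebra_simps)
      also have "\<dots> = (\<Sum>j\<in>J - {p}. A i j * c j) - A i p / A m p * s"
        by (simp add: s_def sum_subtractf sum_distrib_left)
      finally show ?thesis using split[of i] by simp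
    qed
    moreover have "\<exists>j\<in>J. c' j \<noteq> 0" using c(1) unfolding c'_def by auto
    ultimately show ?thesis by blast
  qed
qed

definition lin_comb :: "(complex \<Rightarrow> 'v::ab_group_add \<Rightarrow> 'v) \<Rightarrow> nat \<Rightarrow> (nat \<Rightarrow> complex) \<Rightarrow> (nat \<Rightarrow> 'v) \<Rightarrow> 'v" where
  "lin_comb sc n c u = (\<Sum>j<n. sc (c j) (u j))"

context hermitian_form
begin

text \<open>Independence modulo vectors of norm zero. For the \<open>L\<^sup>2\<close> inner
  product this is independence modulo null sets.\<close>

definition indep :: "nat \<Rightarrow> (nat \<Rightarrow> 'v) \<Rightarrow> bool" where
  "indep n u \<longleftrightarrow> (\<forall>c. form_norm h (lin_comb sc n c u) = 0 \<longrightarrow> (\<forall>j<n. c j = 0))"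

definition orthonormal :: "(nat \<Rightarrow> 'v) \<Rightarrow> bool" where
  "orthonormal e \<longleftrightarrow> (\<forall>i j. h (e i) (e j) = (if i = j then 1 else 0))"

definition perp :: "(nat \<Rightarrow> 'v) \<Rightarrow> nat \<Rightarrow> 'v set" where
  "perp e k = {u \<in> D. \<forall>i<k. h u (e i) = 0}"

lemma lin_comb_in: "(\<And>j. j < n \<Longrightarrow> u j \<in> D) \<Longrightarrow> lin_comb sc n c u \<in> D"
  unfolding lin_comb_def by (intro D_simps(6) D_simps(3)) auto

lemma perp_in: "u \<in> perp e k \<Longrightarrow> u \<in> D" by (simp add: perp_def)

lemma lin_comb_left:
  "(\<And>j. j < n \<Longrightarrow> u j \<in> D) \<Longrightarrow> w \<in> D \<Longrightarrow> h (lin_comb sc n c u) w = (\<Sum>j<n. c j * h (u j) w)"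
  unfolding lin_comb_def by (subst sum_left) (auto simp: scale_left)

lemma lin_comb_right:
  "(\<And>j. j < n \<Longrightarrow> u j \<in> D) \<Longrightarrow> w \<in> D \<Longrightarrow> h w (lin_comb sc n c u) = (\<Sum>j<n. cnj (c j) * h w (u j))"
  unfolding lin_comb_def by (subst sum_right) (auto simp: scale_right)

text \<open>The dimension count behind every min-max argument.\<close>

lemma indep_imp_perp_vector:
  assumes "\<And>j. j < n \<Longrightarrow> u j \<in> D" "indep n u" "m < n" "\<And>i. i < m \<Longrightarrow> e i \<in> D"
  obtains c where "\<exists>j<n. c j \<noteq> 0" "lin_comb sc n c u \<in> perp e m" "form_norm h (lin_comb sc n c u) > 0"
proof -
  obtain c where c: "\<exists>j\<in>{..<n}. c j \<noteq> 0" "\<And>i. i < m \<Longrightarrow> (\<Sum>j<n. h (u j) (e i) * c j) = 0"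
    using homogeneous_system_nontrivial[of "{..<n}" m "\<lambda>i j. h (u j) (e i)"] assms(3) by auto
  have "lin_comb sc n c u \<in> perp e m"
    using assms c(2) by (auto simp: perp_def lin_comb_in lin_comb_left mult.commute)
  moreover have "form_norm h (lin_comb sc n c u) \<noteq> 0"
    using assms(2) c(1) unfolding indep_def by blast
  ultimately show ?thesis
    using that[of c] c(1) form_norm_nonneg[OF lin_comb_in[of n u c, OF assms(1)]] by fastforce
qed

lemma orthogonal_lin_comb:
  assumes "\<And>j. j < n \<Longrightarrow> u j \<in> D" "\<And>i j. i < n \<Longrightarrow> j < n \<Longrightarrow> i \<noteq> j \<Longrightarrow> h (u i) (u j) = 0"
  shows "Re (h (lin_comb sc n c u) (lin_comb sc n c u)) = (\<Sum>j<n. (cmod (c j))\<^sup>2 * Re (h (u j) (u j)))"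
proof -
  have "h (lin_comb sc n c u) (lin_comb sc n c u) = (\<Sum>j<n. c j * (\<Sum>i<n. cnj (c i) * h (u j) (u i)))"
    using assms(1) lin_comb_in[of n u c] by (subst lin_comb_left) (auto simp: lin_comb_right)
  also have "\<dots> = (\<Sum>j<n. c j * (cnj (c j) * h (u j) (u j)))"
  proof (intro sum.cong refl)
    fix j assume j: "j \<in> {..<n}"
    have "(\<Sum>i<n. cnj (c i) * h (u j) (u i)) = (\<Sum>i<n. if i = j then cnj (c j) * h (u j) (u j) else 0)"
      using j assms(2) by (intro sum.cong) auto
    then show "c j * (\<Sum>i<n. cnj (c i) * h (u j) (u i)) = c j * (cnj (c j) * h (u j) (u j))"
      using j by simp
  qed
  also have "\<dots> = (\<Sum>j<n. of_real ((cmod (c j))\<^sup>2 * Re (h (u j) (u j))))"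
  proof (intro sum.cong refl)
    fix j assume "j \<in> {..<n}"
    then have "h (u j) (u j) = of_real (Re (h (u j) (u j)))"
      using self_real[of "u j"] form_norm_sq[of "u j"] assms(1) by simp
    then show "c j * (cnj (c j) * h (u j) (u j)) = of_real ((cmod (c j))\<^sup>2 * Re (h (u j) (u j)))"
      by (metis (no_types) complex_norm_square mult.assoc of_real_mult)
  qed
  finally show ?thesis by simp
qed

lemma orthogonal_indep:
  assumes "\<And>j. j < n \<Longrightarrow> u j \<in> D" "\<And>i j. i < n \<Longrightarrow> j < n \<Longrightarrow> i \<noteq> j \<Longrightarrow> h (u i) (u j) = 0"
    "\<And>j. j < n \<Longrightarrow> h (u j) (u j) \<noteq> 0"
  shows "indep n u"
  unfolding indep_def
proof (intro allI impI)
  fix c j assume 0: "form_norm h (lin_comb sc n c u) = 0" and j: "j < n"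
  have pos: "Re (h (u i) (u i)) > 0" if "i < n" for i
    using assms(3)[OF that] self_real[OF assms(1)[OF that]] nonneg[OF assms(1)[OF that]]
      form_norm_sq[OF assms(1)[OF that]] by (metis less_eq_real_def of_real_0)
  have "(\<Sum>j<n. (cmod (c j))\<^sup>2 * Re (h (u j) (u j))) = 0"
    using 0 orthogonal_lin_comb[of n u c, OF assms(1,2)] form_norm_sq[OF lin_comb_in[of n u c, OF assms(1)]] by simp
  then have "(cmod (c j))\<^sup>2 * Re (h (u j) (u j)) = 0"
    using j pos by (subst (asm) sum_nonneg_eq_0_iff) (auto intro!: mult_nonneg_nonneg intro: less_imp_le)
  then show "c j = 0" using pos[OF j] by simp
qed

lemma orthonormal_indep:
  assumes "\<And>j. j < n \<Longrightarrow> u j \<in> D" "orthonormal u" shows "indep n u"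
  using assms by (intro orthogonal_indep) (auto simp: orthonormal_def)

end

text \<open>At the first index where two sequences with these properties differ, the smaller of
  the two values occurs less often in the other sequence.\<close>

lemma enumeration_unique:
  fixes l l' :: "nat \<Rightarrow> real"
  assumes m: "mono l" "mono l'" and fin: "\<And>\<mu>. finite {k. l k = \<mu>}" "\<And>\<mu>. finite {k. l' k = \<mu>}"
    and card: "\<And>\<mu>. card {k. l k = \<mu>} = card {k. l' k = \<mu>}"
  shows "l = l'"
proof
  have aux: "\<not> f k < g k"
    if fg: "mono f" "mono g" "\<And>\<mu>. finite {k. f k = \<mu>}" "\<And>\<mu>. card {k. f k = \<mu>} = card {k. g k = \<mu>}"
      "\<And>j. j < k \<Longrightarrow> f j = g j" for f g :: "nat \<Rightarrow> real" and k
  proof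
    assume less: "f k < g k"
    have "{j. g j = f k} \<subseteq> {j. f j = f k} - {k}"
    proof
      fix j assume j: "j \<in> {j. g j = f k}"
      then have "j < k" using less monoD[OF fg(2), of k j] by (metis leD leI mem_Collect_eq)
      then show "j \<in> {j. f j = f k} - {k}" using j fg(5) by auto
    qed
    then have "card {j. g j = f k} \<le> card ({j. f j = f k} - {k})" using fg(3) by (intro card_mono) auto
    also have "\<dots> < card {j. f j = f k}" using fg(3) by (intro psubset_card_mono) auto
    finally show False using fg(4) by simp
  qed
  fix k show "l k = l' k"
  proof (induction k rule: less_induct)
    case (less k)
    then show ?case using aux[of l l' k] aux[of l' l k] m fin card by fastforce
  qed
qed

text \<open>A closed form q whose domain D is compactly embedded. The orthogonal sequence b
  makes D infinite-dimensional, so that the sequence of eigenvalues does not break off.\<close>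

locale compact_form_pair = vector_space sc + ip: hermitian_form sc D ip + q: hermitian_form sc D q
  for sc :: "complex \<Rightarrow> 'v::ab_group_add \<Rightarrow> 'v" and D ip q +
  assumes compact: "(\<And>k. s k \<in> D) \<Longrightarrow> (\<And>k. form_norm ip (s k) \<le> C) \<Longrightarrow> (\<And>k. form_norm q (s k) \<le> C)
      \<Longrightarrow> \<exists>r. strict_mono r \<and> form_Cauchy ip (\<lambda>k. s (r k))"
    and complete: "(\<And>k. s k \<in> D) \<Longrightarrow> form_Cauchy ip s \<Longrightarrow> form_Cauchy q s
      \<Longrightarrow> \<exists>u\<in>D. (\<lambda>k. form_norm ip (s k - u)) \<longlonglongrightarrow> 0 \<and> (\<lambda>k. form_norm q (s k - u)) \<longlonglongrightarrow> 0"
    and infinite_dim: "\<exists>b :: nat \<Rightarrow> 'v. \<forall>i. b i \<in> D \<and> ip (b i) (b i) \<noteq> 0 \<and> (\<forall>j. j \<noteq> i \<longrightarrow> ip (b i) (b j) = 0)"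
begin

definition eigvec :: "real \<Rightarrow> 'v \<Rightarrow> bool" where
  "eigvec \<mu> u \<longleftrightarrow> u \<in> D \<and> (\<forall>v\<in>D. q u v = of_real \<mu> * ip u v)"

lemma eigvec_orthogonal:
  assumes "eigvec \<mu> u" "eigvec \<nu> v" "\<mu> \<noteq> \<nu>" shows "ip u v = 0"
proof -
  have D: "u \<in> D" "v \<in> D" using assms by (auto simp: eigvec_def)
  have "of_real \<mu> * ip u v = q u v" using assms D by (simp add: eigvec_def)
  also have "\<dots> = cnj (q v u)" using q.herm D by blast
  also have "\<dots> = of_real \<nu> * cnj (ip v u)" using assms D by (simp add: eigvec_def)
  also have "\<dots> = of_real \<nu> * ip u v" using ip.herm[OF D(2,1)] by simp
  finally show ?thesis using assms(3) by simp
qed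

lemma eigvec_lin_comb:
  assumes "\<And>j. j < n \<Longrightarrow> eigvec \<mu> (u j)" shows "eigvec \<mu> (lin_comb sc n c u)"
  using assms unfolding eigvec_def
  by (auto simp: q.lin_comb_left ip.lin_comb_left q.lin_comb_in sum_distrib_left mult.left_commute intro!: sum.cong)

text \<open>On the orthogonal complement of the e i the form \<open>q - \<mu> ip\<close> is
  nonnegative, and it vanishes at w; by its Cauchy-Schwarz inequality w is in its kernel there.
  The directions e i are harmless, because both forms vanish on w and an eigenvector orthogonal
  to w.\<close>

lemma minimum_is_eigenvector:
  assumes e: "\<And>i. i < k \<Longrightarrow> eigvec (l i) (e i)"
    and on: "\<And>i j. i < k \<Longrightarrow> j < k \<Longrightarrow> ip (e i) (e j) = (if i = j then 1 else 0)"
    and w: "w \<in> ip.perp e k" and eq: "Re (q w w) = \<mu> * Re (ip w w)"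
    and min: "\<And>u. u \<in> ip.perp e k \<Longrightarrow> \<mu> * Re (ip u u) \<le> Re (q u u)"
  shows "eigvec \<mu> w"
proof -
  have eD: "e i \<in> D" if "i < k" for i using e[OF that] by (simp add: eigvec_def)
  define g where "g = (\<lambda>u v. q u v - of_real \<mu> * ip u v)"
  have sub: "subspace (ip.perp e k)"
    unfolding subspace_def ip.perp_def by (auto simp: ip.add_left ip.scale_left eD)
  interpret g: hermitian_form sc "ip.perp e k" g
  proof
    show "g v u = cnj (g u v)" if "u \<in> ip.perp e k" "v \<in> ip.perp e k" for u v
      using q.herm[of u v] ip.herm[of u v] that ip.perp_in unfolding g_def by simp
  qed (use sub ip.perp_in min in \<open>auto simp: g_def q.add_left ip.add_left q.scale_left ip.scale_left algebra_simps\<close>)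
  have wD: "w \<in> D" using w ip.perp_in by blast
  have g0: "g w v = 0" if "v \<in> ip.perp e k" for v
  proof -
    have "form_norm g w = 0" using eq unfolding form_norm_def g_def by simp
    then show ?thesis using g.Cauchy_Schwarz[OF w that] by simp
  qed
  have "q w v = of_real \<mu> * ip w v" if v: "v \<in> D" for v
  proof -
    \<comment> \<open>the orthogonal projection of v to the span of the e i\<close>
    define p where "p = lin_comb sc k (\<lambda>i. ip v (e i)) e"
    have pD: "p \<in> D" unfolding p_def using eD by (rule ip.lin_comb_in)
    have "ip p (e i) = ip v (e i)" if "i < k" for i
    proof -
      have "ip p (e i) = (\<Sum>j<k. ip v (e j) * ip (e j) (e i))"
        unfolding p_def using eD that by (simp add: ip.lin_comb_left)
      also have "\<dots> = (\<Sum>j<k. if j = i then ip v (e i) else 0)"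
        using on that by (intro sum.cong) auto
      finally show ?thesis using that by simp
    qed
    then have "v - p \<in> ip.perp e k" using v pD eD by (simp add: ip.perp_def ip.diff_left)
    then have "q w (v - p) = of_real \<mu> * ip w (v - p)" using g0 by (simp add: g_def)
    moreover have "ip w p = 0"
      unfolding p_def using eD wD w by (simp add: ip.lin_comb_right ip.perp_def)
    moreover have "q w (e i) = 0" if "i < k" for i
    proof -
      have "q w (e i) = cnj (q (e i) w)" using q.herm eD that wD by blast
      also have "\<dots> = of_real (l i) * cnj (ip (e i) w)" using e[OF that] wD by (simp add: eigvec_def)
      also have "cnj (ip (e i) w) = ip w (e i)" using ip.herm eD that wD by metis
      finally show ?thesis using w that by (simp add: ip.perp_def)
    qed
    then have "q w p = 0" unfolding p_def using eD wD by (simp add: q.lin_comb_right)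
    ultimately show ?thesis using v pD wD by (simp add: ip.diff_right q.diff_right)
  qed
  then show ?thesis using wD by (simp add: eigvec_def)
qed

text \<open>The direct method. Compactness makes a normalized minimizing sequence converge for
  ip along a subsequence. Since the quotient at midpoints cannot fall below the infimum, the
  parallelogram law turns this into convergence for q.\<close>

lemma Rayleigh_minimum_attained:
  assumes eD: "\<And>i. i < k \<Longrightarrow> e i \<in> D"
  shows "\<exists>w. w \<in> ip.perp e k \<and> ip w w = 1 \<and> (\<forall>u\<in>ip.perp e k. Re (q w w) * Re (ip u u) \<le> Re (q u u))"
proof -
  have normalise: "sc (of_real (1 / form_norm ip u)) u \<in> ip.perp e k \<and> form_norm ip (sc (of_real (1 / form_norm ip u)) u) = 1
     \<and> Re (q (sc (of_real (1 / form_norm ip u)) u) (sc (of_real (1 / form_norm ip u)) u)) = Re (q u u) / (form_norm ip u)\<^sup>2"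
    if "u \<in> ip.perp e k" "form_norm ip u > 0" for u
    using that eD by (auto simp: ip.perp_def ip.scale_left ip.form_norm_scale q.scale_left q.scale_right power2_eq_square norm_divide)
  define S where "S = (\<lambda>u. Re (q u u)) ` {u \<in> ip.perp e k. form_norm ip u = 1}"
  have "S \<noteq> {}"
  proof -
    obtain b :: "nat \<Rightarrow> 'v" where b: "\<And>i. b i \<in> D \<and> ip (b i) (b i) \<noteq> 0" "\<And>i j. j \<noteq> i \<Longrightarrow> ip (b i) (b j) = 0"
      using infinite_dim by metis
    have "ip.indep (Suc k) b" using b by (intro ip.orthogonal_indep) auto
    then obtain c where "lin_comb sc (Suc k) c b \<in> ip.perp e k" "form_norm ip (lin_comb sc (Suc k) c b) > 0"
      using ip.indep_imp_perp_vector[of "Suc k" b k e] b(1) eD by blast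
    from normalise[OF this] show ?thesis unfolding S_def by auto
  qed
  define \<mu> where "\<mu> = Inf S"
  have bdd: "bdd_below S" unfolding S_def
    by (rule bdd_belowI[of _ 0]) (auto simp: q.nonneg ip.perp_in)
  have \<mu>0: "0 \<le> \<mu>" unfolding \<mu>_def using \<open>S \<noteq> {}\<close>
    by (rule cInf_greatest) (auto simp: S_def q.nonneg ip.perp_in)
  have low: "\<mu> * Re (ip u u) \<le> Re (q u u)" if u: "u \<in> ip.perp e k" for u
  proof (cases "form_norm ip u = 0")
    case True
    then show ?thesis using u ip.form_norm_sq[of u] q.nonneg[of u] ip.perp_in[OF u] by simp
  next
    case False
    then have pos: "form_norm ip u > 0" using ip.form_norm_nonneg[OF ip.perp_in[OF u]] by simp
    have "\<mu> \<le> Re (q u u) / (form_norm ip u)\<^sup>2"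
      unfolding \<mu>_def using normalise[OF u pos] by (intro cInf_lower bdd) (force simp: S_def)
    moreover have "(form_norm ip u)\<^sup>2 > 0" using pos by simp
    ultimately show ?thesis by (simp add: ip.form_norm_sq[OF ip.perp_in[OF u]] pos_le_divide_eq)
  qed
  have "\<exists>u. u \<in> ip.perp e k \<and> form_norm ip u = 1 \<and> Re (q u u) < \<mu> + inverse (Suc m)" for m
    using cInf_lessD[OF \<open>S \<noteq> {}\<close>, of "\<mu> + inverse (Suc m)"] unfolding \<mu>_def[symmetric] by (auto simp: S_def)
  then obtain u where u: "\<And>m. u m \<in> ip.perp e k" "\<And>m. form_norm ip (u m) = 1"
    "\<And>m. Re (q (u m) (u m)) < \<mu> + inverse (Suc m)" by metis
  have uD: "u m \<in> D" for m using u(1) ip.perp_in by blast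
  have "form_norm q (u m) \<le> max 1 (sqrt (\<mu> + 1))" for m
  proof -
    have "Re (q (u m) (u m)) \<le> \<mu> + 1" using u(3)[of m] inverse_le_1_iff[of "real (Suc m)"] by simp
    then show ?thesis unfolding form_norm_def by (simp add: max.coboundedI2)
  qed
  then obtain r where r: "strict_mono r" "form_Cauchy ip (\<lambda>m. u (r m))"
    using compact[of u "max 1 (sqrt (\<mu> + 1))"] uD u(2) by (metis max.cobounded1)
  have "form_Cauchy q (\<lambda>m. u (r m))"
    unfolding form_Cauchy_def
  proof (intro allI impI)
    fix \<epsilon> :: real assume \<epsilon>: "\<epsilon> > 0"
    \<comment> \<open>small enough for \<open>4 d + \<mu> d < \<epsilon>\<^sup>2\<close>: the
      excess of two terms over the infimum is bounded by d each and enters with the factor 2,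
      and the ip-distance is at most sqrt d\<close>
    define d where "d = \<epsilon>\<^sup>2 / 8 / (1 + \<mu>)"
    have d: "d > 0" using \<epsilon> \<mu>0 by (simp add: d_def)
    obtain N1 where N1: "\<And>k l. k \<ge> N1 \<Longrightarrow> l \<ge> N1 \<Longrightarrow> form_norm ip (u (r k) - u (r l)) < sqrt d"
      using r(2) d unfolding form_Cauchy_def by (meson real_sqrt_gt_zero)
    obtain N2 where N2: "inverse (Suc N2) < d" using reals_Archimedean[OF d] by blast
    have "form_norm q (u (r i) - u (r j)) < \<epsilon>" if ij: "i \<ge> max N1 N2" "j \<ge> max N1 N2" for i j
    proof -
      let ?a = "u (r i)" and ?b = "u (r j)"
      have small: "inverse (real (Suc (r m))) < d" if "m \<ge> N2" for m
      proof -
        have "N2 \<le> r m" using that seq_suble[OF r(1), of m] by simp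
        then have "inverse (real (Suc (r m))) \<le> inverse (real (Suc N2))" by (simp add: le_imp_inverse_le)
        then show ?thesis using N2 by (rule le_less_trans)
      qed
      have one: "Re (ip (u m) (u m)) = 1" for m using ip.form_norm_sq[OF uD, of m] u(2) by simp
      have "?a + ?b \<in> ip.perp e k" using u(1) eD by (auto simp: ip.perp_def ip.add_left)
      then have "\<mu> * Re (ip (?a + ?b) (?a + ?b)) \<le> Re (q (?a + ?b) (?a + ?b))" by (rule low)
      moreover have "Re (ip (?a + ?b) (?a + ?b)) = 4 - Re (ip (?a - ?b) (?a - ?b))"
        using ip.parallelogram[OF uD uD, of "r i" "r j"] one by simp
      moreover have "Re (ip (?a - ?b) (?a - ?b)) \<le> d"
      proof -
        have "form_norm ip (?a - ?b) < sqrt d" using N1 ij by simp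
        then show ?thesis unfolding form_norm_def by simp
      qed
      then have "\<mu> * Re (ip (?a - ?b) (?a - ?b)) \<le> \<mu> * d" using \<mu>0 by (rule mult_left_mono)
      ultimately have "Re (q (?a - ?b) (?a - ?b)) \<le> 2 * Re (q ?a ?a) + 2 * Re (q ?b ?b) - 4 * \<mu> + \<mu> * d"
        using q.parallelogram[OF uD uD, of "r i" "r j"] by (simp add: algebra_simps)
      also have "\<dots> \<le> 4 * d + \<mu> * d"
        using u(3)[of "r i"] u(3)[of "r j"] small[of i] small[of j] ij by simp
      also have "\<dots> \<le> 4 * ((1 + \<mu>) * d)" using \<mu>0 d by (simp add: algebra_simps)
      also have "\<dots> = \<epsilon>\<^sup>2 / 2" 
      proof -
        have "1 + \<mu> \<noteq> 0" using \<mu>0 by simp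
        then have "(1 + \<mu>) * d = \<epsilon>\<^sup>2 / 8" unfolding d_def by (metis nonzero_mult_div_cancel_left times_divide_eq_right)
        then show ?thesis by simp
      qed
      also have "\<dots> < \<epsilon>\<^sup>2" using \<epsilon> by simp
      finally show ?thesis unfolding form_norm_def using \<epsilon> by (simp add: real_less_rsqrt real_sqrt_less_iff real_less_lsqrt q.nonneg uD)
    qed
    then show "\<exists>N. \<forall>i\<ge>N. \<forall>j\<ge>N. form_norm q (u (r i) - u (r j)) < \<epsilon>" by blast
  qed
  then obtain w where w: "w \<in> D" "(\<lambda>m. form_norm ip (u (r m) - w)) \<longlonglongrightarrow> 0" "(\<lambda>m. form_norm q (u (r m) - w)) \<longlonglongrightarrow> 0"
    using complete[of "\<lambda>m. u (r m)"] uD r(2) by blast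
  have wperp: "w \<in> ip.perp e k"
  proof -
    have "ip w (e i) = 0" if "i < k" for i
    proof -
      have "(\<lambda>m. ip (u (r m)) (e i)) \<longlonglongrightarrow> ip w (e i)"
        by (rule ip.tendsto_form) (use w uD eD[OF that] in simp_all)
      moreover have "ip (u (r m)) (e i) = 0" for m using u(1) that by (simp add: ip.perp_def)
      ultimately show ?thesis by (simp add: LIMSEQ_const_iff)
    qed
    then show ?thesis using w by (simp add: ip.perp_def)
  qed
  have "(\<lambda>m. form_norm ip (u (r m))) \<longlonglongrightarrow> form_norm ip w"
    using ip.tendsto_form_norm[of "\<lambda>m. u (r m)" w] w uD by simp
  then have nw: "form_norm ip w = 1" using u(2) by (simp add: LIMSEQ_const_iff)
  then have ipw: "ip w w = 1" using ip.self_real[OF w(1)] by simp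
  have "(\<lambda>m. Re (q (u (r m)) (u (r m)))) \<longlonglongrightarrow> Re (q w w)"
    by (intro tendsto_Re q.tendsto_form) (use w uD in simp_all)
  moreover have "(\<lambda>m. \<mu> + inverse (Suc (r m))) \<longlonglongrightarrow> \<mu> + 0"
    using LIMSEQ_subseq_LIMSEQ[OF LIMSEQ_inverse_real_of_nat r(1)] by (intro tendsto_add tendsto_const) (simp add: o_def)
  ultimately have "Re (q w w) \<le> \<mu> + 0"
    using u(3) by (intro LIMSEQ_le) (auto intro: less_imp_le)
  then have "Re (q w w) * Re (ip v v) \<le> Re (q v v)" if "v \<in> ip.perp e k" for v
    using low[OF that] mult_right_mono[of "Re (q w w)" \<mu> "Re (ip v v)"] ip.nonneg[OF ip.perp_in[OF that]] by simp
  then show ?thesis using wperp ipw by blast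
qed

text \<open>The last clause says that l k is the minimum of the Rayleigh quotient on the
  complement of the first k eigenvectors; it replaces the completeness of the system e.\<close>

definition spectral :: "(nat \<Rightarrow> 'v) \<Rightarrow> (nat \<Rightarrow> real) \<Rightarrow> bool" where
  "spectral e l \<longleftrightarrow> (\<forall>k. eigvec (l k) (e k)) \<and> ip.orthonormal e \<and> mono l \<and> filterlim l at_top sequentially \<and>
     (\<forall>k. \<forall>u\<in>ip.perp e k. l k * Re (ip u u) \<le> Re (q u u))"

text \<open>Each e k minimizes the Rayleigh quotient on the complement of its predecessors. The
  values l k are unbounded, because otherwise compactness would give the orthonormal sequence e
  a Cauchy subsequence.\<close>

theorem spectral_resolution: "\<exists>e l. spectral e l"
proof -
  define P where "P = (\<lambda>f k w. w \<in> ip.perp f k \<and> ip w w = 1 \<and>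
      (\<forall>u\<in>ip.perp f k. Re (q w w) * Re (ip u u) \<le> Re (q u u)))"
  have "\<exists>e. \<forall>k. P e k (e k)"
  proof (rule dependent_wf_choice[OF wf_less_than])
    fix f g :: "nat \<Rightarrow> 'v" and k w
    assume "\<And>z. (z, k) \<in> less_than \<Longrightarrow> f z = g z"
    then have "ip.perp f k = ip.perp g k" unfolding ip.perp_def by auto
    then show "P f k w = P g k w" unfolding P_def by simp
  next
    fix k f assume "\<And>y. (y, k) \<in> less_than \<Longrightarrow> P f y (f y)"
    then have "f i \<in> D" if "i < k" for i using that ip.perp_in[of "f i" f i] unfolding P_def by auto
    then show "\<exists>w. P f k w" unfolding P_def using Rayleigh_minimum_attained[of k f] by simp
  qed
  then obtain e where e: "\<And>k. e k \<in> ip.perp e k" "\<And>k. ip (e k) (e k) = 1"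
    "\<And>k u. u \<in> ip.perp e k \<Longrightarrow> Re (q (e k) (e k)) * Re (ip u u) \<le> Re (q u u)" unfolding P_def by blast
  define l where "l = (\<lambda>k. Re (q (e k) (e k)))"
  have eD: "e k \<in> D" for k using e(1) ip.perp_in by blast
  have lt: "ip (e i) (e j) = 0" if "j < i" for i j using e(1)[of i] that by (simp add: ip.perp_def)
  have on: "ip (e i) (e j) = (if i = j then 1 else 0)" for i j
    using e(2) lt[of i j] lt[of j i] ip.herm[OF eD eD, of j i] by (cases i j rule: linorder_cases) auto
  have eig: "eigvec (l k) (e k)" for k
  proof (induction k rule: less_induct)
    case (less k)
    then show ?case
      by (rule minimum_is_eigenvector[of k l e]) (use on e in \<open>auto simp: l_def\<close>)
  qed
  have "mono l"
  proof (rule incseq_SucI)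
    fix k
    have "e (Suc k) \<in> ip.perp e k" using e(1)[of "Suc k"] by (simp add: ip.perp_def)
    then show "l k \<le> l (Suc k)" using e(3)[of "e (Suc k)" k] e(2)[of "Suc k"] by (simp add: l_def)
  qed
  have "\<exists>k. l k > C" for C
  proof (rule ccontr)
    assume "\<nexists>k. l k > C"
    then have C: "l k \<le> C" for k by (meson not_le)
    have "form_norm ip (e k) \<le> max 1 (sqrt C)" "form_norm q (e k) \<le> max 1 (sqrt C)" for k
      using C[of k] e(2)[of k] by (auto simp: form_norm_def l_def max.coboundedI2)
    then obtain r where r: "strict_mono r" "form_Cauchy ip (\<lambda>k. e (r k))"
      using compact[of e "max 1 (sqrt C)"] eD by blast
    then obtain N where "\<And>k l. k \<ge> N \<Longrightarrow> l \<ge> N \<Longrightarrow> form_norm ip (e (r k) - e (r l)) < 1"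
      unfolding form_Cauchy_def by (meson zero_less_one)
    then have "form_norm ip (e (r (Suc N)) - e (r N)) < 1" by simp
    moreover have "r (Suc N) \<noteq> r N" using r(1) by (metis lessI less_irrefl strict_monoD)
    then have "ip (e (r (Suc N)) - e (r N)) (e (r (Suc N)) - e (r N)) = 2"
      using on eD by (simp add: ip.diff_left ip.diff_right)
    ultimately show False by (simp add: form_norm_def)
  qed
  then have "filterlim l at_top sequentially"
    using \<open>mono l\<close> unfolding filterlim_at_top eventually_sequentially
    by (meson less_imp_le monoD order_trans)
  then have "spectral e l"
    unfolding spectral_def ip.orthonormal_def using eig on \<open>mono l\<close> e(3) by (auto simp: l_def)
  then show ?thesis by blast
qed

context
  fixes e l assumes sp: "spectral e l"
begin

lemma spectral_D: "e k \<in> D" and spectral_eigvec: "eigvec (l k) (e k)"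
  using sp by (auto simp: spectral_def eigvec_def)

lemma spectral_orthonormal: "ip (e i) (e j) = (if i = j then 1 else 0)"
  using sp by (auto simp: spectral_def ip.orthonormal_def)

lemma spectral_mono: "i \<le> j \<Longrightarrow> l i \<le> l j" using sp by (auto simp: spectral_def mono_def)

lemma spectral_low: "u \<in> ip.perp e k \<Longrightarrow> l k * Re (ip u u) \<le> Re (q u u)"
  using sp by (auto simp: spectral_def)

lemma spectral_finite: "finite {k. l k \<le> \<mu>}"
proof -
  have "\<forall>\<^sub>F k in sequentially. l k > \<mu>" using sp by (auto simp: spectral_def filterlim_at_top_dense)
  then obtain N where "k < N" if "l k \<le> \<mu>" for k
    unfolding eventually_sequentially by (meson not_le)
  then have "{k. l k \<le> \<mu>} \<subseteq> {..<N}" 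
    by (auto simp flip: not_le)
  then show ?thesis by (rule finite_subset) simp
qed

lemma spectral_span_upper:
  "n \<ge> 1 \<Longrightarrow> Re (q (lin_comb sc n c e) (lin_comb sc n c e)) \<le> l (n - 1) * Re (ip (lin_comb sc n c e) (lin_comb sc n c e))"
proof -
  assume n: "n \<ge> 1"
  have qe: "q (e i) (e j) = (if i = j then of_real (l i) else 0)" for i j
    using spectral_eigvec[of i] spectral_D[of j] spectral_orthonormal[of i j] by (simp add: eigvec_def)
  have "Re (q (lin_comb sc n c e) (lin_comb sc n c e)) = (\<Sum>j<n. (cmod (c j))\<^sup>2 * l j)"
    using q.orthogonal_lin_comb[of n e c] qe spectral_D by simp
  also have "\<dots> \<le> (\<Sum>j<n. (cmod (c j))\<^sup>2 * l (n - 1))"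
    using n by (intro sum_mono mult_left_mono spectral_mono) auto
  also have "\<dots> = l (n - 1) * Re (ip (lin_comb sc n c e) (lin_comb sc n c e))"
    using ip.orthogonal_lin_comb[of n e c] spectral_orthonormal spectral_D by (simp add: sum_distrib_left mult.commute)
  finally show ?thesis .
qed

lemma spectral_indep: "ip.indep n e"
  using sp spectral_D by (intro ip.orthonormal_indep) (auto simp: spectral_def)

lemma minmax_lower:
  assumes u: "\<And>j. j < n \<Longrightarrow> u j \<in> D" "ip.indep n u" and n: "n \<ge> 1"
    and le: "\<And>c. Re (q (lin_comb sc n c u) (lin_comb sc n c u)) \<le> \<mu> * Re (ip (lin_comb sc n c u) (lin_comb sc n c u))"
  shows "l (n - 1) \<le> \<mu>"
proof -
  obtain c where c: "lin_comb sc n c u \<in> ip.perp e (n - 1)" "form_norm ip (lin_comb sc n c u) > 0"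
    using ip.indep_imp_perp_vector[of n u "n - 1" e, OF u _ spectral_D] n by auto
  have pos: "Re (ip (lin_comb sc n c u) (lin_comb sc n c u)) > 0"
    using c(2) unfolding form_norm_def by simp
  have "l (n - 1) * Re (ip (lin_comb sc n c u) (lin_comb sc n c u)) \<le> \<mu> * Re (ip (lin_comb sc n c u) (lin_comb sc n c u))"
    using spectral_low[OF c(1)] le[of c] by linarith
  then show ?thesis using pos by simp
qed

text \<open>Equality in the min-max principle. A combination orthogonal to all eigenvectors with
  values below \<open>\<mu>\<close> has Rayleigh quotient at least \<open>\<mu>\<close>; by
  assumption it is also at most \<open>\<mu>\<close>, so the combination is a minimizer on that
  complement.\<close>

lemma minmax_equality:
  assumes u: "\<And>j. j < n \<Longrightarrow> u j \<in> D" "ip.indep n u" and n: "n \<ge> 1"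
    and le: "\<And>c. Re (q (lin_comb sc n c u) (lin_comb sc n c u)) \<le> \<mu> * Re (ip (lin_comb sc n c u) (lin_comb sc n c u))"
    and ge: "\<mu> \<le> l (n - 1)"
  shows "\<exists>c. form_norm ip (lin_comb sc n c u) > 0 \<and> eigvec \<mu> (lin_comb sc n c u)"
proof -
  define m where "m = (LEAST k. \<mu> \<le> l k)"
  have m: "\<mu> \<le> l m" "m \<le> n - 1" using ge unfolding m_def by (auto intro: LeastI Least_le)
  obtain c where c: "lin_comb sc n c u \<in> ip.perp e m" "form_norm ip (lin_comb sc n c u) > 0"
    using ip.indep_imp_perp_vector[of n u m e, OF u _ spectral_D] n m(2)
    by (metis Suc_pred' le_imp_less_Suc less_le_trans zero_less_one)
  have low: "\<mu> * Re (ip v v) \<le> Re (q v v)" if "v \<in> ip.perp e m" for v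
    using spectral_low[OF that] mult_right_mono[OF m(1), of "Re (ip v v)"] ip.nonneg[OF ip.perp_in[OF that]] by linarith
  have "eigvec \<mu> (lin_comb sc n c u)"
    by (rule minimum_is_eigenvector[of m l e])
      (use spectral_eigvec spectral_orthonormal c(1) low le[of c] in \<open>auto intro: antisym\<close>)
  then show ?thesis using c(2) by blast
qed

text \<open>An eigenvector for \<open>\<mu>\<close> orthogonal to all e k with \<open>l k =
  \<mu>\<close> is orthogonal to every e k, so that its Rayleigh quotient \<open>\<mu>\<close>
  would dominate the unbounded sequence l.\<close>

lemma multiplicity_upper:
  assumes u: "\<And>j. j < m \<Longrightarrow> eigvec \<mu> (u j)" "ip.indep m u"
  shows "m \<le> card {k. l k = \<mu>}"
proof (rule ccontr)
  assume "\<not> ?thesis"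
  then have less: "card {k. l k = \<mu>} < m" by simp
  have fin: "finite {k. l k = \<mu>}" by (rule finite_subset[OF _ spectral_finite[of \<mu>]]) auto
  then obtain f where f: "bij_betw f {..<card {k. l k = \<mu>}} {k. l k = \<mu>}"
    using ex_bij_betw_nat_finite[OF fin] by (auto simp: atLeast0LessThan)
  have uD: "u j \<in> D" if "j < m" for j using u(1)[OF that] by (simp add: eigvec_def)
  obtain c where c: "lin_comb sc m c u \<in> ip.perp (\<lambda>i. e (f i)) (card {k. l k = \<mu>})" "form_norm ip (lin_comb sc m c u) > 0"
    using ip.indep_imp_perp_vector[OF uD u(2) less, of "\<lambda>i. e (f i)"] spectral_D by auto
  let ?w = "lin_comb sc m c u"
  have ew: "eigvec \<mu> ?w" using u(1) by (rule eigvec_lin_comb)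
  have wD: "?w \<in> D" using ew by (simp add: eigvec_def)
  have perp: "ip ?w (e k) = 0" for k
  proof (cases "l k = \<mu>")
    case True
    then obtain i where "i < card {k. l k = \<mu>}" "k = f i" using f unfolding bij_betw_def by auto
    then show ?thesis using c(1) by (auto simp: ip.perp_def)
  next
    case False
    then show ?thesis using eigvec_orthogonal[OF ew spectral_eigvec[of k]] by simp
  qed
  obtain k where k: "l k > \<mu>" using sp unfolding spectral_def filterlim_at_top_dense
    by (meson eventually_happens' sequentially_bot)
  have "l k * Re (ip ?w ?w) \<le> Re (q ?w ?w)" using perp wD by (intro spectral_low) (auto simp: ip.perp_def)
  also have "\<dots> = \<mu> * Re (ip ?w ?w)" using ew wD by (simp add: eigvec_def)
  finally show False using k c(2) by (simp add: form_norm_def)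
qed

lemma multiplicity_lower:
  "\<exists>u. (\<forall>j<card {k. l k = \<mu>}. eigvec \<mu> (u j)) \<and> ip.indep (card {k. l k = \<mu>}) u"
proof -
  have fin: "finite {k. l k = \<mu>}" by (rule finite_subset[OF _ spectral_finite[of \<mu>]]) auto
  then obtain g where g: "bij_betw g {..<card {k. l k = \<mu>}} {k. l k = \<mu>}"
    using ex_bij_betw_nat_finite[OF fin] by (auto simp: atLeast0LessThan)
  then have inj: "inj_on g {..<card {k. l k = \<mu>}}" and im: "\<And>j. j < card {k. l k = \<mu>} \<Longrightarrow> l (g j) = \<mu>"
    unfolding bij_betw_def by auto
  define u where "u = (\<lambda>j. e (g j))"
  have "ip.indep (card {k. l k = \<mu>}) u"
    by (rule ip.orthogonal_indep) (use inj in \<open>auto simp: u_def spectral_D spectral_orthonormal inj_on_eq_iff\<close>)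
  moreover have "eigvec \<mu> (u j)" if "j < card {k. l k = \<mu>}" for j
    using im[OF that] spectral_eigvec[of "g j"] by (auto simp: u_def)
  ultimately show ?thesis by blast
qed

end

end

section \<open>Calculus of smooth functions and test functions\<close>

lemma partial_has_derivative: "(u has_derivative D) (at x) \<Longrightarrow> partial j u x = D (axis j 1)"
  unfolding partial_def by (metis frechet_derivative_at)

text \<open>Smoothness of a function follows from membership in any class of differentiable
  functions that is closed under partial derivatives.\<close>

lemma smooth_coinduct:
  assumes "u \<in> S" "\<And>v x. v \<in> S \<Longrightarrow> v differentiable (at x)" "\<And>v j. v \<in> S \<Longrightarrow> partial j v \<in> S"
  shows "smooth_fun u"
proof -
  have "foldr partial js u \<in> S" for js by (induction js) (use assms in auto)
  then show ?thesis unfolding smooth_fun_def using assms(2) by blast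
qed

lemma smooth_differentiable: "smooth_fun u \<Longrightarrow> u differentiable (at x)"
  unfolding smooth_fun_def by (metis foldr.simps(1) id_apply)

lemma smooth_partial: "smooth_fun u \<Longrightarrow> smooth_fun (partial j u)"
  unfolding smooth_fun_def
proof (intro allI)
  fix js x assume "\<forall>js x. foldr partial js u differentiable (at x)"
  then have "foldr partial (js @ [j]) u differentiable (at x)" by blast
  then show "foldr partial js (partial j u) differentiable (at x)" by simp
qed

lemma smooth_continuous: "smooth_fun u \<Longrightarrow> continuous_on S u"
  by (meson continuous_at_imp_continuous_on differentiable_imp_continuous_within smooth_differentiable)

lemma frechet_derivative_partial:
  assumes "u differentiable (at x)"
  shows "(u has_derivative (\<lambda>h. \<Sum>j\<in>UNIV. of_real (h $ j) * partial j u x)) (at x)"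
proof -
  have d: "(u has_derivative frechet_derivative u (at x)) (at x)"
    using assms frechet_derivative_works by blast
  then have lin: "linear (frechet_derivative u (at x))" using has_derivative_linear by blast
  have "frechet_derivative u (at x) h = (\<Sum>j\<in>UNIV. of_real (h $ j) * partial j u x)" for h
  proof -
    have "h = (\<Sum>j\<in>UNIV. (h $ j) *\<^sub>R axis j 1)" by (simp add: vec_eq_iff axis_def if_distrib cong: if_cong)
    then have "frechet_derivative u (at x) h = (\<Sum>j\<in>UNIV. frechet_derivative u (at x) ((h $ j) *\<^sub>R axis j 1))"
      using lin by (metis (no_types, lifting) linear_sum sum.cong)
    then show ?thesis using lin by (simp add: partial_def linear_scale scaleR_conv_of_real[where 'a=complex])
  qed
  then show ?thesis using d by (metis (no_types, lifting) ext)
qed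

lemma smooth_has_derivative:
  "smooth_fun u \<Longrightarrow> (u has_derivative (\<lambda>h. \<Sum>j\<in>UNIV. of_real (h $ j) * partial j u x)) (at x)"
  by (intro frechet_derivative_partial smooth_differentiable)

lemma diff_deriv: "u differentiable (at x) \<Longrightarrow> (u has_derivative frechet_derivative u (at x)) (at x)"
  using frechet_derivative_works by blast

lemma partial_add:
  assumes "u differentiable (at x)" "v differentiable (at x)"
  shows "partial j (\<lambda>x. u x + v x) x = partial j u x + partial j v x"
  by (subst partial_has_derivative[OF has_derivative_add[OF diff_deriv diff_deriv]]) (use assms in \<open>auto simp: partial_def\<close>)

lemma partial_mult:
  assumes "u differentiable (at x)" "v differentiable (at x)"
  shows "partial j (\<lambda>x. u x * v x) x = u x * partial j v x + partial j u x * v x"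
  by (subst partial_has_derivative[OF has_derivative_mult[OF diff_deriv diff_deriv]]) (use assms in \<open>auto simp: partial_def\<close>)

lemma partial_const [simp]: "partial j (\<lambda>x. c) = (\<lambda>x. 0)"
  by (rule ext) (subst partial_has_derivative[OF has_derivative_const], rule refl)

lemma partial_cmult:
  assumes "u differentiable (at x)"
  shows "partial j (\<lambda>x. c * u x) x = c * partial j u x"
  using partial_mult[of "\<lambda>x. c" x u j] assms by simp

lemma partial_cnj:
  assumes "u differentiable (at x)"
  shows "partial j (\<lambda>x. cnj (u x)) x = cnj (partial j u x)"
  by (subst partial_has_derivative[OF bounded_linear.has_derivative[OF bounded_linear_cnj diff_deriv]])
    (use assms in \<open>auto simp: partial_def\<close>)

lemma partial_affine:
  assumes "u differentiable (at (a + s *\<^sub>R x))"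
  shows "partial j (\<lambda>x. u (a + s *\<^sub>R x)) x = of_real s * partial j u (a + s *\<^sub>R x)"
    and "(\<lambda>x. u (a + s *\<^sub>R x)) differentiable (at x)"
proof -
  have "((\<lambda>x. a + s *\<^sub>R x) has_derivative (\<lambda>h. s *\<^sub>R h)) (at x)"
    by (auto intro!: derivative_eq_intros)
  from has_derivative_compose[OF this diff_deriv[OF assms]]
  have d: "((\<lambda>x. u (a + s *\<^sub>R x)) has_derivative (\<lambda>h. frechet_derivative u (at (a + s *\<^sub>R x)) (s *\<^sub>R h))) (at x)" .
  then show "(\<lambda>x. u (a + s *\<^sub>R x)) differentiable (at x)" unfolding differentiable_def by blast
  have "linear (frechet_derivative u (at (a + s *\<^sub>R x)))"
    using assms linear_frechet_derivative by blast
  then show "partial j (\<lambda>x. u (a + s *\<^sub>R x)) x = of_real s * partial j u (a + s *\<^sub>R x)"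
    by (subst partial_has_derivative[OF d]) (simp add: partial_def linear_scale scaleR_conv_of_real[where 'a=complex])
qed

text \<open>Closed under partial derivatives by the product rule; hence sums and products of
  smooth functions are smooth.\<close>

inductive_set smooth_algebra :: "(real^2 \<Rightarrow> complex) set" where
  base: "smooth_fun u \<Longrightarrow> u \<in> smooth_algebra"
| add: "u \<in> smooth_algebra \<Longrightarrow> v \<in> smooth_algebra \<Longrightarrow> (\<lambda>x. u x + v x) \<in> smooth_algebra"
| mult: "u \<in> smooth_algebra \<Longrightarrow> v \<in> smooth_algebra \<Longrightarrow> (\<lambda>x. u x * v x) \<in> smooth_algebra"

lemma smooth_algebra_closed:
  assumes "v \<in> smooth_algebra" shows "(\<forall>x. v differentiable (at x)) \<and> (\<forall>j. partial j v \<in> smooth_algebra)"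
  using assms
proof induction
  case (base u)
  then show ?case using smooth_differentiable smooth_partial smooth_algebra.base by blast
next
  case (add u v)
  then have "partial j (\<lambda>x. u x + v x) = (\<lambda>x. partial j u x + partial j v x)" for j
    by (intro ext partial_add) auto
  then show ?case using add by (auto intro: smooth_algebra.intros differentiable_add)
next
  case (mult u v)
  then have "partial j (\<lambda>x. u x * v x) = (\<lambda>x. u x * partial j v x + partial j u x * v x)" for j
    by (intro ext partial_mult) auto
  then show ?case using mult 
    by (auto intro!: smooth_algebra.add smooth_algebra.mult differentiable_mult)
qed

lemma smooth_algebra_smooth: "v \<in> smooth_algebra \<Longrightarrow> smooth_fun v"
  by (rule smooth_coinduct[of _ smooth_algebra]) (use smooth_algebra_closed in auto)

lemma smooth_add: "smooth_fun u \<Longrightarrow> smooth_fun v \<Longrightarrow> smooth_fun (\<lambda>x. u x + v x)"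
  and smooth_mult: "smooth_fun u \<Longrightarrow> smooth_fun v \<Longrightarrow> smooth_fun (\<lambda>x. u x * v x)"
  by (auto intro!: smooth_algebra_smooth intro: smooth_algebra.intros)

lemma smooth_const: "smooth_fun (\<lambda>x. c)"
  by (rule smooth_coinduct[of _ "range (\<lambda>c x. c)"]) auto

lemma smooth_cmult: "smooth_fun u \<Longrightarrow> smooth_fun (\<lambda>x. c * u x)"
  by (intro smooth_mult smooth_const)

lemma coordinate_has_derivative:
  "((\<lambda>x. complex_of_real (x $ i)) has_derivative (\<lambda>h. of_real (h $ i))) (at (x :: real^2))"
  by (intro has_derivative_of_real bounded_linear.has_derivative[OF bounded_linear_vec_nth] has_derivative_ident)

lemma partial_coordinate: "partial j (\<lambda>x. complex_of_real (x $ i)) = (\<lambda>x. if i = j then 1 else 0)"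
  by (rule ext) (subst partial_has_derivative[OF coordinate_has_derivative], auto simp: axis_def)

lemma smooth_coordinate: "smooth_fun (\<lambda>x. complex_of_real (x $ i))"
proof (rule smooth_coinduct[of _ "insert (\<lambda>x. complex_of_real (x $ i)) (range (\<lambda>c x. c))"])
  show "v differentiable (at x)" if "v \<in> insert (\<lambda>x. complex_of_real (x $ i)) (range (\<lambda>c x. c))" for v x
    using that coordinate_has_derivative[of i x] differentiable_const[of _ "at x"] unfolding differentiable_def by blast
  show "partial j v \<in> insert (\<lambda>x. complex_of_real (x $ i)) (range (\<lambda>c x. c))"
    if "v \<in> insert (\<lambda>x. complex_of_real (x $ i)) (range (\<lambda>c x. c))" for v j
    using that by (auto simp: partial_coordinate)
qed simp

lemma smooth_cnj: "smooth_fun u \<Longrightarrow> smooth_fun (\<lambda>x. cnj (u x))"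
proof (rule smooth_coinduct[of _ "(\<lambda>u x. cnj (u x)) ` Collect smooth_fun"])
  fix v j x assume "v \<in> (\<lambda>u x. cnj (u x)) ` Collect smooth_fun"
  then obtain u where u: "smooth_fun u" "v = (\<lambda>x. cnj (u x))" by blast
  show "v differentiable (at x)"
    unfolding u(2) differentiable_def
    using bounded_linear.has_derivative[OF bounded_linear_cnj diff_deriv[OF smooth_differentiable[OF u(1)]]] by blast
  have "partial j v = (\<lambda>x. cnj (partial j u x))"
    unfolding u(2) using u(1) by (intro ext partial_cnj smooth_differentiable)
  then show "partial j v \<in> (\<lambda>u x. cnj (u x)) ` Collect smooth_fun" using u(1) smooth_partial by blast
qed auto

lemma smooth_affine: "smooth_fun u \<Longrightarrow> smooth_fun (\<lambda>x. u (a + s *\<^sub>R x))"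
proof (rule smooth_coinduct[of _ "{\<lambda>x. c * u (a + s *\<^sub>R x) |c u. smooth_fun u}"])
  show "smooth_fun u \<Longrightarrow> (\<lambda>x. u (a + s *\<^sub>R x)) \<in> {\<lambda>x. c * u (a + s *\<^sub>R x) |c u. smooth_fun u}"
    by (rule CollectI, rule exI[of _ 1]) auto
next
  fix v j x assume "v \<in> {\<lambda>x. c * u (a + s *\<^sub>R x) |c u. smooth_fun u}"
  then obtain c u where u: "smooth_fun u" and v: "v = (\<lambda>x. c * u (a + s *\<^sub>R x))" by blast
  note p = partial_affine[OF smooth_differentiable[OF u]]
  show "v differentiable (at x)" unfolding v using p(2) by (intro differentiable_mult) auto
  have "partial j v = (\<lambda>x. c * of_real s * partial j u (a + s *\<^sub>R x))"
    unfolding v using p by (intro ext) (simp add: partial_cmult)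
  then show "partial j v \<in> {\<lambda>x. c * u (a + s *\<^sub>R x) |c u. smooth_fun u}"
    using smooth_partial[OF u] by blast
qed

text \<open>The gauge factor that compensates the change of the vector potential under a
  translation.\<close>

definition plane_wave :: "real^2 \<Rightarrow> real^2 \<Rightarrow> complex" where
  "plane_wave \<theta> x = exp (\<i> * of_real (\<theta> \<bullet> x))"

lemma plane_wave_has_derivative:
  "(plane_wave \<theta> has_derivative (\<lambda>h. \<i> * of_real (\<theta> \<bullet> h) * plane_wave \<theta> x)) (at x)"
proof -
  have 1: "((\<lambda>x. \<i> * complex_of_real (\<theta> \<bullet> x)) has_derivative (\<lambda>h. \<i> * of_real (\<theta> \<bullet> h))) (at x)"
    by (intro has_derivative_mult_right has_derivative_of_real has_derivative_inner_right has_derivative_ident)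
  have 2: "(exp has_derivative (\<lambda>h. exp (\<i> * complex_of_real (\<theta> \<bullet> x)) * h)) (at (\<i> * complex_of_real (\<theta> \<bullet> x)))"
    using DERIV_exp unfolding has_field_derivative_def by blast
  show ?thesis using has_derivative_compose[OF 1 2] unfolding plane_wave_def by (simp add: mult.commute fun_eq_iff)
qed

lemma partial_plane_wave: "partial j (plane_wave \<theta>) x = \<i> * of_real (\<theta> $ j) * plane_wave \<theta> x"
  by (subst partial_has_derivative[OF plane_wave_has_derivative]) (simp add: inner_axis)

lemma smooth_plane_wave: "smooth_fun (plane_wave \<theta>)"
proof (rule smooth_coinduct[of _ "range (\<lambda>c x. c * plane_wave \<theta> x)"])
  have d: "plane_wave \<theta> differentiable (at x)" for x
    using plane_wave_has_derivative unfolding differentiable_def by blast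
  fix v j x assume "v \<in> range (\<lambda>c x. c * plane_wave \<theta> x)"
  then obtain c where v: "v = (\<lambda>x. c * plane_wave \<theta> x)" by blast
  show "v differentiable (at x)" unfolding v using d by (intro differentiable_mult) auto
  have "partial j v = (\<lambda>x. (c * (\<i> * of_real (\<theta> $ j))) * plane_wave \<theta> x)"
    unfolding v using d by (intro ext) (simp add: partial_cmult partial_plane_wave)
  then show "partial j v \<in> range (\<lambda>c x. c * plane_wave \<theta> x)" by blast
qed (auto intro: image_eqI[of _ _ 1])

lemma cmod_plane_wave [simp]: "cmod (plane_wave \<theta> x) = 1"
  by (simp add: plane_wave_def)

lemma plane_wave_nonzero [simp]: "plane_wave \<theta> x \<noteq> 0"
  by (simp add: plane_wave_def)

lemma test_fun_iff: "test_fun \<Omega> u \<longleftrightarrow> smooth_fun u \<and> (\<exists>K. compact K \<and> K \<subseteq> \<Omega> \<and> (\<forall>x. x \<notin> K \<longrightarrow> u x = 0))"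
proof
  assume r: "smooth_fun u \<and> (\<exists>K. compact K \<and> K \<subseteq> \<Omega> \<and> (\<forall>x. x \<notin> K \<longrightarrow> u x = 0))"
  then obtain K where K: "compact K" "K \<subseteq> \<Omega>" "\<And>x. x \<notin> K \<Longrightarrow> u x = 0" by blast
  then have c: "closure {x. u x \<noteq> 0} \<subseteq> K" by (intro closure_minimal compact_imp_closed) auto
  then have "K \<inter> closure {x. u x \<noteq> 0} = closure {x. u x \<noteq> 0}" by blast
  moreover have "compact (K \<inter> closure {x. u x \<noteq> 0})" using K(1) by (intro compact_Int_closed) auto
  ultimately show "test_fun \<Omega> u" unfolding test_fun_def using r K(2) c by auto
next
  assume t: "test_fun \<Omega> u"
  show "smooth_fun u \<and> (\<exists>K. compact K \<and> K \<subseteq> \<Omega> \<and> (\<forall>x. x \<notin> K \<longrightarrow> u x = 0))"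
  proof (intro conjI exI[of _ "closure {x. u x \<noteq> 0}"] allI impI)
    fix x assume "x \<notin> closure {x. u x \<noteq> 0}"
    then show "u x = 0" using subsetD[OF closure_subset, of x "{x. u x \<noteq> 0}"] by auto
  qed (use t in \<open>simp_all add: test_fun_def\<close>)
qed

lemma test_smooth: "test_fun \<Omega> u \<Longrightarrow> smooth_fun u" by (simp add: test_fun_def)

lemma test_support:
  assumes "test_fun \<Omega> u"
  obtains K where "compact K" "K \<subseteq> \<Omega>" "\<And>x. x \<notin> K \<Longrightarrow> u x = 0"
  using assms unfolding test_fun_iff by blast

lemma test_zero_outside: "test_fun \<Omega> u \<Longrightarrow> x \<notin> \<Omega> \<Longrightarrow> u x = 0"
  unfolding test_fun_iff by blast

lemma test_mono: "test_fun \<Omega> u \<Longrightarrow> \<Omega> \<subseteq> \<Omega>' \<Longrightarrow> test_fun \<Omega>' u"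
  unfolding test_fun_def by blast

lemma test_zero: "test_fun \<Omega> (\<lambda>x. 0)"
  unfolding test_fun_iff by (auto intro!: smooth_const exI[of _ "{}"])

lemma test_add:
  assumes "test_fun \<Omega> u" "test_fun \<Omega> v" shows "test_fun \<Omega> (\<lambda>x. u x + v x)"
proof -
  obtain K L where "compact K" "K \<subseteq> \<Omega>" "\<And>x. x \<notin> K \<Longrightarrow> u x = 0" "compact L" "L \<subseteq> \<Omega>" "\<And>x. x \<notin> L \<Longrightarrow> v x = 0"
    using assms test_support by metis
  then show ?thesis unfolding test_fun_iff using assms
    by (intro conjI smooth_add test_smooth exI[of _ "K \<union> L"]) auto
qed

lemma test_mult: "test_fun \<Omega> u \<Longrightarrow> smooth_fun v \<Longrightarrow> test_fun \<Omega> (\<lambda>x. v x * u x)"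
  unfolding test_fun_iff by (auto intro: smooth_mult)

lemma test_cmult: "test_fun \<Omega> u \<Longrightarrow> test_fun \<Omega> (\<lambda>x. c * u x)"
  by (intro test_mult smooth_const)

lemma test_diff: "test_fun \<Omega> u \<Longrightarrow> test_fun \<Omega> v \<Longrightarrow> test_fun \<Omega> (\<lambda>x. u x - v x)"
  using test_add[of \<Omega> u "\<lambda>x. (-1) * v x"] test_cmult[of \<Omega> v "-1"] by simp

lemma test_cnj: "test_fun \<Omega> u \<Longrightarrow> test_fun \<Omega> (\<lambda>x. cnj (u x))"
  unfolding test_fun_iff by (auto intro: smooth_cnj)

lemma partial_cong_open:
  assumes "open S" "x \<in> S" "\<And>y. y \<in> S \<Longrightarrow> u y = v y"
  shows "partial j u x = partial j v x" and "u differentiable (at x) \<longleftrightarrow> v differentiable (at x)"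
proof -
  have *: "(u has_derivative D) (at x) \<longleftrightarrow> (v has_derivative D) (at x)" for D
    using assms by (auto intro: has_derivative_transform_within_open[OF _ assms(1,2)])
  show "u differentiable (at x) \<longleftrightarrow> v differentiable (at x)" unfolding differentiable_def * ..
  show "partial j u x = partial j v x" unfolding partial_def frechet_derivative_def * ..
qed

lemma partial_zero_outside:
  assumes "closed K" "\<And>x. x \<notin> K \<Longrightarrow> u x = 0" "x \<notin> K" shows "partial j u x = 0"
  using partial_cong_open(1)[of "- K" x u "\<lambda>x. 0" j] assms by (simp add: open_Compl)

lemma test_partial:
  assumes "test_fun \<Omega> u" shows "test_fun \<Omega> (partial j u)"
proof -
  obtain K where K: "compact K" "K \<subseteq> \<Omega>" "\<And>x. x \<notin> K \<Longrightarrow> u x = 0" using test_support[OF assms] by metis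
  then have "partial j u x = 0" if "x \<notin> K" for x
    using that by (intro partial_zero_outside[of K]) (auto intro: compact_imp_closed)
  then show ?thesis unfolding test_fun_iff using K assms by (meson smooth_partial test_smooth)
qed

lemma test_vector_potential: "smooth_fun (\<lambda>x. complex_of_real (vector_potential B x $ j))"
proof -
  have "j = 1 \<or> j = 2" using exhaust_2 by blast
  then have "(\<lambda>x. complex_of_real (vector_potential B x $ j)) = (\<lambda>x. complex_of_real (- B / 2) * of_real (x $ 2))
    \<or> (\<lambda>x. complex_of_real (vector_potential B x $ j)) = (\<lambda>x. complex_of_real (B / 2) * of_real (x $ 1))"
    by (auto simp: vector_potential_def fun_eq_iff vector_2)
  then show ?thesis using smooth_cmult[OF smooth_coordinate] by metis
qed

lemma test_magnetic_gradient: "test_fun \<Omega> u \<Longrightarrow> test_fun \<Omega> (magnetic_gradient B u j)"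
  unfolding magnetic_gradient_def[abs_def]
  using test_add[OF test_cmult[OF test_partial, of \<Omega> u "- \<i>" j] test_mult[OF _ test_vector_potential]] by simp

lemma magnetic_gradient_add:
  assumes "smooth_fun u" "smooth_fun v"
  shows "magnetic_gradient B (\<lambda>x. u x + v x) j x = magnetic_gradient B u j x + magnetic_gradient B v j x"
  using assms by (simp add: magnetic_gradient_def partial_add smooth_differentiable algebra_simps)

lemma magnetic_gradient_cmult:
  assumes "smooth_fun u"
  shows "magnetic_gradient B (\<lambda>x. c * u x) j x = c * magnetic_gradient B u j x"
  using assms by (simp add: magnetic_gradient_def partial_cmult smooth_differentiable algebra_simps)

definition restrict_fun :: "'a set \<Rightarrow> ('a \<Rightarrow> complex) \<Rightarrow> 'a \<Rightarrow> complex" where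
  "restrict_fun S u x = (if x \<in> S then u x else 0)"

text \<open>A compact subset of \<open>S \<union> S'\<close> has a compact intersection with S,
  so cutting off outside S leaves a smooth function.\<close>

lemma restrict_test:
  assumes "test_fun (S \<union> S') u" and S: "open S" "open S'" "S \<inter> S' = {}"
  shows "test_fun S (restrict_fun S u)"
    and "magnetic_gradient B (restrict_fun S u) j x = restrict_fun S (magnetic_gradient B u j) x"
proof -
  have local: "v differentiable (at x) \<Longrightarrow> restrict_fun S v differentiable (at x)"
    "partial j (restrict_fun S v) x = restrict_fun S (partial j v) x" if v: "test_fun (S \<union> S') v" for v j x
  proof -
    obtain K where K: "compact K" "K \<subseteq> S \<union> S'" "\<And>x. x \<notin> K \<Longrightarrow> v x = 0" using test_support[OF v] by metis
    have "(v differentiable (at x) \<longrightarrow> restrict_fun S v differentiable (at x)) \<and>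
      partial j (restrict_fun S v) x = restrict_fun S (partial j v) x"
    proof (cases "x \<in> S")
      case True
      then show ?thesis using partial_cong_open[of S x "restrict_fun S v" v] S by (simp add: restrict_fun_def)
    next
      case False
      have "x \<in> S' \<union> - K" using False K by blast
      moreover have "open (S' \<union> - K)" using S K by (auto intro: compact_imp_closed)
      moreover have "restrict_fun S v y = 0" if "y \<in> S' \<union> - K" for y
        using that S K by (auto simp: restrict_fun_def)
      ultimately show ?thesis using partial_cong_open[of "S' \<union> - K" x "restrict_fun S v" "\<lambda>x. 0"] False
        by (simp add: restrict_fun_def)
    qed
    then show "v differentiable (at x) \<Longrightarrow> restrict_fun S v differentiable (at x)"
      "partial j (restrict_fun S v) x = restrict_fun S (partial j v) x" by auto
  qed
  have "smooth_fun (restrict_fun S u)"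
  proof (rule smooth_coinduct[of _ "restrict_fun S ` Collect (test_fun (S \<union> S'))"])
    fix w j x assume "w \<in> restrict_fun S ` Collect (test_fun (S \<union> S'))"
    then obtain v where v: "test_fun (S \<union> S') v" "w = restrict_fun S v" by blast
    then show "w differentiable (at x)" using local(1) smooth_differentiable test_smooth by blast
    have "partial j w = restrict_fun S (partial j v)" using v local(2) by auto
    then show "partial j w \<in> restrict_fun S ` Collect (test_fun (S \<union> S'))" using test_partial v by blast
  qed (use assms in auto)
  moreover obtain K where K: "compact K" "K \<subseteq> S \<union> S'" "\<And>x. x \<notin> K \<Longrightarrow> u x = 0" using test_support[OF assms(1)] by metis
  moreover have "K \<inter> S = K \<inter> - S'" using K S by blast
  then have "compact (K \<inter> S)" using K(1) S(2) by (auto intro: compact_Int_closed)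
  ultimately show "test_fun S (restrict_fun S u)"
    unfolding test_fun_iff by (intro conjI exI[of _ "K \<inter> S"]) (auto simp: restrict_fun_def)
  show "magnetic_gradient B (restrict_fun S u) j x = restrict_fun S (magnetic_gradient B u j) x"
    using local(2)[OF assms(1), of j x] by (simp add: magnetic_gradient_def restrict_fun_def)
qed

section \<open>The Hilbert space of square-integrable functions\<close>

definition fun_scale :: "complex \<Rightarrow> ('a \<Rightarrow> complex) \<Rightarrow> 'a \<Rightarrow> complex" where
  "fun_scale c u = (\<lambda>x. c * u x)"

lemma fun_scale_apply [simp]: "fun_scale c u x = c * u x"
  by (simp add: fun_scale_def)

lemma vector_space_fun_scale: "vector_space fun_scale"
  by standard (auto simp: fun_eq_iff algebra_simps)

definition L2 :: "(real^2 \<Rightarrow> complex) set" where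
  "L2 = {u. L2_fun UNIV u}"

abbreviation L2ip :: "(real^2 \<Rightarrow> complex) \<Rightarrow> (real^2 \<Rightarrow> complex) \<Rightarrow> complex" where
  "L2ip \<equiv> L2_inner UNIV"

lemma L2_iff: "u \<in> L2 \<longleftrightarrow> u \<in> borel_measurable lebesgue \<and> integrable lebesgue (\<lambda>x. (cmod (u x))\<^sup>2)"
  by (simp add: L2_def L2_fun_def lebesgue_on_UNIV_eq)

lemma L2_measurable: "u \<in> L2 \<Longrightarrow> u \<in> borel_measurable lebesgue"
  and L2_integrable: "u \<in> L2 \<Longrightarrow> integrable lebesgue (\<lambda>x. (cmod (u x))\<^sup>2)"
  by (auto simp: L2_iff)

lemma L2ip_eq: "L2ip u v = integral\<^sup>L lebesgue (\<lambda>x. u x * cnj (v x))"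
  by (simp add: L2_inner_def lebesgue_on_UNIV_eq)

lemma cnj_measurable [measurable]: "cnj \<in> borel_measurable borel"
  by (intro borel_measurable_continuous_onI continuous_intros)

lemma L2_integrable_prod:
  assumes "u \<in> L2" "v \<in> L2" shows "integrable lebesgue (\<lambda>x. u x * cnj (v x))"
proof (rule Bochner_Integration.integrable_bound)
  show "integrable lebesgue (\<lambda>x. (cmod (u x))\<^sup>2 + (cmod (v x))\<^sup>2)"
    using assms by (simp add: L2_iff)
  note [measurable] = L2_measurable[OF assms(1)] L2_measurable[OF assms(2)]
  show "(\<lambda>x. u x * cnj (v x)) \<in> borel_measurable lebesgue" by measurable
  show "AE x in lebesgue. norm (u x * cnj (v x)) \<le> norm ((cmod (u x))\<^sup>2 + (cmod (v x))\<^sup>2)"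
  proof (intro AE_I2)
    fix x
    have "cmod (u x) * cmod (v x) \<le> (cmod (u x))\<^sup>2 + (cmod (v x))\<^sup>2"
      using sum_squares_bound[of "cmod (u x)" "cmod (v x)"] mult_nonneg_nonneg[OF norm_ge_zero[of "u x"] norm_ge_zero[of "v x"]]
      by linarith
    then show "norm (u x * cnj (v x)) \<le> norm ((cmod (u x))\<^sup>2 + (cmod (v x))\<^sup>2)"
      by (simp add: norm_mult)
  qed
qed

lemma subspace_L2: "module.subspace fun_scale L2"
proof -
  interpret vector_space fun_scale by (rule vector_space_fun_scale)
  show ?thesis
    unfolding subspace_def
  proof (intro conjI ballI allI)
    fix u v assume uv: "u \<in> L2" "v \<in> L2"
    note [measurable] = L2_measurable[OF uv(1)] L2_measurable[OF uv(2)]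
    have "integrable lebesgue (\<lambda>x. (cmod (u x + v x))\<^sup>2)"
    proof (rule Bochner_Integration.integrable_bound)
      show "integrable lebesgue (\<lambda>x. 2 * (cmod (u x))\<^sup>2 + 2 * (cmod (v x))\<^sup>2)"
        using uv by (simp add: L2_iff)
      show "AE x in lebesgue. norm ((cmod (u x + v x))\<^sup>2) \<le> norm (2 * (cmod (u x))\<^sup>2 + 2 * (cmod (v x))\<^sup>2)"
      proof (intro AE_I2)
        fix x
        have "(cmod (u x + v x))\<^sup>2 \<le> (cmod (u x) + cmod (v x))\<^sup>2"
          by (intro power_mono norm_triangle_ineq norm_ge_zero)
        also have "\<dots> \<le> 2 * (cmod (u x))\<^sup>2 + 2 * (cmod (v x))\<^sup>2"
          using sum_squares_bound[of "cmod (u x)" "cmod (v x)"] by (simp add: power2_sum)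
        finally show "norm ((cmod (u x + v x))\<^sup>2) \<le> norm (2 * (cmod (u x))\<^sup>2 + 2 * (cmod (v x))\<^sup>2)" by simp
      qed
    qed measurable
    then show "u + v \<in> L2" using uv by (auto simp: L2_iff plus_fun_def)
  next
    fix c u assume "u \<in> L2"
    then show "fun_scale c u \<in> L2"
      by (auto simp: L2_iff fun_scale_def norm_mult power_mult_distrib)
  qed (simp add: L2_iff zero_fun_def)
qed

lemma hermitian_L2: "hermitian_form fun_scale L2 L2ip"
proof -
  interpret vector_space fun_scale by (rule vector_space_fun_scale)
  show ?thesis
  proof
    show "subspace L2" by (rule subspace_L2)
    show "L2ip (u + v) w = L2ip u w + L2ip v w" if "u \<in> L2" "v \<in> L2" "w \<in> L2" for u v w
      using that by (simp add: L2ip_eq distrib_right L2_integrable_prod)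
    show "L2ip (fun_scale c u) w = c * L2ip u w" if "u \<in> L2" "w \<in> L2" for u w c
      using that by (simp add: L2ip_eq mult.assoc)
    show "L2ip v u = cnj (L2ip u v)" if "u \<in> L2" "v \<in> L2" for u v
      by (simp add: L2ip_eq flip: Bochner_Integration.integral_cnj) (simp add: mult.commute)
    show "0 \<le> Re (L2ip u u)" if "u \<in> L2" for u
      by (simp add: L2ip_eq flip: complex_norm_square of_real_power)
  qed
qed

interpretation L2: hermitian_form fun_scale L2 L2ip by (rule hermitian_L2)

abbreviation L2norm :: "(real^2 \<Rightarrow> complex) \<Rightarrow> real" where "L2norm \<equiv> form_norm L2ip"

lemma L2norm_sq: "(L2norm u)\<^sup>2 = integral\<^sup>L lebesgue (\<lambda>x. (cmod (u x))\<^sup>2)"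
  by (simp add: form_norm_def L2ip_eq flip: complex_norm_square of_real_power)

lemma L2norm_eq: "L2norm u = sqrt (integral\<^sup>L lebesgue (\<lambda>x. (cmod (u x))\<^sup>2))"
  by (simp add: form_norm_def L2ip_eq flip: complex_norm_square of_real_power)

lemma L2norm_zero_iff: "u \<in> L2 \<Longrightarrow> L2norm u = 0 \<longleftrightarrow> (AE x in lebesgue. u x = 0)"
  using integral_nonneg_eq_0_iff_AE[OF L2_integrable, of u] by (simp add: L2norm_eq)

lemma L2_restrict:
  assumes "u \<in> L2" "S \<in> sets lebesgue" shows "restrict_fun S u \<in> L2"
proof -
  note [measurable] = L2_measurable[OF assms(1)] assms(2)
  have *: "restrict_fun S u = (\<lambda>x. indicator S x * u x)" by (auto simp: restrict_fun_def)
  have m: "restrict_fun S u \<in> borel_measurable lebesgue" unfolding * by measurable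
  have "integrable lebesgue (\<lambda>x. (cmod (restrict_fun S u x))\<^sup>2)"
    by (rule Bochner_Integration.integrable_bound[OF L2_integrable[OF assms(1)]])
      (use m in \<open>auto simp: restrict_fun_def\<close>)
  then show ?thesis using m by (simp add: L2_iff)
qed

lemma L2norm_mono:
  assumes "v \<in> L2" "\<And>x. cmod (u x) \<le> cmod (v x)" shows "L2norm u \<le> L2norm v"
  unfolding L2norm_eq using assms
  by (intro real_sqrt_le_mono integral_mono' L2_integrable power_mono) auto

text \<open>The function \<open>\<Sum>k. 2^k |s (k + 1) - s k|\<^sup>2\<close> has integral at
  most \<open>\<Sum>k. (1/2)^k\<close>. Where it is finite, the differences decay
  geometrically.\<close>

lemma L2_complete_subseq:
  assumes s: "\<And>k. s k \<in> L2" and fast: "\<And>k. L2norm (s (Suc k) - s k) \<le> (1/2)^k"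
  shows "\<exists>u. u \<in> borel_measurable lebesgue \<and> (AE x in lebesgue. (\<lambda>k. s k x) \<longlonglongrightarrow> u x)"
proof -
  note [measurable] = L2_measurable[OF s]
  have "(\<integral>\<^sup>+x. (\<Sum>k. ennreal (2^k * (cmod (s (Suc k) x - s k x))\<^sup>2)) \<partial>lebesgue) =
      (\<Sum>k. \<integral>\<^sup>+x. ennreal (2^k * (cmod (s (Suc k) x - s k x))\<^sup>2) \<partial>lebesgue)"
    by (rule nn_integral_suminf) measurable
  also have "\<dots> \<le> (\<Sum>k. ennreal ((1/2)^k))"
  proof (rule suminf_le)
    fix k
    have i: "integrable lebesgue (\<lambda>x. (cmod (s (Suc k) x - s k x))\<^sup>2)"
      using L2_integrable[OF L2.D_simps(4)[OF s s]] by simp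
    have "(\<integral>\<^sup>+x. ennreal (2^k * (cmod (s (Suc k) x - s k x))\<^sup>2) \<partial>lebesgue) =
        ennreal (integral\<^sup>L lebesgue (\<lambda>x. 2^k * (cmod (s (Suc k) x - s k x))\<^sup>2))"
      using i by (intro nn_integral_eq_integral) auto
    also have "integral\<^sup>L lebesgue (\<lambda>x. 2^k * (cmod (s (Suc k) x - s k x))\<^sup>2) = 2^k * (L2norm (s (Suc k) - s k))\<^sup>2"
      by (simp add: L2norm_sq)
    also have "ennreal \<dots> \<le> ennreal (2^k * ((1/2)^k)\<^sup>2)"
      using fast s by (intro ennreal_leI mult_left_mono power_mono) auto
    also have "2^k * ((1/2)^k)\<^sup>2 = (1/2::real)^k" by (simp add: power2_eq_square field_simps)
    finally show "(\<integral>\<^sup>+x. ennreal (2^k * (cmod (s (Suc k) x - s k x))\<^sup>2) \<partial>lebesgue) \<le> ennreal ((1/2)^k)" .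
  qed auto
  also have "\<dots> = ennreal (\<Sum>k. (1/2)^k)" by (intro suminf_ennreal2) auto
  finally have fin: "(\<integral>\<^sup>+x. (\<Sum>k. ennreal (2^k * (cmod (s (Suc k) x - s k x))\<^sup>2)) \<partial>lebesgue) \<noteq> \<infinity>"
    by (auto simp: top_unique)
  have "AE x in lebesgue. (\<Sum>k. ennreal (2^k * (cmod (s (Suc k) x - s k x))\<^sup>2)) \<noteq> \<infinity>"
    by (rule nn_integral_PInf_AE[OF _ fin]) measurable
  then have conv: "AE x in lebesgue. convergent (\<lambda>k. s k x)"
  proof eventually_elim
    case (elim x)
    then have "summable (\<lambda>k. 2^k * (cmod (s (Suc k) x - s k x))\<^sup>2)"
      by (intro summable_suminf_not_top) auto
    then have "(\<lambda>k. 2^k * (cmod (s (Suc k) x - s k x))\<^sup>2) \<longlonglongrightarrow> 0" by (rule summable_LIMSEQ_zero)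
    then have "Bseq (\<lambda>k. 2^k * (cmod (s (Suc k) x - s k x))\<^sup>2)" by (intro convergent_imp_Bseq convergentI)
    then obtain C where C: "C > 0" "\<And>k. norm (2^k * (cmod (s (Suc k) x - s k x))\<^sup>2) \<le> C" by (auto simp: Bseq_def)
    have bd: "cmod (s (Suc k) x - s k x) \<le> sqrt C * (sqrt (1/2))^k" for k
    proof -
      have "(cmod (s (Suc k) x - s k x))\<^sup>2 \<le> C * (1/2)^k"
        using C(2)[of k] by (simp add: field_simps)
      then have "cmod (s (Suc k) x - s k x) \<le> sqrt (C * (1/2)^k)" by (rule real_le_rsqrt)
      then show ?thesis by (simp add: real_sqrt_mult real_sqrt_power)
    qed
    have "summable (\<lambda>k. sqrt C * (sqrt (1/2))^k)"
      by (intro summable_mult summable_geometric) (simp add: real_sqrt_divide)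
    then have "summable (\<lambda>k. s (Suc k) x - s k x)"
      by (rule summable_comparison_test'[where N=0]) (rule bd)
    then have "convergent (\<lambda>n. \<Sum>k<n. s (Suc k) x - s k x)" by (simp add: summable_iff_convergent)
    then have "convergent (\<lambda>n. s n x - s 0 x)" by (simp add: sum_lessThan_telescope[of "\<lambda>k. s k x"])
    then show "convergent (\<lambda>k. s k x)" by (simp add: convergent_diff_const_right_iff)
  qed
  define u where "u = (\<lambda>x. lim (\<lambda>k. s k x))"
  have "u \<in> borel_measurable lebesgue" unfolding u_def by (rule borel_measurable_lim_metric) simp
  moreover have "AE x in lebesgue. (\<lambda>k. s k x) \<longlonglongrightarrow> u x"
    using conv by eventually_elim (simp add: u_def convergent_LIMSEQ_iff)
  ultimately show ?thesis by blast
qed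

lemma fast_Cauchy_subsequence:
  assumes "form_Cauchy h s"
  obtains r where "strict_mono r" "\<And>k l. l \<ge> r k \<Longrightarrow> form_norm h (s l - s (r k)) \<le> (1/2)^k"
proof -
  have "\<exists>r. strict_mono r \<and> (\<forall>k. \<forall>l\<ge>r k. form_norm h (s l - s (r k)) \<le> (1/2)^k)"
  proof -
    have "\<exists>N. \<forall>k\<ge>N. \<forall>l\<ge>N. form_norm h (s k - s l) < (1/2)^n" for n
      using assms unfolding form_Cauchy_def by simp
    then obtain N where N: "\<And>n k l. k \<ge> N n \<Longrightarrow> l \<ge> N n \<Longrightarrow> form_norm h (s k - s l) < (1/2)^n" by metis
    define r where "r = rec_nat (N 0) (\<lambda>n k. Suc (max k (N (Suc n))))"
    have "r n < r (Suc n)" for n by (simp add: r_def)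
    then have "strict_mono r" by (simp add: strict_mono_Suc_iff)
    moreover have "r n \<ge> N n" for n by (cases n) (simp_all add: r_def)
    then have "form_norm h (s l - s (r k)) \<le> (1/2)^k" if "l \<ge> r k" for k l
      using N[of k l "r k"] that by (meson less_imp_le order_trans)
    ultimately show ?thesis by blast
  qed
  then show ?thesis using that by blast
qed

text \<open>The Riesz-Fischer theorem: the limit is taken almost everywhere along a fast
  subsequence, and Fatou's lemma makes it a limit in norm.\<close>

theorem L2_complete:
  assumes s: "\<And>k. s k \<in> L2" and C: "form_Cauchy L2ip s"
  shows "\<exists>u\<in>L2. (\<lambda>k. L2norm (s k - u)) \<longlonglongrightarrow> 0"
proof -
  obtain r where r: "strict_mono r" "\<And>k l. l \<ge> r k \<Longrightarrow> L2norm (s l - s (r k)) \<le> (1/2)^k"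
    using fast_Cauchy_subsequence[OF C] by blast
  have "L2norm (s (r (Suc k)) - s (r k)) \<le> (1/2)^k" for k
    using r by (simp add: strict_mono_less_eq)
  then obtain u where u: "u \<in> borel_measurable lebesgue" "AE x in lebesgue. (\<lambda>k. s (r k) x) \<longlonglongrightarrow> u x"
    using L2_complete_subseq[of "\<lambda>k. s (r k)"] s by blast
  note [measurable] = L2_measurable[OF s] u(1)
  have bound: "(\<integral>\<^sup>+x. ennreal ((cmod (s k x - u x))\<^sup>2) \<partial>lebesgue) \<le> ennreal (e\<^sup>2)"
    if e: "e > 0" "\<And>l. l \<ge> N \<Longrightarrow> L2norm (s k - s l) \<le> e" for k N e
  proof -
    have "(\<integral>\<^sup>+x. ennreal ((cmod (s k x - u x))\<^sup>2) \<partial>lebesgue) =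
        (\<integral>\<^sup>+x. liminf (\<lambda>l. ennreal ((cmod (s k x - s (r l) x))\<^sup>2)) \<partial>lebesgue)"
    proof (rule nn_integral_cong_AE)
      show "AE x in lebesgue. ennreal ((cmod (s k x - u x))\<^sup>2) = liminf (\<lambda>l. ennreal ((cmod (s k x - s (r l) x))\<^sup>2))"
        using u(2)
      proof eventually_elim
        case (elim x)
        then have "(\<lambda>l. ennreal ((cmod (s k x - s (r l) x))\<^sup>2)) \<longlonglongrightarrow> ennreal ((cmod (s k x - u x))\<^sup>2)"
          by (intro tendsto_ennrealI tendsto_power tendsto_norm tendsto_diff tendsto_const)
        then show ?case by (intro lim_imp_Liminf[symmetric]) auto
      qed
    qed
    also have "\<dots> \<le> liminf (\<lambda>l. \<integral>\<^sup>+x. ennreal ((cmod (s k x - s (r l) x))\<^sup>2) \<partial>lebesgue)"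
      by (rule nn_integral_liminf) measurable
    also have "\<dots> \<le> ennreal (e\<^sup>2)"
    proof -
      have "(\<integral>\<^sup>+x. ennreal ((cmod (s k x - s (r l) x))\<^sup>2) \<partial>lebesgue) \<le> ennreal (e\<^sup>2)" if "l \<ge> N" for l
      proof -
        have i: "integrable lebesgue (\<lambda>x. (cmod (s k x - s (r l) x))\<^sup>2)"
          using L2_integrable[OF L2.D_simps(4)[OF s s]] by simp
        have "(\<integral>\<^sup>+x. ennreal ((cmod (s k x - s (r l) x))\<^sup>2) \<partial>lebesgue) = ennreal ((L2norm (s k - s (r l)))\<^sup>2)"
          using i by (simp add: nn_integral_eq_integral L2norm_sq)
        also have "\<dots> \<le> ennreal (e\<^sup>2)"
          using e that seq_suble[OF r(1), of l] s by (intro ennreal_leI power_mono) auto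
        finally show ?thesis .
      qed
      then have "\<forall>\<^sub>F l in sequentially. (\<integral>\<^sup>+x. ennreal ((cmod (s k x - s (r l) x))\<^sup>2) \<partial>lebesgue) \<le> ennreal (e\<^sup>2)"
        by (auto simp: eventually_sequentially)
      then have "liminf (\<lambda>l. \<integral>\<^sup>+x. ennreal ((cmod (s k x - s (r l) x))\<^sup>2) \<partial>lebesgue) \<le> liminf (\<lambda>l::nat. ennreal (e\<^sup>2))"
        by (rule Liminf_mono)
      then show ?thesis by (simp add: Liminf_const)
    qed
    finally show ?thesis .
  qed
  have diffL2: "s k - u \<in> L2 \<and> L2norm (s k - u) \<le> e" if e: "e > 0" "\<And>l. l \<ge> N \<Longrightarrow> L2norm (s k - s l) \<le> e" for k N e
  proof -
    have i: "integrable lebesgue (\<lambda>x. (cmod (s k x - u x))\<^sup>2)"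
      using le_less_trans[OF bound[OF e] ennreal_less_top] by (intro integrableI_nonneg) auto
    have "ennreal ((L2norm (s k - u))\<^sup>2) \<le> ennreal (e\<^sup>2)"
      using bound[OF e] i by (simp add: nn_integral_eq_integral L2norm_sq)
    then have "L2norm (s k - u) \<le> e" using e(1) by (simp add: power2_le_iff_abs_le)
    moreover have "s k - u \<in> L2" using i by (simp add: L2_iff fun_diff_def)
    ultimately show ?thesis by simp
  qed
  have close: "\<exists>N. \<forall>k\<ge>N. s k - u \<in> L2 \<and> L2norm (s k - u) \<le> e" if e: "e > 0" for e
  proof -
    obtain N where "\<And>k l. k \<ge> N \<Longrightarrow> l \<ge> N \<Longrightarrow> L2norm (s k - s l) < e"
      using C e unfolding form_Cauchy_def by blast
    then show ?thesis using diffL2[OF e] by (meson less_imp_le)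
  qed
  obtain N where "s N - u \<in> L2" using close[of 1] by auto
  then have uL2: "u \<in> L2" using L2.D_simps(4)[OF s[of N], of "s N - u"] by simp
  have "(\<lambda>k. L2norm (s k - u)) \<longlonglongrightarrow> 0"
  proof (rule LIMSEQ_I)
    fix e :: real assume "e > 0"
    then obtain N where "\<And>k. k \<ge> N \<Longrightarrow> L2norm (s k - u) \<le> e/2" using close[of "e/2"] by auto
    then show "\<exists>N. \<forall>k\<ge>N. norm (L2norm (s k - u) - 0) < e"
      using \<open>e > 0\<close> L2.form_norm_nonneg[OF L2.D_simps(4)[OF s uL2]] by (intro exI[of _ N]) fastforce
  qed
  then show ?thesis using uL2 by blast
qed

section \<open>Integrals of continuous functions with compact support\<close>

lemma continuous_compact_support_integrable:
  fixes f :: "real^2 \<Rightarrow> 'b::euclidean_space"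
  assumes "continuous_on UNIV f" "compact K" "\<And>x. x \<notin> K \<Longrightarrow> f x = 0"
  shows "integrable lborel f" "integrable lebesgue f"
proof -
  have "integrable lborel (\<lambda>x. indicator K x *\<^sub>R f x)"
    using assms by (intro borel_integrable_compact) (auto intro: continuous_on_subset)
  moreover have "(\<lambda>x. indicator K x *\<^sub>R f x) = f" using assms(3) by (auto simp: indicator_def)
  ultimately show l: "integrable lborel f" by simp
  then show "integrable lebesgue f" by (subst integrable_completion) auto
qed

lemma continuous_measurable_lebesgue:
  fixes f :: "real^2 \<Rightarrow> 'b::euclidean_space"
  assumes "continuous_on UNIV f" shows "f \<in> borel_measurable lebesgue"
  using borel_measurable_continuous_onI[OF assms] by (intro measurable_completion) simp

lemma continuous_compact_support_L2:
  assumes "continuous_on UNIV f" "compact K" "\<And>x. x \<notin> K \<Longrightarrow> f x = 0"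
  shows "f \<in> L2"
  unfolding L2_iff
  using continuous_measurable_lebesgue[OF assms(1)] assms
  by (auto intro!: continuous_compact_support_integrable(2)[of _ K] continuous_intros)

lemma test_L2: "test_fun \<Omega> u \<Longrightarrow> u \<in> L2"
  by (metis continuous_compact_support_L2 smooth_continuous test_fun_iff)

lemma test_integrable: "test_fun \<Omega> u \<Longrightarrow> integrable lebesgue u"
  by (metis continuous_compact_support_integrable(2) smooth_continuous test_fun_iff)

lemma lebesgue_translation:
  fixes f :: "real^2 \<Rightarrow> 'b::euclidean_space"
  assumes "continuous_on UNIV f"
  shows "integral\<^sup>L lebesgue (\<lambda>x. f (x + a)) = integral\<^sup>L lebesgue f"
proof -
  have [measurable]: "f \<in> borel_measurable borel" using assms by (rule borel_measurable_continuous_onI)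
  have "integral\<^sup>L lborel f = integral\<^sup>L (distr lborel borel ((+) a)) f" by (simp add: lborel_distr_plus)
  also have "\<dots> = integral\<^sup>L lborel (\<lambda>x. f (a + x))" by (rule integral_distr) auto
  finally show ?thesis by (simp add: integral_completion add.commute)
qed

section \<open>Difference quotients and integration by parts\<close>

definition dir_deriv :: "(real^2 \<Rightarrow> complex) \<Rightarrow> real^2 \<Rightarrow> real^2 \<Rightarrow> complex" where
  "dir_deriv u z x = (\<Sum>j\<in>UNIV. of_real (z $ j) * partial j u x)"

definition diff_quot :: "(real^2 \<Rightarrow> complex) \<Rightarrow> real^2 \<Rightarrow> nat \<Rightarrow> real^2 \<Rightarrow> complex" where
  "diff_quot u z n x = of_nat (Suc n) * (u (x + (1 / real (Suc n)) *\<^sub>R z) - u x)"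

lemma test_bounded:
  assumes "test_fun \<Omega> u" obtains M where "M \<ge> 0" "\<And>x. cmod (u x) \<le> M"
proof -
  obtain K where K: "compact K" "\<And>x. x \<notin> K \<Longrightarrow> u x = 0" using test_support[OF assms] by metis
  have "bounded (u ` K)"
    using K(1) assms by (intro compact_imp_bounded compact_continuous_image smooth_continuous test_smooth)
  then obtain M where M: "\<And>x. x \<in> K \<Longrightarrow> cmod (u x) \<le> M" by (auto simp: bounded_iff)
  have "cmod (u x) \<le> max M 0" for x using M[of x] K(2)[of x] by (cases "x \<in> K") auto
  then show ?thesis using that[of "max M 0"] by simp
qed

lemma test_Lipschitz:
  assumes u: "test_fun \<Omega> u"
  obtains L where "L \<ge> 0" "\<And>x y. cmod (u x - u y) \<le> L * norm (x - y)"
proof -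
  have "\<forall>j. \<exists>M\<ge>0. \<forall>x. cmod (partial j u x) \<le> M" using test_bounded[OF test_partial[OF u]] by metis
  then obtain M where M: "\<And>j. M j \<ge> 0" "\<And>j x. cmod (partial j u x) \<le> M j" by metis
  define L where "L = (\<Sum>j\<in>UNIV. M j)"
  have "onorm (\<lambda>h. \<Sum>j\<in>UNIV. of_real (h $ j) * partial j u x) \<le> L" for x
  proof (rule onorm_le)
    fix h :: "real^2"
    have "cmod (\<Sum>j\<in>UNIV. of_real (h $ j) * partial j u x) \<le> (\<Sum>j\<in>UNIV. norm h * M j)"
      by (rule sum_norm_le) (auto simp: norm_mult intro!: mult_mono M component_le_norm_cart)
    then show "norm (\<Sum>j\<in>UNIV. of_real (h $ j) * partial j u x) \<le> L * norm h"
      by (simp add: L_def sum_distrib_left mult.commute)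
  qed
  then have "cmod (u x - u y) \<le> L * norm (x - y)" for x y
    using smooth_has_derivative[OF test_smooth[OF u]]
    by (intro differentiable_bound[of UNIV u "\<lambda>x h. \<Sum>j\<in>UNIV. of_real (h $ j) * partial j u x"])
      (auto intro: has_derivative_at_withinI)
  moreover have "L \<ge> 0" unfolding L_def using M by (intro sum_nonneg) auto
  ultimately show ?thesis using that by blast
qed

lemma diff_quot_tendsto:
  assumes "smooth_fun u" shows "(\<lambda>n. diff_quot u z n x) \<longlonglongrightarrow> dir_deriv u z x"
proof -
  have g: "((\<lambda>t. x + t *\<^sub>R z) has_derivative (\<lambda>t. t *\<^sub>R z)) (at 0)"
    by (auto intro!: derivative_eq_intros)
  have "((\<lambda>t. u (x + t *\<^sub>R z)) has_derivative (\<lambda>t. \<Sum>j\<in>UNIV. of_real ((t *\<^sub>R z) $ j) * partial j u x)) (at 0)"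
    using has_derivative_compose[OF g, of u "\<lambda>h. \<Sum>j\<in>UNIV. of_real (h $ j) * partial j u x"]
      smooth_has_derivative[OF assms, of x] by simp
  moreover have "(\<lambda>t. \<Sum>j\<in>UNIV. of_real ((t *\<^sub>R z) $ j) * partial j u x) = (\<lambda>t. t *\<^sub>R dir_deriv u z x)"
    by (simp add: dir_deriv_def fun_eq_iff scaleR_conv_of_real[where 'a=complex] sum_distrib_left mult.assoc)
  ultimately have "((\<lambda>t. u (x + t *\<^sub>R z)) has_derivative (\<lambda>t. t *\<^sub>R dir_deriv u z x)) (at 0)" by simp
  then have lim: "(\<lambda>t. norm (u (x + t *\<^sub>R z) - u x - t *\<^sub>R dir_deriv u z x) / norm t) \<midarrow>0\<rightarrow> 0"
    by (simp add: has_derivative_at)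
  have "(\<lambda>n. 1 / real (Suc n)) \<longlonglongrightarrow> 0"
    using LIMSEQ_inverse_real_of_nat by (simp add: inverse_eq_divide)
  then have "filterlim (\<lambda>n. 1 / real (Suc n)) (at 0) sequentially"
    by (simp add: filterlim_at)
  then have "(\<lambda>n. norm (u (x + (1 / real (Suc n)) *\<^sub>R z) - u x - (1 / real (Suc n)) *\<^sub>R dir_deriv u z x) / norm (1 / real (Suc n))) \<longlonglongrightarrow> 0"
    by (rule filterlim_compose[OF lim])
  moreover have "norm (u (x + (1 / real (Suc n)) *\<^sub>R z) - u x - (1 / real (Suc n)) *\<^sub>R dir_deriv u z x) / norm (1 / real (Suc n))
      = norm (diff_quot u z n x - dir_deriv u z x)" for n
  proof -
    let ?N = "complex_of_nat (Suc n)" and ?d = "u (x + (1 / real (Suc n)) *\<^sub>R z) - u x"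
    have "diff_quot u z n x - dir_deriv u z x = ?N * (?d - (1 / real (Suc n)) *\<^sub>R dir_deriv u z x)"
      unfolding diff_quot_def right_diff_distrib scaleR_conv_of_real
      by (simp del: of_nat_Suc)
    then have "norm (diff_quot u z n x - dir_deriv u z x) = norm ?N * norm (?d - (1 / real (Suc n)) *\<^sub>R dir_deriv u z x)"
      by (simp only: norm_mult)
    then show ?thesis by (simp del: of_nat_Suc add: mult.commute)
  qed
  ultimately have "(\<lambda>n. norm (diff_quot u z n x - dir_deriv u z x)) \<longlonglongrightarrow> 0" by simp
  then show ?thesis by (simp add: tendsto_norm_zero_iff LIM_zero_iff)
qed

lemma diff_quot_bound:
  assumes u: "test_fun \<Omega> u"
  obtains L K where "compact K" "\<And>n x. x \<notin> K \<Longrightarrow> diff_quot u z n x = 0" "\<And>n x. cmod (diff_quot u z n x) \<le> L"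
proof -
  obtain L where L: "L \<ge> 0" "\<And>x y. cmod (u x - u y) \<le> L * norm (x - y)" using test_Lipschitz[OF u] by metis
  obtain K where K: "compact K" "\<And>x. x \<notin> K \<Longrightarrow> u x = 0" using test_support[OF u] by metis
  then obtain R where R: "\<And>x. x \<in> K \<Longrightarrow> norm x \<le> R" using compact_imp_bounded bounded_iff by metis
  have zero: "diff_quot u z n x = 0" if x: "x \<notin> cball 0 (R + norm z)" for n x
  proof -
    have "norm ((1 / real (Suc n)) *\<^sub>R z) \<le> norm z"
      using mult_right_mono[of "1 / real (Suc n)" 1 "norm z"] by simp
    moreover have "norm x \<le> norm (x + (1 / real (Suc n)) *\<^sub>R z) + norm ((1 / real (Suc n)) *\<^sub>R z)"
      using norm_triangle_ineq4[of "x + (1 / real (Suc n)) *\<^sub>R z" "(1 / real (Suc n)) *\<^sub>R z"] by simp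
    ultimately have "norm (x + (1 / real (Suc n)) *\<^sub>R z) > R" "norm x > R" using x norm_ge_zero[of z] by (auto simp: dist_norm simp del: norm_ge_zero)
    then have "x + (1 / real (Suc n)) *\<^sub>R z \<notin> K" "x \<notin> K" using R by (meson not_le)+
    then show ?thesis using K(2) by (simp add: diff_quot_def)
  qed
  have bd: "cmod (diff_quot u z n x) \<le> L * norm z" for n x
  proof -
    have "cmod (diff_quot u z n x) \<le> real (Suc n) * (L * norm ((1 / real (Suc n)) *\<^sub>R z))"
      unfolding diff_quot_def norm_mult norm_of_nat
      using L(2)[of "x + (1 / real (Suc n)) *\<^sub>R z" x] unfolding add_diff_cancel_left'
      by (intro mult_left_mono) (assumption, simp)
    also have "\<dots> = L * norm z" by simp
    finally show ?thesis .
  qed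
  show ?thesis by (rule that[OF compact_cball zero bd])
qed

lemma test_continuous: "test_fun \<Omega> u \<Longrightarrow> continuous_on S u"
  by (intro smooth_continuous test_smooth)

lemma diff_quot_continuous:
  "test_fun \<Omega> u \<Longrightarrow> continuous_on UNIV (diff_quot u z n)"
  unfolding diff_quot_def by (intro continuous_intros continuous_on_compose2[OF test_continuous]) auto

lemma dir_deriv_continuous:
  "test_fun \<Omega> u \<Longrightarrow> continuous_on UNIV (dir_deriv u z)"
  unfolding dir_deriv_def by (intro continuous_intros test_continuous test_partial)

text \<open>Dominated convergence: test functions are Lipschitz, so the difference quotients
  have a common bound and a common compact support.\<close>

lemma integral_diff_quot_tendsto:
  fixes F :: "complex \<Rightarrow> 'b::euclidean_space"
  assumes u: "test_fun \<Omega> u" and F: "continuous_on UNIV F" "F 0 = 0"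
  shows "(\<lambda>n. integral\<^sup>L lebesgue (\<lambda>x. F (diff_quot u z n x))) \<longlonglongrightarrow> integral\<^sup>L lebesgue (\<lambda>x. F (dir_deriv u z x))"
proof -
  obtain L K where LK: "compact K" "\<And>n x. x \<notin> K \<Longrightarrow> diff_quot u z n x = 0" "\<And>n x. cmod (diff_quot u z n x) \<le> L"
    using diff_quot_bound[OF u] by metis
  have "bounded (F ` cball 0 L)" using F(1) by (intro compact_imp_bounded compact_continuous_image) (auto intro: continuous_on_subset)
  then obtain M where M: "\<And>w. cmod w \<le> L \<Longrightarrow> norm (F w) \<le> M" unfolding bounded_iff by (metis imageI mem_cball_0)
  show ?thesis
  proof (rule integral_dominated_convergence[where w="\<lambda>x. M * indicator K x"])
    show "(\<lambda>x. F (dir_deriv u z x)) \<in> borel_measurable lebesgue"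
      by (intro continuous_measurable_lebesgue continuous_on_compose2[OF F(1) dir_deriv_continuous[OF u]]) auto
    show "(\<lambda>x. F (diff_quot u z n x)) \<in> borel_measurable lebesgue" for n
      by (intro continuous_measurable_lebesgue continuous_on_compose2[OF F(1) diff_quot_continuous[OF u]]) auto
    show "integrable lebesgue (\<lambda>x. M * indicator K x)"
      using lmeasurable_compact[OF LK(1)] by (intro integrable_mult_right integrable_real_indicator) (auto simp: fmeasurable_def)
    show "AE x in lebesgue. (\<lambda>n. F (diff_quot u z n x)) \<longlonglongrightarrow> F (dir_deriv u z x)"
      using diff_quot_tendsto[OF test_smooth[OF u]] F(1)
      by (intro AE_I2 isCont_tendsto_compose[of _ F]) (auto simp: continuous_on_eq_continuous_at)
    show "AE x in lebesgue. norm (F (diff_quot u z n x)) \<le> M * indicator K x" for n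
      using M LK(2,3) F(2) by (intro AE_I2) (auto simp: indicator_def)
  qed
qed

lemma dir_deriv_axis: "dir_deriv u (axis j 1) x = partial j u x"
  by (simp add: dir_deriv_def axis_def if_distrib[of complex_of_real] if_distrib[of "\<lambda>c. c * _"] cong: if_cong)

text \<open>By translation invariance the integral of every difference quotient
  vanishes.\<close>

lemma integral_partial_zero:
  assumes u: "test_fun \<Omega> u" shows "integral\<^sup>L lebesgue (partial j u) = 0"
proof -
  have "integral\<^sup>L lebesgue (\<lambda>x. diff_quot u (axis j 1) n x) = 0" for n
  proof -
    let ?z = "(1 / real (Suc n)) *\<^sub>R (axis j 1 :: real^2)"
    have c: "continuous_on UNIV u" using test_continuous u by blast
    have i: "integrable lebesgue u" using u by (rule test_integrable)
    have "integrable lborel u"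
      using i c by (subst (asm) integrable_completion) (auto intro: borel_measurable_continuous_onI)
    have t: "integral\<^sup>L lebesgue (\<lambda>x. u (x + ?z)) = integral\<^sup>L lebesgue u" by (rule lebesgue_translation[OF c])
    have "integrable lebesgue (\<lambda>x. u (x + ?z))"
    proof -
      obtain K where K: "compact K" "\<And>x. x \<notin> K \<Longrightarrow> u x = 0" using test_support[OF u] by metis
      have "compact ((\<lambda>x. x - ?z) ` K)" using K(1) by (intro compact_continuous_image continuous_intros)
      moreover have "u (x + ?z) = 0" if "x \<notin> (\<lambda>x. x - ?z) ` K" for x
      proof (rule K(2))
        show "x + ?z \<notin> K" using that by (metis add_diff_cancel_right' image_eqI)
      qed
      ultimately show ?thesis
        by (intro continuous_compact_support_integrable(2)[of _ "(\<lambda>x. x - ?z) ` K"] continuous_on_compose2[OF c] continuous_intros) auto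
    qed
    then show ?thesis using i t by (simp add: diff_quot_def)
  qed
  then have "(\<lambda>n::nat. 0) \<longlonglongrightarrow> integral\<^sup>L lebesgue (\<lambda>x. dir_deriv u (axis j 1) x)"
    using integral_diff_quot_tendsto[OF u, of "\<lambda>w. w" "axis j 1"] by simp
  then show ?thesis by (simp add: dir_deriv_axis LIMSEQ_const_iff)
qed

lemma magnetic_gradient_symmetric:
  assumes u: "test_fun \<Omega> u" and v: "test_fun \<Omega> v"
  shows "L2ip (magnetic_gradient B u j) v = L2ip u (magnetic_gradient B v j)"
proof -
  have sm: "smooth_fun u" "smooth_fun v" using u v test_smooth by auto
  have uv: "test_fun \<Omega> (\<lambda>x. u x * cnj (v x))" using test_mult[OF test_cnj[OF v] sm(1)] .
  have p: "partial j (\<lambda>x. u x * cnj (v x)) x = u x * cnj (partial j v x) + partial j u x * cnj (v x)" for x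
    using sm by (simp add: partial_mult partial_cnj smooth_differentiable smooth_cnj)
  have "L2ip (magnetic_gradient B u j) v - L2ip u (magnetic_gradient B v j) =
      integral\<^sup>L lebesgue (\<lambda>x. magnetic_gradient B u j x * cnj (v x) - u x * cnj (magnetic_gradient B v j x))"
    unfolding L2ip_eq
    by (intro Bochner_Integration.integral_diff[symmetric] L2_integrable_prod test_L2[of \<Omega>] test_magnetic_gradient u v)
  also have "(\<lambda>x. magnetic_gradient B u j x * cnj (v x) - u x * cnj (magnetic_gradient B v j x)) =
      (\<lambda>x. - \<i> * partial j (\<lambda>x. u x * cnj (v x)) x)"
    unfolding p by (auto simp: magnetic_gradient_def fun_eq_iff algebra_simps)
  also have "integral\<^sup>L lebesgue \<dots> = 0" using integral_partial_zero[OF uv, of j] by simp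
  finally show ?thesis by simp
qed

section \<open>The magnetic form is closable\<close>

abbreviation mform :: "real \<Rightarrow> (real^2 \<Rightarrow> complex) \<Rightarrow> (real^2 \<Rightarrow> complex) \<Rightarrow> complex" where
  "mform B \<equiv> magnetic_form UNIV B"

lemma mform_eq:
  assumes "test_fun \<Omega> u" "test_fun \<Omega> v"
  shows "mform B u v = (\<Sum>j\<in>UNIV. L2ip (magnetic_gradient B u j) (magnetic_gradient B v j))"
  unfolding magnetic_form_def lebesgue_on_UNIV_eq L2ip_eq
  by (intro Bochner_Integration.integral_sum L2_integrable_prod test_L2[of \<Omega>] test_magnetic_gradient assms)

lemma magnetic_form_local:
  assumes u: "test_fun \<Omega> u" and "\<Omega> \<in> sets lebesgue"
  shows "magnetic_form \<Omega> B u v = mform B u v"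
proof -
  have "magnetic_gradient B u j x = 0" if "x \<notin> \<Omega>" for x j using test_zero_outside[OF test_magnetic_gradient[OF u]] that by blast
  then have "(\<lambda>x. indicator \<Omega> x *\<^sub>R (\<Sum>j\<in>UNIV. magnetic_gradient B u j x * cnj (magnetic_gradient B v j x))) =
      (\<lambda>x. \<Sum>j\<in>UNIV. magnetic_gradient B u j x * cnj (magnetic_gradient B v j x))"
    by (auto simp: indicator_def)
  then show ?thesis
    unfolding magnetic_form_def lebesgue_on_UNIV_eq using assms(2) by (subst integral_restrict_space) auto
qed

definition tests :: "(real^2) set \<Rightarrow> (real^2 \<Rightarrow> complex) set" where
  "tests \<Omega> = Collect (test_fun \<Omega>)"

lemma hermitian_mform: "hermitian_form fun_scale (tests \<Omega>) (mform B)"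
proof -
  interpret vector_space fun_scale by (rule vector_space_fun_scale)
  have L: "magnetic_gradient B u j \<in> L2" if "test_fun \<Omega> u" for u j using that test_L2 test_magnetic_gradient by blast
  have ga: "magnetic_gradient B (u + v) j = magnetic_gradient B u j + magnetic_gradient B v j"
    if "test_fun \<Omega> u" "test_fun \<Omega> v" for u v j
    using that magnetic_gradient_add[of u v B j] test_smooth by (fastforce simp: plus_fun_def)
  have gs: "magnetic_gradient B (fun_scale c u) j = fun_scale c (magnetic_gradient B u j)"
    if "test_fun \<Omega> u" for u j c
    using that magnetic_gradient_cmult[of u B c j] test_smooth by (fastforce simp: fun_scale_def)
  have ta: "test_fun \<Omega> (u + v)" if "test_fun \<Omega> u" "test_fun \<Omega> v" for u v
    using test_add[OF that] by (simp add: plus_fun_def)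
  have ts: "test_fun \<Omega> (fun_scale c u)" if "test_fun \<Omega> u" for u c
    using test_cmult[OF that] by (simp add: fun_scale_def)
  show ?thesis
  proof
    show "subspace (tests \<Omega>)"
      unfolding subspace_def tests_def using ta ts test_zero by (auto simp: zero_fun_def)
    show "mform B (u + v) w = mform B u w + mform B v w" if "u \<in> tests \<Omega>" "v \<in> tests \<Omega>" "w \<in> tests \<Omega>" for u v w
      using that unfolding tests_def by (simp add: mform_eq[of \<Omega>] ta ga L2.add_left L sum.distrib)
    show "mform B (fun_scale c u) w = c * mform B u w" if "u \<in> tests \<Omega>" "w \<in> tests \<Omega>" for u w c
      using that unfolding tests_def by (simp add: mform_eq[of \<Omega>] ts gs L2.scale_left L sum_distrib_left)
    show "mform B v u = cnj (mform B u v)" if "u \<in> tests \<Omega>" "v \<in> tests \<Omega>" for u v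
    proof -
      have "L2ip (magnetic_gradient B v j) (magnetic_gradient B u j) = cnj (L2ip (magnetic_gradient B u j) (magnetic_gradient B v j))" for j
        using that unfolding tests_def by (intro L2.herm L) auto
      then show ?thesis using that unfolding tests_def by (simp add: mform_eq[of \<Omega>])
    qed
    show "0 \<le> Re (mform B u u)" if "u \<in> tests \<Omega>" for u
      using that unfolding tests_def by (simp add: mform_eq[of \<Omega>] L2.nonneg L sum_nonneg)
  qed
qed

definition magnetic_op :: "real \<Rightarrow> (real^2 \<Rightarrow> complex) \<Rightarrow> real^2 \<Rightarrow> complex" where
  "magnetic_op B v = (\<Sum>j\<in>UNIV. magnetic_gradient B (magnetic_gradient B v j) j)"

lemma mform_by_parts:
  assumes u: "test_fun \<Omega> u" and v: "test_fun \<Omega> v"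
  shows "magnetic_op B v \<in> L2" "mform B u v = L2ip u (magnetic_op B v)"
proof -
  have L: "magnetic_gradient B (magnetic_gradient B v j) j \<in> L2" for j using v test_L2 test_magnetic_gradient by blast
  then show "magnetic_op B v \<in> L2" unfolding magnetic_op_def by (intro L2.D_simps(6))
  have "mform B u v = (\<Sum>j\<in>UNIV. L2ip u (magnetic_gradient B (magnetic_gradient B v j) j))"
    using u v by (simp add: mform_eq[of \<Omega>] magnetic_gradient_symmetric[of \<Omega>] test_magnetic_gradient)
  also have "\<dots> = L2ip u (magnetic_op B v)"
    unfolding magnetic_op_def using L test_L2[OF u] by (subst L2.sum_right) auto
  finally show "mform B u v = L2ip u (magnetic_op B v)" .
qed

text \<open>In \<open>q (s k) (s k) = q (s k) (s k - s N) + ip (s k) (H (s N))\<close>, where H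
  is the differential operator of the form, the first term is small by the Cauchy condition and
  the second tends to 0 with the norm of s k.\<close>

lemma mform_closable:
  assumes s: "\<And>k. s k \<in> tests \<Omega>" and null: "(\<lambda>k. L2norm (s k)) \<longlonglongrightarrow> 0" and C: "form_Cauchy (mform B) s"
  shows "(\<lambda>k. form_norm (mform B) (s k)) \<longlonglongrightarrow> 0"
proof -
  interpret q: hermitian_form fun_scale "tests \<Omega>" "mform B" by (rule hermitian_mform)
  obtain M where M: "M > 0" "\<And>k. form_norm (mform B) (s k) \<le> M" using q.form_Cauchy_bounded[OF s C] by blast
  have t: "test_fun \<Omega> (s k)" for k using s by (simp add: tests_def)
  show ?thesis
  proof (rule LIMSEQ_I)
    fix e :: real assume e: "e > 0"
    have "e\<^sup>2 / (2 * M) > 0" using e M by simp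
    then obtain N where N: "\<And>k l. k \<ge> N \<Longrightarrow> l \<ge> N \<Longrightarrow> form_norm (mform B) (s k - s l) < e\<^sup>2 / (2 * M)"
      using C unfolding form_Cauchy_def by meson
    have "(\<lambda>k. L2ip (s k) (magnetic_op B (s N))) \<longlonglongrightarrow> L2ip 0 (magnetic_op B (s N))"
      by (rule L2.tendsto_form) (use null test_L2[OF t] mform_by_parts(1)[OF t t] in simp_all)
    then have "(\<lambda>k. cmod (mform B (s k) (s N))) \<longlonglongrightarrow> 0"
      using mform_by_parts[OF t t] tendsto_norm_zero by simp
    then have "\<forall>\<^sub>F k in sequentially. cmod (mform B (s k) (s N)) < e\<^sup>2 / 2"
      using e by (intro order_tendstoD) auto
    then obtain N' where N': "\<And>k. k \<ge> N' \<Longrightarrow> cmod (mform B (s k) (s N)) < e\<^sup>2 / 2" by (auto simp: eventually_sequentially)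
    have "norm (form_norm (mform B) (s k) - 0) < e" if k: "k \<ge> max N N'" for k
    proof -
      have "Re (mform B (s k) (s k)) = Re (mform B (s k) (s k - s N)) + Re (mform B (s k) (s N))"
        using s by (simp add: q.diff_right)
      also have "\<dots> \<le> cmod (mform B (s k) (s k - s N)) + cmod (mform B (s k) (s N))"
        by (intro add_mono complex_Re_le_cmod)
      also have "\<dots> \<le> form_norm (mform B) (s k) * form_norm (mform B) (s k - s N) + cmod (mform B (s k) (s N))"
        using s by (intro add_mono q.Cauchy_Schwarz) auto
      also have "\<dots> \<le> M * (e\<^sup>2 / (2 * M)) + cmod (mform B (s k) (s N))"
        using s M N[of k N] k by (intro add_mono mult_mono) auto
      also have "\<dots> < e\<^sup>2" using M N'[of k] k by simp
      finally have "(form_norm (mform B) (s k))\<^sup>2 < e\<^sup>2" using q.form_norm_sq[OF s] by simp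
      then show ?thesis using e s by (simp add: power2_less_imp_less)
    qed
    then show "\<exists>N. \<forall>k\<ge>N. norm (form_norm (mform B) (s k) - 0) < e" by blast
  qed
qed

definition L2_on :: "(real^2) set \<Rightarrow> (real^2 \<Rightarrow> complex) set" where
  "L2_on \<Omega> = {u \<in> L2. \<forall>x. x \<notin> \<Omega> \<longrightarrow> u x = 0}"

lemma closable_mform:
  assumes "\<Omega> \<in> sets lebesgue"
  shows "closable_form fun_scale (L2_on \<Omega>) (tests \<Omega>) L2ip (mform B)"
proof -
  interpret q: hermitian_form fun_scale "tests \<Omega>" "mform B" by (rule hermitian_mform)
  have "L2.subspace (L2_on \<Omega>)" unfolding L2.subspace_def L2_on_def by auto
  then interpret ip: hermitian_form fun_scale "L2_on \<Omega>" L2ip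
    by (rule L2.hermitian_form_subspace) (auto simp: L2_on_def)
  show ?thesis
  proof
    show "tests \<Omega> \<subseteq> L2_on \<Omega>" unfolding tests_def L2_on_def using test_L2 test_zero_outside by blast
    show "(\<lambda>k. form_norm (mform B) (s k)) \<longlonglongrightarrow> 0"
      if "\<And>k. s k \<in> tests \<Omega>" "(\<lambda>k. L2norm (s k)) \<longlonglongrightarrow> 0" "form_Cauchy (mform B) s" for s
      using mform_closable[OF that] .
    show "\<exists>u\<in>L2_on \<Omega>. (\<lambda>k. L2norm (s k - u)) \<longlonglongrightarrow> 0"
      if s: "\<And>k. s k \<in> L2_on \<Omega>" and C: "form_Cauchy L2ip s" for s
    proof -
      have sL: "s k \<in> L2" for k using s by (simp add: L2_on_def)
      obtain u where u: "u \<in> L2" "(\<lambda>k. L2norm (s k - u)) \<longlonglongrightarrow> 0" using L2_complete[OF sL C] by blast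
      have "L2norm (s k - restrict_fun \<Omega> u) \<le> L2norm (s k - u)" for k
        using s[of k] sL u(1) by (intro L2norm_mono) (auto simp: restrict_fun_def L2_on_def)
      then have "(\<lambda>k. L2norm (s k - restrict_fun \<Omega> u)) \<longlonglongrightarrow> 0"
        using sL L2_restrict[OF u(1) assms]
        by (intro tendsto_sandwich[OF always_eventually always_eventually tendsto_const u(2)]) auto
      moreover have "restrict_fun \<Omega> u \<in> L2_on \<Omega>" using L2_restrict[OF u(1) assms] by (simp add: L2_on_def restrict_fun_def)
      ultimately show ?thesis by blast
    qed
  qed
qed

section \<open>Translations of test functions\<close>

lemma L2norm_translation:
  assumes "continuous_on UNIV u" shows "L2norm (\<lambda>x. u (x + a)) = L2norm u"
  unfolding L2norm_eq using lebesgue_translation[of "\<lambda>x. (cmod (u x))\<^sup>2" a] assms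
  by (simp add: continuous_intros)

lemma test_translate:
  assumes "test_fun \<Omega> u" shows "test_fun UNIV (\<lambda>x. u (x + a))"
proof -
  obtain K where K: "compact K" "\<And>x. x \<notin> K \<Longrightarrow> u x = 0" using test_support[OF assms] by metis
  have "smooth_fun (\<lambda>x. u (a + 1 *\<^sub>R x))" using assms by (intro smooth_affine test_smooth)
  then have "smooth_fun (\<lambda>x. u (x + a))" by (simp add: add.commute)
  moreover have "compact ((\<lambda>x. x - a) ` K)" using K(1) by (intro compact_continuous_image continuous_intros)
  moreover have "u (x + a) = 0" if "x \<notin> (\<lambda>x. x - a) ` K" for x
  proof (rule K(2))
    show "x + a \<notin> K" using that by (metis add_diff_cancel_right' image_eqI)
  qed
  ultimately show ?thesis unfolding test_fun_iff by blast
qed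

lemma (in hermitian_form) form_norm_sum_le:
  "finite I \<Longrightarrow> (\<And>i. i \<in> I \<Longrightarrow> f i \<in> D) \<Longrightarrow> form_norm h (sum f I) \<le> (\<Sum>i\<in>I. form_norm h (f i))"
proof (induction I rule: finite_induct)
  case (insert i I)
  then have "sum f I \<in> D" by (intro D_simps(6)) auto
  then show ?case using insert form_norm_triangle[of "f i" "sum f I"] by fastforce
qed simp

text \<open>A translation by z consists of n + 1 translations by \<open>z / (n + 1)\<close>,
  each of which changes u by \<open>1 / (n + 1)\<close> times a translated difference
  quotient.\<close>

lemma translation_le_dir_deriv:
  assumes u: "test_fun \<Omega> u"
  shows "L2norm (\<lambda>x. u (x + z) - u x) \<le> L2norm (dir_deriv u z)"
proof -
  have c: "continuous_on UNIV u" using test_continuous u by blast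
  have "L2norm (\<lambda>x. u (x + z) - u x) \<le> L2norm (diff_quot u z n)" for n
  proof -
    let ?y = "(1 / real (Suc n)) *\<^sub>R z"
    define f where "f = (\<lambda>k x. u (x + real (Suc k) *\<^sub>R ?y) - u (x + real k *\<^sub>R ?y))"
    have fL: "f k \<in> L2" for k
      unfolding f_def using test_L2[OF test_diff[OF test_translate[OF u] test_translate[OF u]]] by simp
    have "(\<lambda>x. u (x + z) - u x) = (\<Sum>k<Suc n. f k)"
    proof
      fix x
      have "(\<Sum>k<Suc n. f k) x = (\<Sum>k<Suc n. f k x)" by (induction n) auto
      also have "\<dots> = u (x + real (Suc n) *\<^sub>R ?y) - u (x + real 0 *\<^sub>R ?y)"
        unfolding f_def by (rule sum_lessThan_telescope)
      finally show "u (x + z) - u x = (\<Sum>k<Suc n. f k) x" by simp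
    qed
    then have "L2norm (\<lambda>x. u (x + z) - u x) \<le> (\<Sum>k<Suc n. L2norm (f k))"
      using fL by (simp only:) (intro L2.form_norm_sum_le, auto)
    also have "\<dots> = (\<Sum>k<Suc n. 1 / real (Suc n) * L2norm (diff_quot u z n))"
    proof (rule sum.cong[OF refl])
      fix k
      have "f k = (\<lambda>x. fun_scale (of_real (1 / real (Suc n))) (diff_quot u z n) (x + real k *\<^sub>R ?y))"
        by (simp add: f_def diff_quot_def fun_eq_iff algebra_simps scaleR_add_left[symmetric] add_divide_distrib[symmetric] of_nat_Suc[of k] del: of_nat_Suc)
      then have "L2norm (f k) = L2norm (fun_scale (of_real (1 / real (Suc n))) (diff_quot u z n))"
        using diff_quot_continuous[OF u] by (simp only:) (intro L2norm_translation, unfold fun_scale_def, intro continuous_intros)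
      moreover have "diff_quot u z n \<in> L2"
        using test_L2[OF test_cmult[OF test_diff[OF test_translate[OF u] test_mono[OF u]]]] unfolding diff_quot_def by simp
      ultimately show "L2norm (f k) = 1 / real (Suc n) * L2norm (diff_quot u z n)"
        by (simp add: L2.form_norm_scale norm_divide del: of_nat_Suc)
    qed
    also have "\<dots> = L2norm (diff_quot u z n)" by (simp del: of_nat_Suc)
    finally show ?thesis .
  qed
  moreover have "(\<lambda>n. L2norm (diff_quot u z n)) \<longlonglongrightarrow> L2norm (dir_deriv u z)"
  proof -
    have "(\<lambda>n. integral\<^sup>L lebesgue (\<lambda>x. (\<lambda>w. (cmod w)\<^sup>2) (diff_quot u z n x))) \<longlonglongrightarrow>
        integral\<^sup>L lebesgue (\<lambda>x. (\<lambda>w. (cmod w)\<^sup>2) (dir_deriv u z x))"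
      by (rule integral_diff_quot_tendsto[OF u]) (auto intro!: continuous_intros)
    then show ?thesis unfolding L2norm_eq by (intro tendsto_real_sqrt)
  qed
  ultimately show ?thesis by (intro LIMSEQ_le_const) auto
qed

lemma translation_bound:
  assumes u: "test_fun \<Omega> u"
  shows "L2norm (\<lambda>x. u (x + z) - u x) \<le> (\<Sum>j\<in>UNIV. \<bar>z $ j\<bar> * L2norm (partial j u))"
proof -
  have L: "partial j u \<in> L2" for j using test_L2[OF test_partial[OF u]] .
  have e: "dir_deriv u z = (\<Sum>j\<in>UNIV. fun_scale (of_real (z $ j)) (partial j u))"
    by (simp add: dir_deriv_def fun_eq_iff UNIV_2)
  have "L2norm (dir_deriv u z) \<le> (\<Sum>j\<in>UNIV. L2norm (fun_scale (of_real (z $ j)) (partial j u)))"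
    unfolding e using L by (intro L2.form_norm_sum_le) auto
  then show ?thesis using translation_le_dir_deriv[OF u, of z] L by (simp add: L2.form_norm_scale)
qed

section \<open>Averages over the cells of a grid\<close>

definition cell_index :: "real \<Rightarrow> real^2 \<Rightarrow> int \<times> int" where
  "cell_index h x = (\<lfloor>x $ 1 / h\<rfloor>, \<lfloor>x $ 2 / h\<rfloor>)"

definition cell :: "real \<Rightarrow> int \<times> int \<Rightarrow> (real^2) set" where
  "cell h p = {x. cell_index h x = p}"

lemma cell_bounds:
  assumes "h > 0"
  shows "x \<in> cell h (a, b) \<longleftrightarrow> h * a \<le> x $ 1 \<and> x $ 1 < h * (a + 1) \<and> h * b \<le> x $ 2 \<and> x $ 2 < h * (b + 1)"
  using assms by (auto simp: cell_def cell_index_def floor_eq_iff field_simps)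

lemma cell_measurable [measurable]: "cell h p \<in> sets borel"
proof -
  have "Measurable.pred borel (\<lambda>x::real^2. \<lfloor>x $ i / h\<rfloor> = k)" for i k
  proof -
    have [measurable]: "(\<lambda>x::real^2. x $ i) \<in> borel_measurable borel"
      by (intro borel_measurable_continuous_onI continuous_intros)
    show ?thesis by measurable
  qed
  then have "Measurable.pred borel (\<lambda>x::real^2. \<lfloor>x $ 1 / h\<rfloor> = fst p \<and> \<lfloor>x $ 2 / h\<rfloor> = snd p)"
    by (intro pred_intros_logic)
  then show ?thesis by (simp add: cell_def cell_index_def prod_eq_iff pred_def)
qed

lemma content_square:
  assumes "r \<ge> 0"
  shows "emeasure lborel (cbox (c :: real^2) (c + r *\<^sub>R 1)) = ennreal (r\<^sup>2)"
    "emeasure lborel (box (c :: real^2) (c + r *\<^sub>R 1)) = ennreal (r\<^sup>2)"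
proof -
  have b: "\<And>b::real^2. b \<in> Basis \<Longrightarrow> c \<bullet> b \<le> (c + r *\<^sub>R 1) \<bullet> b"
    using assms by (auto simp: Basis_vec_def inner_axis inner_add_left)
  have "(\<Prod>b\<in>(Basis::(real^2) set). (c + r *\<^sub>R 1 - c) \<bullet> b) = r\<^sup>2"
  proof -
    have "(\<Prod>b\<in>(Basis::(real^2) set). (c + r *\<^sub>R 1 - c) \<bullet> b) = (\<Prod>b\<in>(Basis::(real^2) set). r)"
      by (intro prod.cong) (auto simp: Basis_vec_def inner_axis)
    then show ?thesis by simp
  qed
  then show "emeasure lborel (cbox c (c + r *\<^sub>R 1)) = ennreal (r\<^sup>2)" "emeasure lborel (box c (c + r *\<^sub>R 1)) = ennreal (r\<^sup>2)"
    using b by (simp_all add: emeasure_lborel_cbox emeasure_lborel_box)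
qed

lemma cell_measure:
  assumes h: "h > 0"
  shows "emeasure lborel (cell h p) < \<infinity>" "h\<^sup>2 \<le> measure lborel (cell h p)"
proof -
  obtain a b where p: "p = (a, b)" by (cases p)
  define c :: "real^2" where "c = vector [h * a, h * b]"
  have c: "c $ 1 = h * a" "c $ 2 = h * b" by (auto simp: c_def vector_2)
  have sub: "box c (c + h *\<^sub>R 1) \<subseteq> cell h p" "cell h p \<subseteq> cbox c (c + h *\<^sub>R 1)"
    using c unfolding p by (auto simp: cell_bounds[OF h] mem_box_cart forall_2 algebra_simps)
  have "emeasure lborel (cell h p) \<le> ennreal (h\<^sup>2)"
    using emeasure_mono[OF sub(2), of lborel] content_square(1)[of h c] h by simp
  then show fin: "emeasure lborel (cell h p) < \<infinity>" by (simp add: le_less_trans)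
  have "ennreal (h\<^sup>2) \<le> emeasure lborel (cell h p)"
    using emeasure_mono[OF sub(1), of lborel] content_square(2)[of h c] h by simp
  then show "h\<^sup>2 \<le> measure lborel (cell h p)"
    using fin by (simp add: emeasure_eq_ennreal_measure less_top[symmetric])
qed

definition cell_fun :: "real \<Rightarrow> int \<times> int \<Rightarrow> real^2 \<Rightarrow> complex" where
  "cell_fun h p x = indicator (cell h p) x"

lemma cell_fun_L2: "h > 0 \<Longrightarrow> cell_fun h p \<in> L2"
proof -
  assume h: "h > 0"
  have "(\<lambda>x. (cmod (cell_fun h p x))\<^sup>2) = indicator (cell h p)" by (auto simp: cell_fun_def indicator_def)
  moreover have "integrable lebesgue (indicator (cell h p) :: real^2 \<Rightarrow> real)"
    using cell_measure(1)[OF h, of p] by (intro integrable_real_indicator) auto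
  moreover have "cell_fun h p \<in> borel_measurable lebesgue"
    unfolding cell_fun_def by (intro borel_measurable_indicator) simp
  ultimately show ?thesis by (simp add: L2_iff)
qed

text \<open>Expanding the square: the double integral is twice the variance of u on Q, up to the
  factor \<open>|Q|\<^sup>2\<close>.\<close>

lemma cell_variance:
  assumes u: "test_fun \<Omega> u" and Q: "Q \<in> sets borel" "emeasure lborel Q < \<infinity>"
  shows "(\<integral>\<^sup>+x. \<integral>\<^sup>+y. indicator Q x * indicator Q y * ennreal ((cmod (u x - u y))\<^sup>2) \<partial>lborel \<partial>lborel) =
    ennreal (2 * measure lborel Q * (\<integral>x. indicator Q x * (cmod (u x))\<^sup>2 \<partial>lborel) - 2 * (cmod (\<integral>x. indicator Q x * u x \<partial>lborel))\<^sup>2)"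
proof -
  have c: "continuous_on UNIV u" using test_continuous u by blast
  have [measurable]: "u \<in> borel_measurable borel" using c by (rule borel_measurable_continuous_onI)
  note [measurable] = Q(1)
  define v where "v = (\<lambda>x. indicator Q x * u x)"
  define rp :: "complex \<Rightarrow> complex \<Rightarrow> real" where "rp = (\<lambda>w z. Re (w * cnj z))"
  define W where "W = (\<integral>x. v x \<partial>lborel)"
  define I where "I = (\<integral>x. indicator Q x * (cmod (u x))\<^sup>2 \<partial>lborel)"
  define m where "m = measure lborel Q"
  obtain K where K: "compact K" "\<And>x. x \<notin> K \<Longrightarrow> u x = 0" using test_support[OF u] by metis
  have iu: "integrable lborel u" "integrable lborel (\<lambda>x. (cmod (u x))\<^sup>2)"
    using c K by (auto intro!: continuous_compact_support_integrable(1)[of _ K] continuous_intros)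
  have iv: "integrable lborel v" unfolding v_def
    by (rule Bochner_Integration.integrable_bound[OF iu(1)]) (auto simp: indicator_def)
  have iI: "integrable lborel (\<lambda>x. indicator Q x * (cmod (u x))\<^sup>2)"
    by (rule Bochner_Integration.integrable_bound[OF iu(2)]) (auto simp: indicator_def)
  have iQ: "integrable lborel (indicator Q :: real^2 \<Rightarrow> real)" using Q by (intro integrable_real_indicator) auto
  have expand: "indicator Q y * (cmod (w - u y))\<^sup>2 = indicator Q y * (cmod w)\<^sup>2 - 2 * rp w (v y) + indicator Q y * (cmod (u y))\<^sup>2" for w y
  proof -
    have "(cmod (w - u y))\<^sup>2 = (cmod w)\<^sup>2 - 2 * rp w (u y) + (cmod (u y))\<^sup>2"
      unfolding rp_def by (simp add: cmod_power2) (simp add: power2_eq_square algebra_simps)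
    then show ?thesis by (cases "y \<in> Q") (auto simp: v_def rp_def)
  qed
  have icr: "integrable lborel (\<lambda>y. rp w (v y))" for w unfolding rp_def using iv by (intro integrable_Re integrable_mult_right integrable_cnj)
  have inner: "(\<integral>y. indicator Q y * (cmod (w - u y))\<^sup>2 \<partial>lborel) = m * (cmod w)\<^sup>2 - 2 * rp w W + I"
    "integrable lborel (\<lambda>y. indicator Q y * (cmod (w - u y))\<^sup>2)" for w
  proof -
    have "(\<integral>y. rp w (v y) \<partial>lborel) = rp w W"
      using iv unfolding W_def rp_def by (subst integral_Re) auto
    then show "(\<integral>y. indicator Q y * (cmod (w - u y))\<^sup>2 \<partial>lborel) = m * (cmod w)\<^sup>2 - 2 * rp w W + I"
      unfolding expand using iQ icr[of w] iI by (simp add: I_def m_def)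
    show "integrable lborel (\<lambda>y. indicator Q y * (cmod (w - u y))\<^sup>2)"
      unfolding expand using iQ icr[of w] iI by simp
  qed
  have ex2: "indicator Q x * (m * (cmod (u x))\<^sup>2 - 2 * rp (u x) W + I) =
      m * (indicator Q x * (cmod (u x))\<^sup>2) - 2 * rp (v x) W + indicator Q x * I" for x
    by (cases "x \<in> Q") (auto simp: v_def rp_def)
  have icr2: "integrable lborel (\<lambda>x. rp (v x) W)" unfolding rp_def using iv by (intro integrable_Re integrable_mult_left)
  have "(\<integral>x. rp (v x) W \<partial>lborel) = (cmod W)\<^sup>2"
  proof -
    have "(\<integral>x. rp (v x) W \<partial>lborel) = rp W W" using iv unfolding W_def rp_def by (subst integral_Re) auto
    moreover have "rp W W = (cmod W)\<^sup>2" by (simp add: rp_def cmod_power2) (simp add: power2_eq_square)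
    ultimately show ?thesis by simp
  qed
  then have outer: "(\<integral>x. indicator Q x * (m * (cmod (u x))\<^sup>2 - 2 * rp (u x) W + I) \<partial>lborel) = 2 * m * I - 2 * (cmod W)\<^sup>2"
    "integrable lborel (\<lambda>x. indicator Q x * (m * (cmod (u x))\<^sup>2 - 2 * rp (u x) W + I))"
    unfolding ex2 using iI iQ icr2 by (simp_all add: I_def[symmetric] m_def)
  have g0: "0 \<le> m * (cmod w)\<^sup>2 - 2 * rp w W + I" for w
    using inner(1)[of w] integral_nonneg_AE[of "\<lambda>y. indicator Q y * (cmod (w - u y))\<^sup>2" lborel] by simp
  have "(\<integral>\<^sup>+x. \<integral>\<^sup>+y. indicator Q x * indicator Q y * ennreal ((cmod (u x - u y))\<^sup>2) \<partial>lborel \<partial>lborel) =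
      (\<integral>\<^sup>+x. ennreal (indicator Q x * (m * (cmod (u x))\<^sup>2 - 2 * rp (u x) W + I)) \<partial>lborel)"
  proof (rule nn_integral_cong)
    fix x
    have "(\<integral>\<^sup>+y. indicator Q x * indicator Q y * ennreal ((cmod (u x - u y))\<^sup>2) \<partial>lborel) =
        indicator Q x * (\<integral>\<^sup>+y. ennreal (indicator Q y * (cmod (u x - u y))\<^sup>2) \<partial>lborel)"
      by (subst nn_integral_cmult[symmetric]) (auto intro!: nn_integral_cong simp: indicator_def)
    also have "(\<integral>\<^sup>+y. ennreal (indicator Q y * (cmod (u x - u y))\<^sup>2) \<partial>lborel) =
        ennreal (m * (cmod (u x))\<^sup>2 - 2 * rp (u x) W + I)"
      using inner[of "u x"] by (subst nn_integral_eq_integral) auto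
    also have "indicator Q x * \<dots> = ennreal (indicator Q x * (m * (cmod (u x))\<^sup>2 - 2 * rp (u x) W + I))"
      by (auto simp: indicator_def)
    finally show "(\<integral>\<^sup>+y. indicator Q x * indicator Q y * ennreal ((cmod (u x - u y))\<^sup>2) \<partial>lborel) =
      ennreal (indicator Q x * (m * (cmod (u x))\<^sup>2 - 2 * rp (u x) W + I))" .
  qed
  also have "\<dots> = ennreal (2 * m * I - 2 * (cmod W)\<^sup>2)"
    using outer g0 by (subst nn_integral_eq_integral) auto
  finally show ?thesis by (simp add: m_def I_def W_def v_def)
qed

text \<open>Two points of the same cell differ by an element of a square of side 2 h around 0.
  After exchanging the integrals, each such difference contributes the change of u under a
  translation.\<close>

lemma sum_cell_variances:
  assumes u: "test_fun \<Omega> u" and h: "h > 0" and P: "finite P"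
  shows "(\<Sum>p\<in>P. \<integral>\<^sup>+x. \<integral>\<^sup>+y. indicator (cell h p) x * indicator (cell h p) y * ennreal ((cmod (u x - u y))\<^sup>2) \<partial>lborel \<partial>lborel)
    \<le> ennreal (4 * h\<^sup>2 * (h * (\<Sum>j\<in>UNIV. L2norm (partial j u)))\<^sup>2)"
proof -
  have c: "continuous_on UNIV u" using test_continuous u by blast
  have [measurable]: "u \<in> borel_measurable borel" using c by (rule borel_measurable_continuous_onI)
  \<comment> \<open>the square \<open>[-h, h]\<^sup>2\<close>\<close>
  define Z :: "(real^2) set" where "Z = cbox ((- h) *\<^sub>R 1) ((- h) *\<^sub>R 1 + (2 * h) *\<^sub>R 1)"
  have [measurable]: "Z \<in> sets borel" by (simp add: Z_def)
  define S where "S = (h * (\<Sum>j\<in>UNIV. L2norm (partial j u)))\<^sup>2"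
  have Zmem: "z \<in> Z \<longleftrightarrow> (\<forall>j. - h \<le> z $ j \<and> z $ j \<le> h)" for z by (simp add: Z_def mem_box_cart)
  have ind: "(\<Sum>p\<in>P. indicator (cell h p) x * indicator (cell h p) y) \<le> (indicator Z (y - x) :: ennreal)" for x y
  proof (cases "cell_index h x = cell_index h y \<and> cell_index h x \<in> P")
    case True
    obtain a b where ab: "cell_index h x = (a, b)" by fastforce
    then have "x \<in> cell h (a, b)" "y \<in> cell h (a, b)" using True by (auto simp: cell_def)
    then have "y - x \<in> Z" unfolding Zmem forall_2 cell_bounds[OF h] by (simp add: algebra_simps)
    moreover have "(\<Sum>p\<in>P. indicator (cell h p) x * indicator (cell h p) y) = (\<Sum>p\<in>P. if p = cell_index h x then 1 else (0::ennreal))"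
      using True by (intro sum.cong) (auto simp: cell_def indicator_def)
    ultimately show ?thesis using P by simp
  next
    case False
    then have "(\<Sum>p\<in>P. indicator (cell h p) x * indicator (cell h p) y) = (0::ennreal)"
      by (intro sum.neutral) (auto simp: cell_def indicator_def)
    then show ?thesis by simp
  qed
  have "(\<Sum>p\<in>P. \<integral>\<^sup>+x. \<integral>\<^sup>+y. indicator (cell h p) x * indicator (cell h p) y * ennreal ((cmod (u x - u y))\<^sup>2) \<partial>lborel \<partial>lborel)
      = (\<integral>\<^sup>+x. \<integral>\<^sup>+y. (\<Sum>p\<in>P. indicator (cell h p) x * indicator (cell h p) y) * ennreal ((cmod (u x - u y))\<^sup>2) \<partial>lborel \<partial>lborel)"
    by (simp add: nn_integral_sum[symmetric] sum_distrib_right)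
  also have "\<dots> \<le> (\<integral>\<^sup>+x. \<integral>\<^sup>+y. indicator Z (y - x) * ennreal ((cmod (u x - u y))\<^sup>2) \<partial>lborel \<partial>lborel)"
    by (intro nn_integral_mono mult_right_mono ind) auto
  also have "\<dots> = (\<integral>\<^sup>+x. \<integral>\<^sup>+z. indicator Z z * ennreal ((cmod (u (x + z) - u x))\<^sup>2) \<partial>lborel \<partial>lborel)"
  proof (rule nn_integral_cong)
    fix x :: "real^2"
    have "(\<integral>\<^sup>+y. indicator Z (y - x) * ennreal ((cmod (u x - u y))\<^sup>2) \<partial>lborel) =
        (\<integral>\<^sup>+y. indicator Z (y - x) * ennreal ((cmod (u x - u y))\<^sup>2) \<partial>distr lborel borel ((+) x))"
      by (simp add: lborel_distr_plus)
    also have "\<dots> = (\<integral>\<^sup>+z. indicator Z (x + z - x) * ennreal ((cmod (u x - u (x + z)))\<^sup>2) \<partial>lborel)"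
      by (rule nn_integral_distr) measurable
    finally show "(\<integral>\<^sup>+y. indicator Z (y - x) * ennreal ((cmod (u x - u y))\<^sup>2) \<partial>lborel) =
        (\<integral>\<^sup>+z. indicator Z z * ennreal ((cmod (u (x + z) - u x))\<^sup>2) \<partial>lborel)"
      by (simp add: norm_minus_commute)
  qed
  also have "\<dots> = (\<integral>\<^sup>+z. \<integral>\<^sup>+x. indicator Z z * ennreal ((cmod (u (x + z) - u x))\<^sup>2) \<partial>lborel \<partial>lborel)"
    by (rule lborel_pair.Fubini') measurable
  also have "\<dots> \<le> (\<integral>\<^sup>+z. ennreal S * indicator Z z \<partial>lborel)"
  proof (rule nn_integral_mono)
    fix z :: "real^2"
    show "(\<integral>\<^sup>+x. indicator Z z * ennreal ((cmod (u (x + z) - u x))\<^sup>2) \<partial>lborel) \<le> ennreal S * indicator Z z"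
    proof (cases "z \<in> Z")
      case True
      have tz: "(\<lambda>x. u (x + z) - u x) \<in> L2"
        using test_L2[OF test_diff[OF test_translate[OF u] test_mono[OF u]]] by simp
      have "(\<integral>\<^sup>+x. indicator Z z * ennreal ((cmod (u (x + z) - u x))\<^sup>2) \<partial>lborel) =
          (\<integral>\<^sup>+x. ennreal ((cmod (u (x + z) - u x))\<^sup>2) \<partial>lebesgue)"
        using True by (simp add: nn_integral_completion)
      also have "\<dots> = ennreal ((L2norm (\<lambda>x. u (x + z) - u x))\<^sup>2)"
        using L2_integrable[OF tz] by (simp add: nn_integral_eq_integral L2norm_sq)
      also have "\<dots> \<le> ennreal S"
      proof (intro ennreal_leI)
        have nn: "0 \<le> L2norm (partial j u)" for j using test_L2[OF test_partial[OF u]] by simp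
        have "L2norm (\<lambda>x. u (x + z) - u x) \<le> (\<Sum>j\<in>UNIV. \<bar>z $ j\<bar> * L2norm (partial j u))"
          by (rule translation_bound[OF u])
        also have "\<dots> \<le> (\<Sum>j\<in>UNIV. h * L2norm (partial j u))"
          using True unfolding Zmem by (intro sum_mono mult_right_mono nn) (auto simp: abs_le_iff minus_le_iff)
        also have "\<dots> = h * (\<Sum>j\<in>UNIV. L2norm (partial j u))" by (simp add: sum_distrib_left)
        finally show "(L2norm (\<lambda>x. u (x + z) - u x))\<^sup>2 \<le> S"
          unfolding S_def using L2.form_norm_nonneg[OF tz] by (rule power_mono)
      qed
      finally show ?thesis using True by simp
    qed simp
  qed
  also have "\<dots> = ennreal S * emeasure lborel Z" by (subst nn_integral_cmult_indicator) auto
  also have "emeasure lborel Z = ennreal ((2 * h)\<^sup>2)" unfolding Z_def using h by (intro content_square) simp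
  also have "ennreal S * ennreal ((2 * h)\<^sup>2) = ennreal (4 * h\<^sup>2 * S)"
    by (simp add: S_def ennreal_mult[symmetric] power_mult_distrib mult.commute)
  finally show ?thesis unfolding S_def .
qed

lemma cell_ip: "L2ip u (cell_fun h p) = (\<integral>x. indicator (cell h p) x * u x \<partial>lebesgue)"
  unfolding L2ip_eq cell_fun_def by (intro Bochner_Integration.integral_cong) (auto simp: indicator_def)

text \<open>Up to finitely many linear functionals, the norm of a test function is controlled by
  its gradient with a constant that tends to 0 with the mesh size h.\<close>

lemma Friedrichs_inequality:
  assumes \<Omega>: "bounded \<Omega>" and h: "h > 0"
  obtains P where "finite P" "\<And>u. test_fun \<Omega> u \<Longrightarrow>
    (L2norm u)\<^sup>2 \<le> (\<Sum>p\<in>P. (cmod (L2ip u (cell_fun h p)))\<^sup>2) / h\<^sup>2 + 2 * (h * (\<Sum>j\<in>UNIV. L2norm (partial j u)))\<^sup>2"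
proof -
  obtain R where R: "\<And>x. x \<in> \<Omega> \<Longrightarrow> norm x \<le> R" using \<Omega> by (auto simp: bounded_iff)
  define P where "P = {\<lfloor>- R / h\<rfloor>..\<lfloor>R / h\<rfloor>} \<times> {\<lfloor>- R / h\<rfloor>..\<lfloor>R / h\<rfloor>}"
  have P: "cell_index h x \<in> P" if "x \<in> \<Omega>" for x
  proof -
    have "\<bar>x $ j\<bar> \<le> R" for j using R[OF that] component_le_norm_cart[of x j] by linarith
    then have "- R / h \<le> x $ j / h" "x $ j / h \<le> R / h" for j
      using h by (intro divide_right_mono; simp add: abs_le_iff minus_le_iff)+
    then show ?thesis unfolding P_def cell_index_def by (auto intro!: floor_mono simp del: minus_divide_left)
  qed
  have "(L2norm u)\<^sup>2 \<le> (\<Sum>p\<in>P. (cmod (L2ip u (cell_fun h p)))\<^sup>2) / h\<^sup>2 + 2 * (h * (\<Sum>j\<in>UNIV. L2norm (partial j u)))\<^sup>2"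
    if u: "test_fun \<Omega> u" for u
  proof -
    define S where "S = (h * (\<Sum>j\<in>UNIV. L2norm (partial j u)))\<^sup>2"
    define W where "W = (\<lambda>p. (\<integral>x. indicator (cell h p) x * u x \<partial>lborel))"
    define I where "I = (\<lambda>p. (\<integral>x. indicator (cell h p) x * (cmod (u x))\<^sup>2 \<partial>lborel))"
    define V where "V = (\<lambda>p. 2 * measure lborel (cell h p) * I p - 2 * (cmod (W p))\<^sup>2)"
    have finP: "finite P" by (simp add: P_def)
    have c: "continuous_on UNIV u" using test_continuous u by blast
    have [measurable]: "u \<in> borel_measurable borel" using c by (rule borel_measurable_continuous_onI)
    have WL: "L2ip u (cell_fun h p) = W p" for p unfolding cell_ip W_def by (rule integral_completion) measurable
    have i2: "integrable lborel (\<lambda>x. (cmod (u x))\<^sup>2)"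
      using L2_integrable[OF test_L2[OF u]] by (subst (asm) integrable_completion) auto
    have iI: "integrable lborel (\<lambda>x. indicator (cell h p) x * (cmod (u x))\<^sup>2)" for p
      by (rule Bochner_Integration.integrable_bound[OF i2]) (auto simp: indicator_def)
    have V0: "V p \<ge> 0" for p
    proof (rule ccontr)
      assume neg: "\<not> V p \<ge> 0"
      have cs: "(cmod (W p))\<^sup>2 \<le> measure lborel (cell h p) * I p"
      proof -
        have "(cmod (L2ip u (cell_fun h p)))\<^sup>2 \<le> measure lborel (cell h p) * I p"
        proof -
          define v where "v = restrict_fun (cell h p) u"
          have vL: "v \<in> L2" unfolding v_def by (intro L2_restrict test_L2[OF u]) simp
          have "L2ip u (cell_fun h p) = L2ip v (cell_fun h p)"
            unfolding L2ip_eq by (intro Bochner_Integration.integral_cong) (auto simp: v_def restrict_fun_def cell_fun_def)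
          then have "cmod (L2ip u (cell_fun h p)) \<le> L2norm v * L2norm (cell_fun h p)"
            using L2.Cauchy_Schwarz[OF vL cell_fun_L2[OF h]] by simp
          then have "(cmod (L2ip u (cell_fun h p)))\<^sup>2 \<le> (L2norm v)\<^sup>2 * (L2norm (cell_fun h p))\<^sup>2"
            by (metis norm_ge_zero power_mono power_mult_distrib)
          moreover have "(L2norm v)\<^sup>2 = I p"
          proof -
            have "(L2norm v)\<^sup>2 = integral\<^sup>L lebesgue (\<lambda>x. indicator (cell h p) x * (cmod (u x))\<^sup>2)"
              unfolding L2norm_sq by (intro Bochner_Integration.integral_cong) (auto simp: v_def restrict_fun_def indicator_def)
            also have "\<dots> = I p" unfolding I_def by (rule integral_completion) measurable
            finally show ?thesis .
          qed
          moreover have "(L2norm (cell_fun h p))\<^sup>2 = measure lborel (cell h p)"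
          proof -
            have "(L2norm (cell_fun h p))\<^sup>2 = integral\<^sup>L lebesgue (indicator (cell h p))"
              unfolding L2norm_sq by (intro Bochner_Integration.integral_cong) (auto simp: cell_fun_def indicator_def)
            then show ?thesis by simp
          qed
          ultimately show ?thesis by (simp add: mult.commute)
        qed
        then show ?thesis by (simp add: WL)
      qed
      then show False using neg by (simp add: V_def)
    qed
    have "(\<Sum>p\<in>P. ennreal (V p)) \<le> ennreal (4 * h\<^sup>2 * S)"
      using sum_cell_variances[OF u h finP] cell_variance[OF u cell_measurable cell_measure(1)[OF h]]
      unfolding V_def W_def I_def S_def by simp
    then have "ennreal (\<Sum>p\<in>P. V p) \<le> ennreal (4 * h\<^sup>2 * S)" using V0 by simp
    then have Vsum: "(\<Sum>p\<in>P. V p) \<le> 4 * h\<^sup>2 * S" by (simp add: S_def)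
    have Ip: "I p \<le> (cmod (W p))\<^sup>2 / h\<^sup>2 + V p / (2 * h\<^sup>2)" for p
    proof -
      have I0: "I p \<ge> 0" unfolding I_def by (rule integral_nonneg_AE) simp
      have "2 * h\<^sup>2 * I p \<le> 2 * measure lborel (cell h p) * I p"
        using cell_measure(2)[OF h, of p] I0 by (intro mult_right_mono) auto
      also have "\<dots> = V p + 2 * (cmod (W p))\<^sup>2" by (simp add: V_def)
      finally show ?thesis using h by (simp add: field_simps)
    qed
    have "(L2norm u)\<^sup>2 = (\<integral>x. (cmod (u x))\<^sup>2 \<partial>lborel)" unfolding L2norm_sq by (rule integral_completion) measurable
    also have "\<dots> = (\<integral>x. (\<Sum>p\<in>P. indicator (cell h p) x * (cmod (u x))\<^sup>2) \<partial>lborel)"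
    proof (intro Bochner_Integration.integral_cong refl)
      fix x
      show "(cmod (u x))\<^sup>2 = (\<Sum>p\<in>P. indicator (cell h p) x * (cmod (u x))\<^sup>2)"
      proof (cases "x \<in> \<Omega>")
        case True
        have "(\<Sum>p\<in>P. indicator (cell h p) x * (cmod (u x))\<^sup>2) = (\<Sum>p\<in>P. if p = cell_index h x then (cmod (u x))\<^sup>2 else 0)"
          by (intro sum.cong) (auto simp: cell_def indicator_def)
        then show ?thesis using P[OF True] finP by simp
      next
        case False
        then show ?thesis using test_zero_outside[OF u] by simp
      qed
    qed
    also have "\<dots> = (\<Sum>p\<in>P. I p)" unfolding I_def using iI by (intro Bochner_Integration.integral_sum) auto
    also have "\<dots> \<le> (\<Sum>p\<in>P. (cmod (W p))\<^sup>2 / h\<^sup>2 + V p / (2 * h\<^sup>2))" by (intro sum_mono Ip)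
    also have "\<dots> = (\<Sum>p\<in>P. (cmod (W p))\<^sup>2) / h\<^sup>2 + (\<Sum>p\<in>P. V p) / (2 * h\<^sup>2)"
      by (simp add: sum.distrib sum_divide_distrib)
    also have "(\<Sum>p\<in>P. V p) / (2 * h\<^sup>2) \<le> 4 * h\<^sup>2 * S / (2 * h\<^sup>2)" using Vsum by (intro divide_right_mono) auto
    also have "4 * h\<^sup>2 * S / (2 * h\<^sup>2) = 2 * S" using h by simp
    finally show ?thesis by (simp add: WL S_def)
  qed
  then show ?thesis using that[of P] by (simp add: P_def)
qed

section \<open>Rellich's compactness theorem\<close>

text \<open>On a bounded set the vector potential is bounded, hence the magnetic form controls
  the ordinary gradient.\<close>

lemma partial_norm_bound:
  assumes u: "test_fun \<Omega> u" and R: "\<And>x. x \<in> \<Omega> \<Longrightarrow> norm x \<le> R" "R \<ge> 0"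
  shows "L2norm (partial j u) \<le> form_norm (mform B) u + \<bar>B\<bar> * R * L2norm u"
proof -
  define a where "a = (\<lambda>x. complex_of_real (vector_potential B x $ j) * u x)"
  have aL: "a \<in> L2" unfolding a_def by (rule test_L2[OF test_mult[OF u test_vector_potential]])
  have gL: "magnetic_gradient B u i \<in> L2" for i using test_L2[OF test_magnetic_gradient[OF u]] .
  have uL: "u \<in> L2" using test_L2[OF u] .
  have "partial j u = fun_scale \<i> (magnetic_gradient B u j - a)"
    by (auto simp: magnetic_gradient_def a_def fun_eq_iff)
  then have "L2norm (partial j u) = L2norm (magnetic_gradient B u j - a)"
    using aL gL by (simp add: L2.form_norm_scale)
  also have "\<dots> \<le> L2norm (magnetic_gradient B u j) + L2norm a"
    using L2.form_norm_triangle[of "magnetic_gradient B u j" "fun_scale (-1) a"] L2.form_norm_scale[of a "-1"] aL gL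
    by simp
  also have "L2norm (magnetic_gradient B u j) \<le> form_norm (mform B) u"
  proof -
    have "(L2norm (magnetic_gradient B u j))\<^sup>2 \<le> (\<Sum>i\<in>UNIV. (L2norm (magnetic_gradient B u i))\<^sup>2)"
      by (rule member_le_sum) auto
    also have "\<dots> = Re (mform B u u)" using gL by (simp add: mform_eq[OF u u] L2.form_norm_sq)
    finally show ?thesis unfolding form_norm_def[of "mform B"] by (rule real_le_rsqrt)
  qed
  also have "L2norm a \<le> L2norm (fun_scale (of_real (\<bar>B\<bar> * R)) u)"
  proof (rule L2norm_mono)
    show "fun_scale (of_real (\<bar>B\<bar> * R)) u \<in> L2" using uL by simp
    fix x
    show "cmod (a x) \<le> cmod (fun_scale (of_real (\<bar>B\<bar> * R)) u x)"
    proof (cases "x \<in> \<Omega>")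
      case True
      have "j = 1 \<or> j = 2" using exhaust_2 by blast
      then have "\<bar>vector_potential B x $ j\<bar> \<le> \<bar>B\<bar> / 2 * norm x"
        using component_le_norm_cart[of x 1] component_le_norm_cart[of x 2]
        by (auto simp: vector_potential_def vector_2 abs_mult intro!: mult_left_mono)
      also have "\<dots> \<le> \<bar>B\<bar> * R" using R(1)[OF True] R(2) by (intro mult_mono) auto
      finally have "\<bar>vector_potential B x $ j\<bar> * cmod (u x) \<le> \<bar>B\<bar> * R * cmod (u x)" by (rule mult_right_mono) simp
      then show ?thesis using R(2) by (simp add: a_def norm_mult abs_mult)
    next
      case False
      then show ?thesis using test_zero_outside[OF u] by (simp add: a_def)
    qed
  qed
  also have "\<dots> = \<bar>B\<bar> * R * L2norm u" using uL R(2) by (simp add: L2.form_norm_scale norm_mult abs_mult)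
  finally show ?thesis by simp
qed

text \<open>By Tychonoff's theorem the product of countably many discs is compact and
  metrizable.\<close>

lemma bounded_sequences_pointwise_subsequence:
  fixes X :: "nat \<Rightarrow> 'i::countable \<Rightarrow> complex"
  assumes "\<And>k i. cmod (X k i) \<le> D i"
  obtains r l where "strict_mono r" "\<And>i. (\<lambda>k. X (r k) i) \<longlonglongrightarrow> l i"
proof -
  have "compact (PiE UNIV (\<lambda>i. cball 0 (D i)) :: ('i \<Rightarrow> complex) set)"
    using compactin_PiE[of "\<lambda>i::'i. euclidean :: complex topology" UNIV "\<lambda>i. cball 0 (D i)"]
    by (simp add: euclidean_product_topology)
  then have "seq_compact (PiE UNIV (\<lambda>i. cball 0 (D i)) :: ('i \<Rightarrow> complex) set)"
    by (simp add: compact_eq_seq_compact_metric)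
  moreover have "X k \<in> PiE UNIV (\<lambda>i. cball 0 (D i))" for k using assms by (auto simp: PiE_UNIV_domain Pi_def)
  ultimately obtain l r where l: "strict_mono r" "(X \<circ> r) \<longlonglongrightarrow> l"
    unfolding seq_compact_def by metis
  have "(\<lambda>k. X (r k) i) \<longlonglongrightarrow> l i" for i
    using continuous_on_tendsto_compose[OF continuous_on_product_coordinates[of i] l(2)] by (simp add: o_def)
  then show ?thesis using that l(1) by blast
qed

text \<open>Along a subsequence the integrals over all cells of all grids of mesh size \<open>1
  / (m + 1)\<close> converge. The Friedrichs inequality then makes the differences small in
  norm.\<close>

theorem Rellich:
  fixes s :: "nat \<Rightarrow> real^2 \<Rightarrow> complex"
  assumes \<Omega>: "bounded \<Omega>" and s: "\<And>k. s k \<in> tests \<Omega>"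
    and C: "\<And>k. L2norm (s k) \<le> C" "\<And>k. form_norm (mform B) (s k) \<le> C"
  shows "\<exists>r. strict_mono r \<and> form_Cauchy L2ip (\<lambda>k. s (r k))"
proof -
  obtain R where R: "R > 0" "\<And>x. x \<in> \<Omega> \<Longrightarrow> norm x \<le> R" using \<Omega> by (auto simp: bounded_pos)
  have t: "test_fun \<Omega> (s k)" for k using s by (simp add: tests_def)
  have sL: "s k \<in> L2" for k using test_L2[OF t] .
  have C0: "C \<ge> 0" using C(1)[of 0] L2.form_norm_nonneg[OF sL[of 0]] by linarith
  define G where "G = C + \<bar>B\<bar> * R * C"
  have G0: "G \<ge> 0" using C0 R by (simp add: G_def)
  have G: "L2norm (partial j (s k)) \<le> G" for j k
  proof -
    have "L2norm (partial j (s k)) \<le> form_norm (mform B) (s k) + \<bar>B\<bar> * R * L2norm (s k)"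
      using R by (intro partial_norm_bound[OF t]) auto
    also have "\<dots> \<le> G" unfolding G_def using C R by (intro add_mono mult_left_mono) auto
    finally show ?thesis .
  qed
  define h where "h = (\<lambda>m. 1 / real (Suc m))"
  have h: "h m > 0" for m by (simp add: h_def)
  define X where "X = (\<lambda>k (m, p). L2ip (s k) (cell_fun (h m) p))"
  have "cmod (X k i) \<le> (\<lambda>(m, p). C * L2norm (cell_fun (h m) p)) i" for k i
  proof -
    obtain m p where Pair: "i = (m, p)" by (cases i)
    have "cmod (L2ip (s k) (cell_fun (h m) p)) \<le> L2norm (s k) * L2norm (cell_fun (h m) p)"
      by (intro L2.Cauchy_Schwarz sL cell_fun_L2 h)
    also have "\<dots> \<le> C * L2norm (cell_fun (h m) p)"
      using C(1) cell_fun_L2[OF h] by (intro mult_right_mono) auto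
    finally show ?thesis by (simp add: X_def Pair)
  qed
  then obtain r l where r: "strict_mono r" "\<And>i. (\<lambda>k. X (r k) i) \<longlonglongrightarrow> l i"
    using bounded_sequences_pointwise_subsequence by metis
  have "form_Cauchy L2ip (\<lambda>k. s (r k))"
    unfolding form_Cauchy_def
  proof (intro allI impI)
    fix e :: real assume e: "e > 0"
    obtain m where m: "inverse (real (Suc m)) < e / (16 * (G + 1))"
      using reals_Archimedean[of "e / (16 * (G + 1))"] e G0 by auto
    have hm: "h m * (4 * G) \<le> e / 4"
    proof -
      have "h m * (4 * G) \<le> e / (16 * (G + 1)) * (4 * (G + 1))"
        using m G0 e by (intro mult_mono) (auto simp: h_def inverse_eq_divide)
      also have "\<dots> = e / 4" using G0 by (simp add: field_simps)
      finally show ?thesis .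
    qed
    obtain P where P: "finite P" "\<And>u. test_fun \<Omega> u \<Longrightarrow>
      (L2norm u)\<^sup>2 \<le> (\<Sum>p\<in>P. (cmod (L2ip u (cell_fun (h m) p)))\<^sup>2) / (h m)\<^sup>2 + 2 * (h m * (\<Sum>j\<in>UNIV. L2norm (partial j u)))\<^sup>2"
      using Friedrichs_inequality[OF \<Omega> h] by metis
    \<comment> \<open>the bound for each of the finitely many cell integrals that makes their
      total contribution at most \<open>e\<^sup>2 / 4\<close>\<close>
    define \<delta> where "\<delta> = (h m)\<^sup>2 * (e\<^sup>2 / (4 * (real (card P) + 1)))"
    have \<delta>: "\<delta> > 0" unfolding \<delta>_def using e h[of m] by (intro mult_pos_pos divide_pos_pos) auto
    have "\<forall>\<^sub>F k in sequentially. \<forall>p\<in>P. dist (X (r k) (m, p)) (l (m, p)) < sqrt \<delta> / 2"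
      using P(1) r(2) \<delta> by (intro eventually_ball_finite ballI tendstoD) auto
    then obtain N where N: "\<And>k p. k \<ge> N \<Longrightarrow> p \<in> P \<Longrightarrow> dist (X (r k) (m, p)) (l (m, p)) < sqrt \<delta> / 2"
      by (auto simp: eventually_sequentially)
    have "L2norm (s (r k) - s (r i)) < e" if ki: "k \<ge> N" "i \<ge> N" for k i
    proof -
      let ?u = "s (r k) - s (r i)"
      have tu: "test_fun \<Omega> ?u" using test_diff[OF t t] by (simp add: fun_diff_def)
      have cellbd: "(cmod (L2ip ?u (cell_fun (h m) p)))\<^sup>2 \<le> \<delta>" if p: "p \<in> P" for p
      proof -
        have "L2ip ?u (cell_fun (h m) p) = X (r k) (m, p) - X (r i) (m, p)"
          using sL cell_fun_L2[OF h] by (simp add: X_def L2.diff_left)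
        moreover have "dist (X (r k) (m, p)) (X (r i) (m, p)) < sqrt \<delta>"
          using N[OF ki(1) p] N[OF ki(2) p] by (rule dist_triangle_half_l)
        ultimately have "cmod (L2ip ?u (cell_fun (h m) p)) \<le> sqrt \<delta>" by (simp add: dist_norm)
        then show ?thesis using \<delta> by (metis less_imp_le norm_ge_zero power_mono real_sqrt_pow2)
      qed
      have "(\<Sum>p\<in>P. (cmod (L2ip ?u (cell_fun (h m) p)))\<^sup>2) / (h m)\<^sup>2 \<le> real (card P) * \<delta> / (h m)\<^sup>2"
        using sum_mono[of P, OF cellbd] by (intro divide_right_mono) auto
      also have "\<dots> \<le> e\<^sup>2 / 4"
      proof -
        have "real (card P) * \<delta> / (h m)\<^sup>2 = e\<^sup>2 / 4 * (real (card P) / (real (card P) + 1))"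
          using h[of m] by (simp add: \<delta>_def)
        also have "\<dots> \<le> e\<^sup>2 / 4 * 1" by (intro mult_left_mono) (auto simp: divide_simps)
        finally show ?thesis by simp
      qed
      finally have 1: "(\<Sum>p\<in>P. (cmod (L2ip ?u (cell_fun (h m) p)))\<^sup>2) / (h m)\<^sup>2 \<le> e\<^sup>2 / 4" .
      have pj: "L2norm (partial j ?u) \<le> 2 * G" for j
      proof -
        have pL: "partial j (s n) \<in> L2" for n using test_L2[OF test_partial[OF t]] .
        have "partial j ?u = partial j (s (r k)) - partial j (s (r i))"
        proof
          fix x
          have d: "s n differentiable (at x)" for n using smooth_differentiable[OF test_smooth[OF t]] .
          have "partial j (\<lambda>x. s (r k) x + (-1) * s (r i) x) x = partial j (s (r k)) x + (-1) * partial j (s (r i)) x"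
            unfolding partial_cmult[OF d, symmetric] by (intro partial_add d differentiable_mult differentiable_const)
          then show "partial j ?u x = (partial j (s (r k)) - partial j (s (r i))) x" by (simp add: fun_diff_def)
        qed
        then have "L2norm (partial j ?u) \<le> L2norm (partial j (s (r k))) + L2norm (partial j (s (r i)))"
          using L2.form_norm_triangle[of "partial j (s (r k))" "fun_scale (-1) (partial j (s (r i)))"]
            L2.form_norm_scale[OF pL, of "-1" "r i"] pL by simp
        then show ?thesis using G[of j "r k"] G[of j "r i"] by linarith
      qed
      have "h m * (\<Sum>j\<in>UNIV. L2norm (partial j ?u)) \<le> h m * (4 * G)"
        using pj[of 1] pj[of 2] h[of m] by (intro mult_left_mono) (auto simp: UNIV_2)
      then have "h m * (\<Sum>j\<in>UNIV. L2norm (partial j ?u)) \<le> e / 4" using hm by linarith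
      moreover have "0 \<le> h m * (\<Sum>j\<in>UNIV. L2norm (partial j ?u))"
        using h[of m] test_L2[OF test_partial[OF tu]] by (intro mult_nonneg_nonneg sum_nonneg) auto
      ultimately have "(h m * (\<Sum>j\<in>UNIV. L2norm (partial j ?u)))\<^sup>2 \<le> (e / 4)\<^sup>2" by (intro power_mono)
      then have "(L2norm ?u)\<^sup>2 \<le> e\<^sup>2 / 4 + 2 * (e / 4)\<^sup>2" using P(2)[OF tu] 1 by linarith
      also have "\<dots> < e\<^sup>2" using e by (simp add: power2_eq_square)
      finally show ?thesis using e by (simp add: power2_less_imp_less)
    qed
    then show "\<exists>N. \<forall>k\<ge>N. \<forall>i\<ge>N. L2norm (s (r k) - s (r i)) < e" by blast
  qed
  then show ?thesis using r(1) by blast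
qed

section \<open>Smooth bump functions\<close>

text \<open>For m = 0 the classical smooth function that vanishes to infinite order at 0. The
  powers of \<open>1 / t\<close> make the family closed under differentiation, up to linear
  combinations.\<close>

definition flat :: "nat \<Rightarrow> real \<Rightarrow> real" where
  "flat m t = (if t > 0 then (1 / t) ^ m * exp (- (1 / t)) else 0)"

lemma flat_has_derivative:
  "(flat m has_real_derivative (flat (m + 2) t - real m * flat (m + 1) t)) (at t)"
proof -
  consider "t > 0" | "t < 0" | "t = 0" by linarith
  then show ?thesis
  proof cases
    case 1
    define g where "g = (\<lambda>t::real. 1 / t)"
    have g: "(g has_real_derivative - (g t)\<^sup>2) (at t)"
      unfolding g_def using 1 by (auto intro!: derivative_eq_intros simp: power2_eq_square)
    have "((\<lambda>t. g t ^ m * exp (- g t)) has_real_derivative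
        real m * (g t ^ (m - Suc 0) * - (g t)\<^sup>2) * exp (- g t) + exp (- g t) * (g t)\<^sup>2 * g t ^ m) (at t)"
      by (rule derivative_eq_intros g refl | simp)+
    moreover have "real m * (g t ^ (m - Suc 0) * - (g t)\<^sup>2) * exp (- g t) + exp (- g t) * (g t)\<^sup>2 * g t ^ m =
        flat (m + 2) t - real m * flat (m + 1) t"
      using 1 by (cases m) (simp_all add: flat_def g_def[symmetric] power2_eq_square algebra_simps)
    ultimately have "((\<lambda>t. (1 / t) ^ m * exp (- (1 / t))) has_real_derivative (flat (m + 2) t - real m * flat (m + 1) t)) (at t)"
      by (simp add: g_def)
    then show ?thesis
      by (rule has_field_derivative_transform_within_open[of _ _ _ "{0<..}"]) (use 1 in \<open>auto simp: flat_def\<close>)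
  next
    case 2
    have "((\<lambda>t. 0) has_real_derivative (flat (m + 2) t - real m * flat (m + 1) t)) (at t)"
      using 2 by (simp add: flat_def)
    then show ?thesis
      by (rule has_field_derivative_transform_within_open[of _ _ _ "{..<0}"]) (use 2 in \<open>auto simp: flat_def\<close>)
  next
    case 3
    have "((\<lambda>y. inverse y ^ Suc m / exp (inverse y)) \<longlongrightarrow> 0) (at_right (0::real))"
      by (rule filterlim_compose[OF tendsto_power_div_exp_0 filterlim_inverse_at_top_right])
    then have "((\<lambda>y. (flat m y - flat m 0) / (y - 0)) \<longlongrightarrow> 0) (at_right 0)"
      by (rule Lim_transform_eventually)
        (auto simp: eventually_at_right_less flat_def exp_minus field_simps intro!: eventually_at_rightI[of 0 1])
    moreover have "((\<lambda>y. (flat m y - flat m 0) / (y - 0)) \<longlongrightarrow> 0) (at_left 0)"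
      by (rule Lim_transform_eventually[OF tendsto_const]) (auto simp: flat_def intro!: eventually_at_leftI[of "-1" 0])
    ultimately show ?thesis
      unfolding has_field_derivative_iff 3 by (simp add: filterlim_split_at flat_def)
  qed
qed

definition bump :: "real^2 \<Rightarrow> real \<Rightarrow> nat \<Rightarrow> real^2 \<Rightarrow> complex" where
  "bump c r m x = of_real (flat m (r\<^sup>2 - (x - c) \<bullet> (x - c)))"

lemma bump_has_derivative:
  "(bump c r m has_derivative (\<lambda>h. of_real ((flat (m + 2) (r\<^sup>2 - (x - c) \<bullet> (x - c)) - real m * flat (m + 1) (r\<^sup>2 - (x - c) \<bullet> (x - c)))
     * (- 2 * ((x - c) \<bullet> h))))) (at x)"
proof -
  have 1: "((\<lambda>x. r\<^sup>2 - (x - c) \<bullet> (x - c)) has_derivative (\<lambda>h. - 2 * ((x - c) \<bullet> h))) (at x)"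
    by (auto intro!: derivative_eq_intros simp: inner_commute)
  have "(flat m has_derivative (\<lambda>h. (flat (m + 2) (r\<^sup>2 - (x - c) \<bullet> (x - c)) - real m * flat (m + 1) (r\<^sup>2 - (x - c) \<bullet> (x - c))) * h))
      (at (r\<^sup>2 - (x - c) \<bullet> (x - c)))"
    using flat_has_derivative unfolding has_field_derivative_def by blast
  from has_derivative_of_real[OF has_derivative_compose[OF 1 this]] show ?thesis
    unfolding bump_def[abs_def] .
qed

text \<open>Contains all bumps with the given centre and radius and is closed under partial
  derivatives.\<close>

inductive_set bump_algebra :: "real^2 \<Rightarrow> real \<Rightarrow> (real^2 \<Rightarrow> complex) set" for c r where
  const: "(\<lambda>x. a) \<in> bump_algebra c r"
| coord: "(\<lambda>x. of_real (x $ i)) \<in> bump_algebra c r"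
| bump: "bump c r m \<in> bump_algebra c r"
| add: "u \<in> bump_algebra c r \<Longrightarrow> v \<in> bump_algebra c r \<Longrightarrow> (\<lambda>x. u x + v x) \<in> bump_algebra c r"
| mult: "u \<in> bump_algebra c r \<Longrightarrow> v \<in> bump_algebra c r \<Longrightarrow> (\<lambda>x. u x * v x) \<in> bump_algebra c r"

lemma bump_algebra_closed:
  assumes "v \<in> bump_algebra c r"
  shows "(\<forall>x. v differentiable (at x)) \<and> (\<forall>j. partial j v \<in> bump_algebra c r)"
  using assms
proof induction
  case (const a)
  then show ?case by (auto intro: bump_algebra.const)
next
  case (coord i)
  then show ?case using coordinate_has_derivative[of i]
    by (auto simp: partial_coordinate differentiable_def intro: bump_algebra.const)
next
  case (bump m)
  have "partial j (bump c r m) = (\<lambda>x. (bump c r (m + 2) x + (- of_nat m) * bump c r (m + 1) x) * (-2 * (of_real (x $ j) + (- of_real (c $ j)))))" for j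
    by (rule ext) (subst partial_has_derivative[OF bump_has_derivative], simp add: bump_def inner_axis)
  moreover have "(\<lambda>x. (bump c r (m + 2) x + (- of_nat m) * bump c r (m + 1) x) * (-2 * (of_real (x $ j) + (- of_real (c $ j)))))
      \<in> bump_algebra c r" for j
    by (intro bump_algebra.intros)
  ultimately have "partial j (bump c r m) \<in> bump_algebra c r" for j by simp
  moreover have "bump c r m differentiable (at x)" for x
    using bump_has_derivative unfolding differentiable_def by blast
  ultimately show ?case by blast
next
  case (add u v)
  then have "partial j (\<lambda>x. u x + v x) = (\<lambda>x. partial j u x + partial j v x)" for j
    by (intro ext partial_add) auto
  then show ?case using add by (auto intro!: bump_algebra.add)
next
  case (mult u v)
  then have "partial j (\<lambda>x. u x * v x) = (\<lambda>x. u x * partial j v x + partial j u x * v x)" for j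
    by (intro ext partial_mult) auto
  then show ?case using mult by (auto intro!: bump_algebra.add bump_algebra.mult)
qed

lemma smooth_bump: "smooth_fun (bump c r m)"
  by (rule smooth_coinduct[of _ "bump_algebra c r"]) (use bump_algebra_closed in \<open>auto intro: bump_algebra.bump\<close>)

lemma bump_nonzero_iff:
  assumes "r > 0" shows "bump c r 0 x \<noteq> 0 \<longleftrightarrow> x \<in> ball c r"
proof -
  have "(x - c) \<bullet> (x - c) < r\<^sup>2 \<longleftrightarrow> norm (x - c) < r"
    unfolding power2_norm_eq_inner[symmetric]
    using assms power2_less_imp_less[of "norm (x - c)" r] power_strict_mono[of "norm (x - c)" r 2] by auto
  then show ?thesis by (auto simp: bump_def flat_def dist_norm norm_minus_commute)
qed

lemma test_bump:
  assumes "r > 0" "cball c r \<subseteq> \<Omega>" shows "test_fun \<Omega> (bump c r 0)"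
proof -
  have "bump c r 0 x = 0" if "x \<notin> cball c r" for x
    using bump_nonzero_iff[OF assms(1), of c x] that by auto
  then show ?thesis
    unfolding test_fun_iff using assms(2) by (intro conjI smooth_bump exI[of _ "cball c r"]) auto
qed

lemma bump_norm_nonzero:
  assumes "r > 0" shows "L2ip (bump c r 0) (bump c r 0) \<noteq> 0"
proof
  assume 0: "L2ip (bump c r 0) (bump c r 0) = 0"
  have "bump c r 0 \<in> L2" using test_L2[OF test_bump[OF assms, of c UNIV]] by simp
  moreover have "L2norm (bump c r 0) = 0" using 0 by (simp add: form_norm_def)
  ultimately have "AE x in lebesgue. x \<notin> ball c r"
    using L2norm_zero_iff bump_nonzero_iff[OF assms] by auto
  then have "negligible (ball c r)" by (simp add: negligible_iff_null_sets AE_iff_null_sets)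
  then show False using assms open_not_negligible[of "ball c r"] by simp
qed

text \<open>Bumps in disjoint discs, with radii d k / 4 and centres at distance d k from c,
  where \<open>d k = R / 2 ^ (k + 1)\<close>. They lie in the annuli between the radii 3/4 d k
  and 5/4 d k, which are disjoint.\<close>

lemma orthogonal_tests:
  assumes "open \<Omega>" "\<Omega> \<noteq> {}"
  shows "\<exists>b :: nat \<Rightarrow> _. \<forall>i. b i \<in> tests \<Omega> \<and> L2ip (b i) (b i) \<noteq> 0 \<and> (\<forall>j. j \<noteq> i \<longrightarrow> L2ip (b i) (b j) = 0)"
proof -
  obtain c R where cR: "R > 0" "ball c R \<subseteq> \<Omega>" using assms by (metis ex_in_conv open_contains_ball)
  define d where "d = (\<lambda>k. R / 2 ^ (k + 1))"
  define z where "z = (\<lambda>k. c + d k *\<^sub>R axis 1 1 :: real^2)"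
  define b where "b = (\<lambda>k. bump (z k) (d k / 4) 0)"
  have d0: "d k > 0" for k using cR by (simp add: d_def)
  have ring: "3/4 * d k \<le> norm (x - c) \<and> norm (x - c) \<le> 5/4 * d k" if "x \<in> cball (z k) (d k / 4)" for x k
  proof -
    have "norm (x - z k) \<le> d k / 4" using that by (simp add: dist_norm norm_minus_commute)
    moreover have "norm (z k - c) = d k" using d0[of k] by (simp add: z_def norm_axis_1)
    moreover have "x - c = (x - z k) + (z k - c)" by simp
    ultimately show ?thesis
      using norm_triangle_ineq[of "x - z k" "z k - c"] norm_triangle_ineq[of "z k - x" "x - c"] norm_minus_commute[of "z k" x]
      by simp
  qed
  have dlt: "5/4 * d j < 3/4 * d i" if "i < j" for i j
  proof -
    have "(2::real) ^ (i + 2) \<le> 2 ^ (j + 1)" using that by (intro power_increasing) auto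
    then have "d j \<le> R / 2 ^ (i + 2)" unfolding d_def using cR(1) by (intro divide_left_mono) auto
    also have "\<dots> = d i / 2" by (simp add: d_def)
    finally show ?thesis using d0[of i] by simp
  qed
  have "cball (z k) (d k / 4) \<subseteq> \<Omega>" for k
  proof -
    have "d k \<le> R / 2" unfolding d_def using cR(1) by (intro divide_left_mono) auto
    then have "cball (z k) (d k / 4) \<subseteq> ball c R"
      using ring[of _ k] cR(1) by (force simp: dist_norm norm_minus_commute)
    then show ?thesis using cR by blast
  qed
  then have "b k \<in> tests \<Omega>" for k unfolding b_def tests_def using d0[of k] by (simp add: test_bump)
  moreover have "L2ip (b i) (b i) \<noteq> 0" for i unfolding b_def using d0[of i] by (simp add: bump_norm_nonzero)
  moreover have "L2ip (b i) (b j) = 0" if "j \<noteq> i" for i j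
  proof -
    have "b i x * cnj (b j x) = 0" for x
    proof (rule ccontr)
      assume "b i x * cnj (b j x) \<noteq> 0"
      then have "x \<in> ball (z i) (d i / 4)" "x \<in> ball (z j) (d j / 4)"
        using bump_nonzero_iff[of "d _ / 4" "z _" x] d0 by (auto simp: b_def)
      then have "x \<in> cball (z i) (d i / 4)" "x \<in> cball (z j) (d j / 4)" by auto
      then show False using ring[of x i] ring[of x j] dlt[of i j] dlt[of j i] that by (cases i j rule: linorder_cases) auto
    qed
    then have "(\<lambda>x. b i x * cnj (b j x)) = (\<lambda>x. 0)" by (rule ext)
    then show ?thesis unfolding L2ip_eq by simp
  qed
  ultimately show ?thesis by blast
qed

section \<open>The form domain and the closed magnetic form\<close>

definition approx_by :: "(real^2) set \<Rightarrow> real \<Rightarrow> (nat \<Rightarrow> real^2 \<Rightarrow> complex) \<Rightarrow> (real^2 \<Rightarrow> complex) \<Rightarrow> bool" where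
  "approx_by \<Omega> B s u \<longleftrightarrow>
     (\<forall>k. s k \<in> tests \<Omega>) \<and> (\<lambda>k. L2norm (s k - u)) \<longlonglongrightarrow> 0 \<and> form_Cauchy (mform B) s"

text \<open>Elements are functions on the whole plane that vanish outside
  \<open>\<Omega>\<close>. In this way the form domain of a subset is a subspace of that of the
  larger set, and the single form \<open>qform B\<close> serves all sets.\<close>

definition fdom :: "(real^2) set \<Rightarrow> real \<Rightarrow> (real^2 \<Rightarrow> complex) set" where
  "fdom \<Omega> B = {u \<in> L2_on \<Omega>. \<exists>s. approx_by \<Omega> B s u}"

definition qform :: "real \<Rightarrow> (real^2 \<Rightarrow> complex) \<Rightarrow> (real^2 \<Rightarrow> complex) \<Rightarrow> complex" where
  "qform B u v = (THE z. \<exists>s t. approx_by UNIV B s u \<and> approx_by UNIV B t v \<and> (\<lambda>k. mform B (s k) (t k)) \<longlonglongrightarrow> z)"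

lemma tests_mono: "\<Omega> \<subseteq> \<Omega>' \<Longrightarrow> tests \<Omega> \<subseteq> tests \<Omega>'"
  unfolding tests_def using test_mono by blast

lemma tests_UNIV: "u \<in> tests \<Omega> \<Longrightarrow> u \<in> tests UNIV"
  using tests_mono by blast

lemma tests_L2: "u \<in> tests \<Omega> \<Longrightarrow> u \<in> L2"
  by (simp add: tests_def test_L2)

lemma approx_by_mono: "approx_by \<Omega> B s u \<Longrightarrow> \<Omega> \<subseteq> \<Omega>' \<Longrightarrow> approx_by \<Omega>' B s u"
  unfolding approx_by_def using tests_mono by blast

lemma fdom_mono: "\<Omega> \<subseteq> \<Omega>' \<Longrightarrow> fdom \<Omega> B \<subseteq> fdom \<Omega>' B"
  unfolding fdom_def L2_on_def using approx_by_mono by blast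

lemma fdom_L2: "u \<in> fdom \<Omega> B \<Longrightarrow> u \<in> L2"
  and fdom_outside: "u \<in> fdom \<Omega> B \<Longrightarrow> x \<notin> \<Omega> \<Longrightarrow> u x = 0"
  by (auto simp: fdom_def L2_on_def)

interpretation whole: closable_form fun_scale "L2_on UNIV" "tests UNIV" L2ip "mform B"
  rewrites "closable_form.approx (tests UNIV) L2ip (mform B) = approx_by UNIV B"
    and "closable_form.Dom (L2_on UNIV) (tests UNIV) L2ip (mform B) = fdom UNIV B"
    and "closable_form.Q (tests UNIV) L2ip (mform B) = qform B"
  for B
proof -
  show c: "closable_form fun_scale (L2_on UNIV) (tests UNIV) L2ip (mform B)" by (rule closable_mform) simp
  show a: "closable_form.approx (tests UNIV) L2ip (mform B) = approx_by UNIV B"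
    by (intro ext) (simp add: closable_form.approx_def[OF c] approx_by_def)
  show "closable_form.Dom (L2_on UNIV) (tests UNIV) L2ip (mform B) = fdom UNIV B"
    by (simp add: closable_form.Dom_def[OF c] a fdom_def)
  show "closable_form.Q (tests UNIV) L2ip (mform B) = qform B"
    by (intro ext) (simp add: closable_form.Q_def[OF c] a qform_def)
qed

lemma qform_limit:
  assumes "u \<in> L2" "v \<in> L2" "approx_by \<Omega> B s u" "approx_by \<Omega>' B t v"
  shows "(\<lambda>k. mform B (s k) (t k)) \<longlonglongrightarrow> qform B u v"
  using assms whole.approx_form_limit[of u v B s t] approx_by_mono[OF _ subset_UNIV] by (auto simp: L2_on_def)

lemma closable_tests:
  assumes "\<Omega> \<in> sets lebesgue"
  shows "closable_form fun_scale (L2_on \<Omega>) (tests \<Omega>) L2ip (mform B)"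
    and "closable_form.approx (tests \<Omega>) L2ip (mform B) = approx_by \<Omega> B"
    and "closable_form.Dom (L2_on \<Omega>) (tests \<Omega>) L2ip (mform B) = fdom \<Omega> B"
    and "u \<in> fdom \<Omega> B \<Longrightarrow> v \<in> fdom \<Omega> B \<Longrightarrow> closable_form.Q (tests \<Omega>) L2ip (mform B) u v = qform B u v"
proof -
  show c: "closable_form fun_scale (L2_on \<Omega>) (tests \<Omega>) L2ip (mform B)" using assms by (rule closable_mform)
  show a: "closable_form.approx (tests \<Omega>) L2ip (mform B) = approx_by \<Omega> B"
    by (intro ext) (simp add: closable_form.approx_def[OF c] approx_by_def)
  show "closable_form.Dom (L2_on \<Omega>) (tests \<Omega>) L2ip (mform B) = fdom \<Omega> B"
    by (simp add: closable_form.Dom_def[OF c] a fdom_def)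
  assume uv: "u \<in> fdom \<Omega> B" "v \<in> fdom \<Omega> B"
  then obtain s t where st: "approx_by \<Omega> B s u" "approx_by \<Omega> B t v" by (auto simp: fdom_def)
  have "(\<lambda>k. mform B (s k) (t k)) \<longlonglongrightarrow> closable_form.Q (tests \<Omega>) L2ip (mform B) u v"
    using uv st by (intro closable_form.approx_form_limit[OF c]) (auto simp: a fdom_def)
  moreover have "(\<lambda>k. mform B (s k) (t k)) \<longlonglongrightarrow> qform B u v"
    using uv st fdom_L2 by (intro qform_limit[of _ _ \<Omega> _ _ \<Omega>]) auto
  ultimately show "closable_form.Q (tests \<Omega>) L2ip (mform B) u v = qform B u v" using LIMSEQ_unique by blast
qed

lemma form_norm_cong: "h u u = h' u u \<Longrightarrow> form_norm h u = form_norm h' u"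
  by (simp add: form_norm_def)

lemma hermitian_qform:
  assumes "\<Omega> \<in> sets lebesgue" shows "hermitian_form fun_scale (fdom \<Omega> B) (qform B)"
proof -
  interpret c: closable_form fun_scale "L2_on \<Omega>" "tests \<Omega>" L2ip "mform B" using assms by (rule closable_tests)
  have D: "c.Dom = fdom \<Omega> B" using closable_tests(3)[OF assms] .
  show ?thesis
    by (rule hermitian_form.hermitian_form_subspace[OF whole.hermitian_Q c.Q.sub[unfolded D]]) (rule fdom_mono, simp)
qed

lemma hermitian_L2_fdom:
  assumes "\<Omega> \<in> sets lebesgue" shows "hermitian_form fun_scale (fdom \<Omega> B) L2ip"
proof -
  interpret q: hermitian_form fun_scale "fdom \<Omega> B" "qform B" using assms by (rule hermitian_qform)
  show ?thesis using q.sub fdom_L2 by (intro L2.hermitian_form_subspace) auto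
qed

lemma tests_fdom: "u \<in> tests \<Omega> \<Longrightarrow> u \<in> fdom \<Omega> B"
  unfolding fdom_def L2_on_def approx_by_def
  using tests_L2 test_zero_outside by (auto simp: tests_def form_Cauchy_def intro!: exI[of _ "\<lambda>k. u"])

lemma qform_tests: "u \<in> tests \<Omega> \<Longrightarrow> v \<in> tests \<Omega> \<Longrightarrow> qform B u v = mform B u v"
  using whole.Q_on_T tests_UNIV by blast

lemma fdom_approximation:
  assumes "\<Omega> \<in> sets lebesgue" "u \<in> fdom \<Omega> B" "e > 0"
  obtains t where "t \<in> tests \<Omega>" "L2norm (u - t) < e" "form_norm (qform B) (u - t) < e"
proof -
  interpret c: closable_form fun_scale "L2_on \<Omega>" "tests \<Omega>" L2ip "mform B" using assms(1) by (rule closable_tests)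
  have D: "c.Dom = fdom \<Omega> B" using closable_tests(3)[OF assms(1)] .
  obtain t where t: "t \<in> tests \<Omega>" "L2norm (u - t) < e" "form_norm c.Q (u - t) < e"
    using c.Dom_approximation[of u e] assms(2,3) unfolding D by blast
  have "u - t \<in> fdom \<Omega> B" using c.Q.D_simps(4)[of u t] assms(2) tests_fdom[OF t(1)] unfolding D by blast
  then have "form_norm (qform B) (u - t) = form_norm c.Q (u - t)"
    using closable_tests(4)[OF assms(1)] by (intro form_norm_cong) simp
  then show ?thesis using that t by simp
qed

text \<open>Every element of the form domain is close to a test function in both norms, so
  Rellich's theorem passes from test functions to the form domain.\<close>

theorem compact_fdom:
  assumes "open \<Omega>" "bounded \<Omega>" "\<Omega> \<noteq> {}"
  shows "compact_form_pair fun_scale (fdom \<Omega> B) L2ip (qform B)"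
proof -
  have ms: "\<Omega> \<in> sets lebesgue" using assms(1) by simp
  interpret ip: hermitian_form fun_scale "fdom \<Omega> B" L2ip using ms by (rule hermitian_L2_fdom)
  interpret q: hermitian_form fun_scale "fdom \<Omega> B" "qform B" using ms by (rule hermitian_qform)
  interpret c: closable_form fun_scale "L2_on \<Omega>" "tests \<Omega>" L2ip "mform B" using ms by (rule closable_tests)
  have D: "c.Dom = fdom \<Omega> B" using closable_tests(3)[OF ms] .
  have Qn: "form_norm c.Q u = form_norm (qform B) u" if "u \<in> fdom \<Omega> B" for u
    using closable_tests(4)[OF ms] that by (intro form_norm_cong) simp
  show ?thesis
  proof
    fix s :: "nat \<Rightarrow> real^2 \<Rightarrow> complex" and C
    assume s: "\<And>k. s k \<in> fdom \<Omega> B" and C: "\<And>k. L2norm (s k) \<le> C" "\<And>k. form_norm (qform B) (s k) \<le> C"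
    have "\<exists>t. t \<in> tests \<Omega> \<and> L2norm (s k - t) < inverse (Suc k) \<and> form_norm (qform B) (s k - t) < inverse (Suc k)" for k
      using fdom_approximation[OF ms s[of k], of "inverse (Suc k)"] by (metis inverse_positive_iff_positive of_nat_0_less_iff zero_less_Suc)
    then obtain t where t: "\<And>k. t k \<in> tests \<Omega>" "\<And>k. L2norm (s k - t k) < inverse (Suc k)"
      "\<And>k. form_norm (qform B) (s k - t k) < inverse (Suc k)" by metis
    have tD: "t k \<in> fdom \<Omega> B" for k using t(1) by (rule tests_fdom)
    have le1: "inverse (real (Suc k)) \<le> 1" for k by (simp add: inverse_le_1_iff)
    have b1: "L2norm (t k) \<le> C + 1" for k
      using ip.form_norm_diff_le[OF s[of k] tD[of k]] C(1)[of k] t(2)[of k] le1[of k] by linarith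
    have "form_norm (qform B) (t k) \<le> C + 1" for k
      using q.form_norm_diff_le[OF s[of k] tD[of k]] C(2)[of k] t(3)[of k] le1[of k] by linarith
    then have b2: "form_norm (mform B) (t k) \<le> C + 1" for k
      using qform_tests[OF t(1)[of k] t(1)[of k], of B] by (metis form_norm_cong)
    have "\<exists>r. strict_mono r \<and> form_Cauchy L2ip (\<lambda>k. t (r k))"
      by (rule Rellich[OF assms(2) t(1) b1 b2])
    then obtain r where r: "strict_mono r" "form_Cauchy L2ip (\<lambda>k. t (r k))" by blast
    have lim0: "(\<lambda>k. L2norm (s k - t k)) \<longlonglongrightarrow> 0"
      using t(2) s tD by (intro tendsto_sandwich[OF always_eventually always_eventually tendsto_const LIMSEQ_inverse_real_of_nat])
        (auto intro: less_imp_le)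
    then have "(\<lambda>k. L2norm (s (r k) - t (r k) - 0)) \<longlonglongrightarrow> 0"
      using LIMSEQ_subseq_LIMSEQ[OF lim0 r(1)] by (simp add: o_def)
    then have "form_Cauchy L2ip (\<lambda>k. s (r k) - t (r k))"
      by (intro ip.form_convergent_imp_Cauchy[of _ 0]) (use s tD in simp_all)
    then have "form_Cauchy L2ip (\<lambda>k. (s (r k) - t (r k)) + t (r k))"
      by (rule ip.form_Cauchy_add[rotated]) (use s tD r(2) in simp_all)
    then have "form_Cauchy L2ip (\<lambda>k. s (r k))" by simp
    then show "\<exists>r. strict_mono r \<and> form_Cauchy L2ip (\<lambda>k. s (r k))" using r(1) by blast
  next
    fix s :: "nat \<Rightarrow> real^2 \<Rightarrow> complex"
    assume s: "\<And>k. s k \<in> fdom \<Omega> B" and C: "form_Cauchy L2ip s" "form_Cauchy (qform B) s"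
    have "s k - s l \<in> fdom \<Omega> B" for k l using s by simp
    then have "form_Cauchy c.Q s" using C(2) Qn unfolding form_Cauchy_def by simp
    then obtain u where u: "u \<in> fdom \<Omega> B" "(\<lambda>k. L2norm (s k - u)) \<longlonglongrightarrow> 0" "(\<lambda>k. form_norm c.Q (s k - u)) \<longlonglongrightarrow> 0"
      using c.Dom_complete[of s] s C(1) unfolding D by blast
    moreover have "form_norm c.Q (s k - u) = form_norm (qform B) (s k - u)" for k using Qn s u(1) by simp
    ultimately show "\<exists>u\<in>fdom \<Omega> B. (\<lambda>k. L2norm (s k - u)) \<longlonglongrightarrow> 0 \<and> (\<lambda>k. form_norm (qform B) (s k - u)) \<longlonglongrightarrow> 0"
      by auto
  next
    show "\<exists>b :: nat \<Rightarrow> _. \<forall>i. b i \<in> fdom \<Omega> B \<and> L2ip (b i) (b i) \<noteq> 0 \<and> (\<forall>j. j \<noteq> i \<longrightarrow> L2ip (b i) (b j) = 0)"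
      using orthogonal_tests[OF assms(1,3)] tests_fdom by blast
  qed
qed

section \<open>The eigenvalues of the magnetic Dirichlet Laplacian\<close>

lemma restrict_measurable_iff:
  assumes "\<Omega> \<in> sets lebesgue"
  shows "L2_fun \<Omega> u \<longleftrightarrow> restrict_fun \<Omega> u \<in> L2"
proof -
  have "u \<in> borel_measurable (lebesgue_on \<Omega>) \<longleftrightarrow> restrict_fun \<Omega> u \<in> borel_measurable lebesgue"
    unfolding restrict_fun_def[abs_def] using assms by (simp add: borel_measurable_if)
  moreover have "integrable (lebesgue_on \<Omega>) (\<lambda>x. (cmod (u x))\<^sup>2) \<longleftrightarrow> integrable lebesgue (\<lambda>x. indicator \<Omega> x *\<^sub>R (cmod (u x))\<^sup>2)"
    using assms by (intro integrable_restrict_space) auto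
  moreover have "(\<lambda>x. indicator \<Omega> x *\<^sub>R (cmod (u x))\<^sup>2) = (\<lambda>x. (cmod (restrict_fun \<Omega> u x))\<^sup>2)"
    by (auto simp: restrict_fun_def)
  ultimately show ?thesis by (simp add: L2_fun_def L2_iff)
qed

lemma L2_inner_restrict:
  assumes "\<Omega> \<in> sets lebesgue"
  shows "L2_inner \<Omega> u v = L2ip (restrict_fun \<Omega> u) (restrict_fun \<Omega> v)"
proof -
  have "L2_inner \<Omega> u v = (\<integral>x. indicator \<Omega> x *\<^sub>R (u x * cnj (v x)) \<partial>lebesgue)"
    unfolding L2_inner_def using assms by (intro integral_restrict_space) auto
  also have "(\<lambda>x. indicator \<Omega> x *\<^sub>R (u x * cnj (v x))) = (\<lambda>x. restrict_fun \<Omega> u x * cnj (restrict_fun \<Omega> v x))"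
    by (auto simp: restrict_fun_def)
  finally show ?thesis by (simp add: L2ip_eq)
qed

lemma form_approx_restrict:
  assumes ms: "\<Omega> \<in> sets lebesgue" and u: "L2_fun \<Omega> u"
  shows "form_approx \<Omega> B \<phi> u \<longleftrightarrow> approx_by \<Omega> B \<phi> (restrict_fun \<Omega> u)"
proof (cases "\<forall>k. test_fun \<Omega> (\<phi> k)")
  case False
  then show ?thesis unfolding form_approx_def approx_by_def tests_def by blast
next
  case True
  interpret m: hermitian_form fun_scale "tests \<Omega>" "mform B" by (rule hermitian_mform)
  have t: "test_fun \<Omega> (\<phi> k)" "\<phi> k \<in> tests \<Omega>" for k using True by (auto simp: tests_def)
  have uL: "restrict_fun \<Omega> u \<in> L2" using u restrict_measurable_iff[OF ms] by blast
  have "integral\<^sup>L (lebesgue_on \<Omega>) (\<lambda>x. (cmod (\<phi> k x - u x))\<^sup>2) = (L2norm (\<phi> k - restrict_fun \<Omega> u))\<^sup>2" for k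
  proof -
    have "integral\<^sup>L (lebesgue_on \<Omega>) (\<lambda>x. (cmod (\<phi> k x - u x))\<^sup>2) = (\<integral>x. indicator \<Omega> x *\<^sub>R (cmod (\<phi> k x - u x))\<^sup>2 \<partial>lebesgue)"
      using ms by (intro integral_restrict_space) auto
    also have "(\<lambda>x. indicator \<Omega> x *\<^sub>R (cmod (\<phi> k x - u x))\<^sup>2) = (\<lambda>x. (cmod ((\<phi> k - restrict_fun \<Omega> u) x))\<^sup>2)"
      using test_zero_outside[OF t(1)] by (auto simp: restrict_fun_def indicator_def)
    finally show ?thesis by (simp add: L2norm_sq)
  qed
  moreover have "(\<lambda>k. (L2norm (\<phi> k - restrict_fun \<Omega> u))\<^sup>2) \<longlonglongrightarrow> 0 \<longleftrightarrow> (\<lambda>k. L2norm (\<phi> k - restrict_fun \<Omega> u)) \<longlonglongrightarrow> 0"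
  proof
    assume "(\<lambda>k. (L2norm (\<phi> k - restrict_fun \<Omega> u))\<^sup>2) \<longlonglongrightarrow> 0"
    then have "(\<lambda>k. sqrt ((L2norm (\<phi> k - restrict_fun \<Omega> u))\<^sup>2)) \<longlonglongrightarrow> sqrt 0" by (rule tendsto_real_sqrt)
    then show "(\<lambda>k. L2norm (\<phi> k - restrict_fun \<Omega> u)) \<longlonglongrightarrow> 0"
      using tests_L2[OF t(2)] uL by simp
  next
    assume "(\<lambda>k. L2norm (\<phi> k - restrict_fun \<Omega> u)) \<longlonglongrightarrow> 0"
    from tendsto_power[OF this, of 2] show "(\<lambda>k. (L2norm (\<phi> k - restrict_fun \<Omega> u))\<^sup>2) \<longlonglongrightarrow> 0" by simp
  qed
  ultimately have conv: "L2_convergent_to \<Omega> \<phi> u \<longleftrightarrow> (\<lambda>k. L2norm (\<phi> k - restrict_fun \<Omega> u)) \<longlonglongrightarrow> 0"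
    by (simp add: L2_convergent_to_def)
  have sq: "cmod (magnetic_form \<Omega> B (\<lambda>x. \<phi> k x - \<phi> l x) (\<lambda>x. \<phi> k x - \<phi> l x)) = (form_norm (mform B) (\<phi> k - \<phi> l))\<^sup>2" for k l
  proof -
    have "magnetic_form \<Omega> B (\<lambda>x. \<phi> k x - \<phi> l x) (\<lambda>x. \<phi> k x - \<phi> l x) = mform B (\<phi> k - \<phi> l) (\<phi> k - \<phi> l)"
      using magnetic_form_local[OF test_diff[OF t(1) t(1)] ms] by (simp add: fun_diff_def)
    also have "\<dots> = of_real ((form_norm (mform B) (\<phi> k - \<phi> l))\<^sup>2)"
      using t(2) by (intro m.self_real) auto
    finally show ?thesis by (simp del: of_real_power)
  qed
  have "(\<forall>e>0. \<exists>N. \<forall>k\<ge>N. \<forall>l\<ge>N. (form_norm (mform B) (\<phi> k - \<phi> l))\<^sup>2 < e) \<longleftrightarrow> form_Cauchy (mform B) \<phi>"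
  proof
    assume L: "\<forall>e>0. \<exists>N. \<forall>k\<ge>N. \<forall>l\<ge>N. (form_norm (mform B) (\<phi> k - \<phi> l))\<^sup>2 < e"
    show "form_Cauchy (mform B) \<phi>"
      unfolding form_Cauchy_def
    proof (intro allI impI)
      fix e :: real assume "e > 0"
      moreover then have "e\<^sup>2 > 0" by simp
      ultimately show "\<exists>N. \<forall>k\<ge>N. \<forall>l\<ge>N. form_norm (mform B) (\<phi> k - \<phi> l) < e"
        using L by (meson less_imp_le power2_less_imp_less)
    qed
  next
    assume R: "form_Cauchy (mform B) \<phi>"
    show "\<forall>e>0. \<exists>N. \<forall>k\<ge>N. \<forall>l\<ge>N. (form_norm (mform B) (\<phi> k - \<phi> l))\<^sup>2 < e"
    proof (intro allI impI)
      fix e :: real assume e: "e > 0"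
      then obtain N where N: "\<And>k l. k \<ge> N \<Longrightarrow> l \<ge> N \<Longrightarrow> form_norm (mform B) (\<phi> k - \<phi> l) < sqrt e"
        using R unfolding form_Cauchy_def by (meson real_sqrt_gt_zero)
      have "(form_norm (mform B) (\<phi> k - \<phi> l))\<^sup>2 < e" if "k \<ge> N" "l \<ge> N" for k l
      proof -
        have "(form_norm (mform B) (\<phi> k - \<phi> l))\<^sup>2 < (sqrt e)\<^sup>2"
          using N[OF that] t(2) by (intro power_strict_mono) auto
        then show ?thesis using e by simp
      qed
      then show "\<exists>N. \<forall>k\<ge>N. \<forall>l\<ge>N. (form_norm (mform B) (\<phi> k - \<phi> l))\<^sup>2 < e" by blast
    qed
  qed
  then show ?thesis unfolding form_approx_def approx_by_def conv sq using t by (simp add: tests_def)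
qed

lemma form_domain_restrict:
  assumes ms: "\<Omega> \<in> sets lebesgue"
  shows "u \<in> form_domain \<Omega> B \<longleftrightarrow> restrict_fun \<Omega> u \<in> fdom \<Omega> B"
  using restrict_measurable_iff[OF ms, of u] form_approx_restrict[OF ms, of u B]
  by (auto simp: form_domain_def fdom_def L2_on_def restrict_fun_def)

lemma closed_form_restrict:
  assumes ms: "\<Omega> \<in> sets lebesgue" and uv: "u \<in> form_domain \<Omega> B" "v \<in> form_domain \<Omega> B"
  shows "closed_form \<Omega> B u v = qform B (restrict_fun \<Omega> u) (restrict_fun \<Omega> v)"
proof -
  have f: "restrict_fun \<Omega> u \<in> fdom \<Omega> B" "restrict_fun \<Omega> v \<in> fdom \<Omega> B"
    using uv form_domain_restrict[OF ms] by auto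
  have L: "restrict_fun \<Omega> u \<in> L2" "restrict_fun \<Omega> v \<in> L2" using f fdom_L2 by auto
  have a: "form_approx \<Omega> B \<phi> u \<longleftrightarrow> approx_by \<Omega> B \<phi> (restrict_fun \<Omega> u)"
    "form_approx \<Omega> B \<phi> v \<longleftrightarrow> approx_by \<Omega> B \<phi> (restrict_fun \<Omega> v)" for \<phi>
    using uv form_approx_restrict[OF ms] by (auto simp: form_domain_def)
  have m: "magnetic_form \<Omega> B (\<phi> k) (\<psi> k) = mform B (\<phi> k) (\<psi> k)" if "approx_by \<Omega> B \<phi> w" for \<phi> \<psi> w k
    using that by (intro magnetic_form_local ms) (simp add: approx_by_def tests_def)
  show ?thesis
    unfolding closed_form_def a
  proof (rule the_equality)
    obtain s t where st: "approx_by \<Omega> B s (restrict_fun \<Omega> u)" "approx_by \<Omega> B t (restrict_fun \<Omega> v)" using f by (auto simp: fdom_def)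
    moreover have "(\<lambda>k. magnetic_form \<Omega> B (s k) (t k)) \<longlonglongrightarrow> qform B (restrict_fun \<Omega> u) (restrict_fun \<Omega> v)"
      unfolding m[OF st(1)] by (rule qform_limit[OF L st])
    ultimately show "\<exists>\<phi> \<psi>. approx_by \<Omega> B \<phi> (restrict_fun \<Omega> u) \<and> approx_by \<Omega> B \<psi> (restrict_fun \<Omega> v) \<and>
        (\<lambda>k. magnetic_form \<Omega> B (\<phi> k) (\<psi> k)) \<longlonglongrightarrow> qform B (restrict_fun \<Omega> u) (restrict_fun \<Omega> v)"
      by blast
  next
    fix z assume "\<exists>\<phi> \<psi>. approx_by \<Omega> B \<phi> (restrict_fun \<Omega> u) \<and> approx_by \<Omega> B \<psi> (restrict_fun \<Omega> v) \<and>
        (\<lambda>k. magnetic_form \<Omega> B (\<phi> k) (\<psi> k)) \<longlonglongrightarrow> z"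
    then obtain \<phi> \<psi> where p: "approx_by \<Omega> B \<phi> (restrict_fun \<Omega> u)" "approx_by \<Omega> B \<psi> (restrict_fun \<Omega> v)"
      "(\<lambda>k. mform B (\<phi> k) (\<psi> k)) \<longlonglongrightarrow> z" using m by auto
    then show "z = qform B (restrict_fun \<Omega> u) (restrict_fun \<Omega> v)"
      using qform_limit[OF L p(1,2)] LIMSEQ_unique by blast
  qed
qed

lemma restrict_id: "u \<in> fdom \<Omega> B \<Longrightarrow> restrict_fun \<Omega> u = u"
  by (auto simp: restrict_fun_def fun_eq_iff fdom_outside)

text \<open>The operator ignores the values of functions outside \<open>\<Omega>\<close>,
  whereas elements of \<open>fdom\<close> vanish there; restriction translates between the two
  conventions.\<close>

lemma eigenspace_iff:
  assumes "open \<Omega>" "bounded \<Omega>" "\<Omega> \<noteq> {}"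
  shows "u \<in> eigenspace \<Omega> B \<mu> \<longleftrightarrow> compact_form_pair.eigvec (fdom \<Omega> B) L2ip (qform B) \<mu> (restrict_fun \<Omega> u)"
proof -
  have ms: "\<Omega> \<in> sets lebesgue" using assms(1) by simp
  interpret compact_form_pair fun_scale "fdom \<Omega> B" L2ip "qform B" using assms by (rule compact_fdom)
  show ?thesis
  proof (cases "u \<in> form_domain \<Omega> B")
    case False
    then show ?thesis by (simp add: eigenspace_def magnetic_Laplacian_def eigvec_def form_domain_restrict[OF ms])
  next
    case True
    then have f: "restrict_fun \<Omega> u \<in> fdom \<Omega> B" using form_domain_restrict[OF ms] by blast
    have r: "restrict_fun \<Omega> (\<lambda>x. of_real \<mu> * u x) = fun_scale (of_real \<mu>) (restrict_fun \<Omega> u)"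
      by (auto simp: restrict_fun_def)
    have L: "L2_fun \<Omega> (\<lambda>x. of_real \<mu> * u x)"
      unfolding restrict_measurable_iff[OF ms] r using f fdom_L2 by auto
    have "(\<forall>v\<in>form_domain \<Omega> B. closed_form \<Omega> B u v = L2_inner \<Omega> (\<lambda>x. of_real \<mu> * u x) v) \<longleftrightarrow>
      (\<forall>v\<in>fdom \<Omega> B. qform B (restrict_fun \<Omega> u) v = of_real \<mu> * L2ip (restrict_fun \<Omega> u) v)"
    proof -
      have *: "closed_form \<Omega> B u v = L2_inner \<Omega> (\<lambda>x. of_real \<mu> * u x) v \<longleftrightarrow>
        qform B (restrict_fun \<Omega> u) (restrict_fun \<Omega> v) = of_real \<mu> * L2ip (restrict_fun \<Omega> u) (restrict_fun \<Omega> v)"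
        if "v \<in> form_domain \<Omega> B" for v
        using that f form_domain_restrict[OF ms]
        by (simp add: closed_form_restrict[OF ms True] L2_inner_restrict[OF ms] r ip.scale_left)
      show ?thesis
      proof
        assume L: "\<forall>v\<in>form_domain \<Omega> B. closed_form \<Omega> B u v = L2_inner \<Omega> (\<lambda>x. of_real \<mu> * u x) v"
        show "\<forall>v\<in>fdom \<Omega> B. qform B (restrict_fun \<Omega> u) v = of_real \<mu> * L2ip (restrict_fun \<Omega> u) v"
        proof
          fix v assume v: "v \<in> fdom \<Omega> B"
          then have "v \<in> form_domain \<Omega> B" using form_domain_restrict[OF ms] restrict_id by metis
          then show "qform B (restrict_fun \<Omega> u) v = of_real \<mu> * L2ip (restrict_fun \<Omega> u) v"
            using L *[of v] restrict_id[OF v] by simp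
        qed
      next
        assume R: "\<forall>v\<in>fdom \<Omega> B. qform B (restrict_fun \<Omega> u) v = of_real \<mu> * L2ip (restrict_fun \<Omega> u) v"
        then show "\<forall>v\<in>form_domain \<Omega> B. closed_form \<Omega> B u v = L2_inner \<Omega> (\<lambda>x. of_real \<mu> * u x) v"
          using * form_domain_restrict[OF ms] by blast
      qed
    qed
    then show ?thesis using True f L by (simp add: eigenspace_def magnetic_Laplacian_def eigvec_def)
  qed
qed

lemma lin_comb_apply: "lin_comb fun_scale n c u x = (\<Sum>j<n. c j * u j x)"
  unfolding lin_comb_def by (induction n) auto

lemma L2_independent_iff:
  assumes ms: "\<Omega> \<in> sets lebesgue" and u: "\<And>j. j < n \<Longrightarrow> restrict_fun \<Omega> (u j) \<in> L2"
  shows "L2_independent \<Omega> n u \<longleftrightarrow> L2.indep n (\<lambda>j. restrict_fun \<Omega> (u j))"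
proof -
  have "(AE x in lebesgue_on \<Omega>. (\<Sum>j<n. c j * u j x) = 0) \<longleftrightarrow> L2norm (lin_comb fun_scale n c (\<lambda>j. restrict_fun \<Omega> (u j))) = 0" for c
  proof -
    have "(AE x in lebesgue_on \<Omega>. (\<Sum>j<n. c j * u j x) = 0) \<longleftrightarrow> (AE x in lebesgue. x \<in> \<Omega> \<longrightarrow> (\<Sum>j<n. c j * u j x) = 0)"
      using ms by (intro AE_restrict_space_iff) auto
    also have "\<dots> \<longleftrightarrow> (AE x in lebesgue. lin_comb fun_scale n c (\<lambda>j. restrict_fun \<Omega> (u j)) x = 0)"
    proof (intro AE_cong)
      fix x
      show "(x \<in> \<Omega> \<longrightarrow> (\<Sum>j<n. c j * u j x) = 0) \<longleftrightarrow> lin_comb fun_scale n c (\<lambda>j. restrict_fun \<Omega> (u j)) x = 0"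
        by (cases "x \<in> \<Omega>") (simp_all add: lin_comb_apply restrict_fun_def)
    qed
    also have "\<dots> \<longleftrightarrow> L2norm (lin_comb fun_scale n c (\<lambda>j. restrict_fun \<Omega> (u j))) = 0"
      using u by (intro L2norm_zero_iff[symmetric] L2.lin_comb_in)
    finally show ?thesis .
  qed
  then show ?thesis by (simp add: L2_independent_def L2.indep_def)
qed

definition spectral_of :: "(real^2) set \<Rightarrow> real \<Rightarrow> (nat \<Rightarrow> real^2 \<Rightarrow> complex) \<Rightarrow> (nat \<Rightarrow> real) \<Rightarrow> bool" where
  "spectral_of \<Omega> B = compact_form_pair.spectral (fdom \<Omega> B) L2ip (qform B)"

theorem multiplicity_of_spectral:
  assumes \<Omega>: "open \<Omega>" "bounded \<Omega>" "\<Omega> \<noteq> {}" and sp: "spectral_of \<Omega> B e l"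
  shows "multiplicity_of \<Omega> B \<mu> = enat (card {k. l k = \<mu>})"
proof -
  have ms: "\<Omega> \<in> sets lebesgue" using \<Omega>(1) by simp
  interpret compact_form_pair fun_scale "fdom \<Omega> B" L2ip "qform B" using \<Omega> by (rule compact_fdom)
  have sp': "spectral e l" using sp by (simp add: spectral_of_def)
  have eig: "u \<in> eigenspace \<Omega> B \<mu> \<longleftrightarrow> eigvec \<mu> (restrict_fun \<Omega> u)" for u using eigenspace_iff[OF \<Omega>] .
  show ?thesis
    unfolding multiplicity_of_def
  proof (rule antisym)
    show "Sup {enat k |k. \<exists>u. (\<forall>j<k. u j \<in> eigenspace \<Omega> B \<mu>) \<and> L2_independent \<Omega> k u} \<le> enat (card {k. l k = \<mu>})"
    proof (rule Sup_least)
      fix x assume "x \<in> {enat k |k. \<exists>u. (\<forall>j<k. u j \<in> eigenspace \<Omega> B \<mu>) \<and> L2_independent \<Omega> k u}"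
      then obtain k u where u: "x = enat k" "\<And>j. j < k \<Longrightarrow> eigvec \<mu> (restrict_fun \<Omega> (u j))" "L2_independent \<Omega> k u"
        using eig by blast
      have rL: "restrict_fun \<Omega> (u j) \<in> L2" if "j < k" for j
        using u(2)[OF that] fdom_L2 unfolding eigvec_def by blast
      have "ip.indep k (\<lambda>j. restrict_fun \<Omega> (u j))"
        using L2_independent_iff[OF ms rL] u(3) by simp
      then have "k \<le> card {k. l k = \<mu>}" by (intro multiplicity_upper[OF sp' u(2)])
      then show "x \<le> enat (card {k. l k = \<mu>})" using u(1) by simp
    qed
    obtain u where u: "\<And>j. j < card {k. l k = \<mu>} \<Longrightarrow> eigvec \<mu> (u j)" "ip.indep (card {k. l k = \<mu>}) u"
      using multiplicity_lower[OF sp', of \<mu>] by blast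
    have id: "restrict_fun \<Omega> (u j) = u j" "u j \<in> L2" if "j < card {k. l k = \<mu>}" for j
    proof -
      have "u j \<in> fdom \<Omega> B" using u(1)[OF that] unfolding eigvec_def by blast
      then show "restrict_fun \<Omega> (u j) = u j" "u j \<in> L2" by (rule restrict_id, rule fdom_L2)
    qed
    have "L2.indep (card {k. l k = \<mu>}) (\<lambda>j. restrict_fun \<Omega> (u j))"
    proof -
      have "lin_comb fun_scale (card {k. l k = \<mu>}) c (\<lambda>j. restrict_fun \<Omega> (u j)) = lin_comb fun_scale (card {k. l k = \<mu>}) c u" for c
        unfolding lin_comb_def using id by (intro sum.cong) auto
      then show ?thesis using u(2) by (simp add: L2.indep_def)
    qed
    then have "L2_independent \<Omega> (card {k. l k = \<mu>}) u"
      using id by (subst L2_independent_iff[OF ms]) auto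
    moreover have "\<forall>j<card {k. l k = \<mu>}. u j \<in> eigenspace \<Omega> B \<mu>" using u(1) id eig by simp
    ultimately show "enat (card {k. l k = \<mu>}) \<le> Sup {enat k |k. \<exists>u. (\<forall>j<k. u j \<in> eigenspace \<Omega> B \<mu>) \<and> L2_independent \<Omega> k u}"
      by (intro Sup_upper) blast
  qed
qed

text \<open>The spectral resolution provides an enumeration of the eigenvalues, and there is
  only one.\<close>

theorem magnetic_eigenvalue_spectral:
  assumes \<Omega>: "open \<Omega>" "bounded \<Omega>" "\<Omega> \<noteq> {}" and sp: "spectral_of \<Omega> B e l"
  shows "magnetic_eigenvalue n \<Omega> B = l (n - 1)"
proof -
  interpret compact_form_pair fun_scale "fdom \<Omega> B" L2ip "qform B" using \<Omega> by (rule compact_fdom)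
  have sp': "spectral e l" using sp by (simp add: spectral_of_def)
  have "finite {k. l k = \<mu>}" for \<mu> by (rule finite_subset[OF _ spectral_finite[OF sp', of \<mu>]]) auto
  then have en: "eigenvalue_enumeration \<Omega> B l"
    using sp' multiplicity_of_spectral[OF assms] by (simp add: eigenvalue_enumeration_def spectral_def)
  have "(THE l. eigenvalue_enumeration \<Omega> B l) = l"
  proof (rule the_equality)
    show "eigenvalue_enumeration \<Omega> B l" by (rule en)
  next
    fix l' assume en': "eigenvalue_enumeration \<Omega> B l'"
    have "card {k. l' k = \<mu>} = card {k. l k = \<mu>}" for \<mu>
      using en en' unfolding eigenvalue_enumeration_def by (metis enat.inject)
    then show "l' = l" using en en' by (intro enumeration_unique) (auto simp: eigenvalue_enumeration_def)
  qed
  then show ?thesis by (simp add: magnetic_eigenvalue_def)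
qed

lemma spectral_of_exists:
  assumes \<Omega>: "open \<Omega>" "bounded \<Omega>" "\<Omega> \<noteq> {}" shows "\<exists>e l. spectral_of \<Omega> B e l"
proof -
  interpret compact_form_pair fun_scale "fdom \<Omega> B" L2ip "qform B" using \<Omega> by (rule compact_fdom)
  show ?thesis unfolding spectral_of_def by (rule spectral_resolution)
qed

section \<open>The min-max principle\<close>

definition is_domain :: "(real^2) set \<Rightarrow> bool" where
  "is_domain \<Omega> \<longleftrightarrow> open \<Omega> \<and> bounded \<Omega> \<and> \<Omega> \<noteq> {}"

definition Rayleigh_le :: "(real^2) set \<Rightarrow> real \<Rightarrow> nat \<Rightarrow> real \<Rightarrow> (nat \<Rightarrow> real^2 \<Rightarrow> complex) \<Rightarrow> bool" where
  "Rayleigh_le \<Omega> B n \<mu> u \<longleftrightarrow> (\<forall>j<n. u j \<in> fdom \<Omega> B) \<and> L2.indep n u \<and>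
     (\<forall>c. Re (qform B (lin_comb fun_scale n c u) (lin_comb fun_scale n c u))
          \<le> \<mu> * Re (L2ip (lin_comb fun_scale n c u) (lin_comb fun_scale n c u)))"

lemma domain_pair: "is_domain \<Omega> \<Longrightarrow> compact_form_pair fun_scale (fdom \<Omega> B) L2ip (qform B)"
  unfolding is_domain_def by (blast intro: compact_fdom)

lemma domain_lebesgue: "is_domain \<Omega> \<Longrightarrow> \<Omega> \<in> sets lebesgue"
  by (simp add: is_domain_def)

lemma domain_spectral:
  assumes "is_domain \<Omega>"
  obtains e l where "spectral_of \<Omega> B e l" "\<And>n. magnetic_eigenvalue n \<Omega> B = l (n - 1)"
  using spectral_of_exists[of \<Omega> B] magnetic_eigenvalue_spectral[of \<Omega> B] assms unfolding is_domain_def by metis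

text \<open>The min-max principle. The span of the first n eigenfunctions gives one direction,
  the dimension count in \<open>minmax_lower\<close> the other.\<close>

lemma eigenvalue_le_iff:
  assumes \<Omega>: "is_domain \<Omega>" and n: "n \<ge> 1"
  shows "magnetic_eigenvalue n \<Omega> B \<le> \<mu> \<longleftrightarrow> (\<exists>u. Rayleigh_le \<Omega> B n \<mu> u)"
proof -
  interpret compact_form_pair fun_scale "fdom \<Omega> B" L2ip "qform B" using \<Omega> by (rule domain_pair)
  obtain e l where sp: "spectral e l" and l: "magnetic_eigenvalue n \<Omega> B = l (n - 1)"
    using domain_spectral[OF \<Omega>, of B] unfolding spectral_of_def by metis
  show ?thesis
  proof
    assume le: "magnetic_eigenvalue n \<Omega> B \<le> \<mu>"
    have "Re (qform B (lin_comb fun_scale n c e) (lin_comb fun_scale n c e))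
          \<le> \<mu> * Re (L2ip (lin_comb fun_scale n c e) (lin_comb fun_scale n c e))" for c
    proof -
      have "lin_comb fun_scale n c e \<in> fdom \<Omega> B" using spectral_D[OF sp] by (rule ip.lin_comb_in)
      then have "l (n - 1) * Re (L2ip (lin_comb fun_scale n c e) (lin_comb fun_scale n c e))
        \<le> \<mu> * Re (L2ip (lin_comb fun_scale n c e) (lin_comb fun_scale n c e))"
        using le l by (intro mult_right_mono ip.nonneg) auto
      then show ?thesis using spectral_span_upper[OF sp n, of c] by linarith
    qed
    then have "Rayleigh_le \<Omega> B n \<mu> e"
      unfolding Rayleigh_le_def using spectral_D[OF sp] spectral_indep[OF sp] by blast
    then show "\<exists>u. Rayleigh_le \<Omega> B n \<mu> u" by blast
  next
    assume "\<exists>u. Rayleigh_le \<Omega> B n \<mu> u"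
    then obtain u where "Rayleigh_le \<Omega> B n \<mu> u" by blast
    then show "magnetic_eigenvalue n \<Omega> B \<le> \<mu>"
      unfolding l Rayleigh_le_def by (intro minmax_lower[OF sp _ _ n]) auto
  qed
qed

lemma Rayleigh_le_mono: "Rayleigh_le \<Omega> B n \<mu> u \<Longrightarrow> \<Omega> \<subseteq> \<Omega>' \<Longrightarrow> Rayleigh_le \<Omega>' B n \<mu> u"
  unfolding Rayleigh_le_def using fdom_mono by blast

text \<open>Extension by zero embeds the smaller form domain into the larger one.\<close>

lemma eigenvalue_antimono:
  assumes "is_domain \<Omega>" "is_domain \<Omega>'" "\<Omega> \<subseteq> \<Omega>'" "n \<ge> 1"
  shows "magnetic_eigenvalue n \<Omega>' B \<le> magnetic_eigenvalue n \<Omega> B"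
  using eigenvalue_le_iff[OF assms(1,4)] eigenvalue_le_iff[OF assms(2,4)] Rayleigh_le_mono[OF _ assms(3)] by blast

section \<open>Scaling, translation and gauge\<close>

lemma lebesgue_affine:
  assumes "c \<noteq> 0"
  shows "lebesgue = density (distr lebesgue lebesgue (\<lambda>x::real^2. t + c *\<^sub>R x)) (\<lambda>_. ennreal (c\<^sup>2))"
    and "(\<lambda>x::real^2. t + c *\<^sub>R x) \<in> lebesgue \<rightarrow>\<^sub>M lebesgue"
proof -
  have e: "(\<Sum>j\<in>Basis. (c * (x \<bullet> j)) *\<^sub>R j) = c *\<^sub>R x" for x :: "real^2"
    unfolding scaleR_scaleR[symmetric] scaleR_sum_right[symmetric] euclidean_representation ..
  show "lebesgue = density (distr lebesgue lebesgue (\<lambda>x::real^2. t + c *\<^sub>R x)) (\<lambda>_. ennreal (c\<^sup>2))"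
    using lebesgue_affine_euclidean[of "\<lambda>_::real^2. c" t] assms by (simp add: e power2_eq_square flip: abs_mult)
  show "(\<lambda>x::real^2. t + c *\<^sub>R x) \<in> lebesgue \<rightarrow>\<^sub>M lebesgue"
    using lebesgue_affine_measurable[of "\<lambda>_::real^2. c" t] assms by (simp add: e)
qed

lemma lebesgue_affine_integral:
  fixes g :: "real^2 \<Rightarrow> 'b::{banach, second_countable_topology}"
  assumes [measurable]: "g \<in> borel_measurable lebesgue" and c: "c \<noteq> 0"
  shows "integral\<^sup>L lebesgue g = c\<^sup>2 *\<^sub>R integral\<^sup>L lebesgue (\<lambda>x. g (t + c *\<^sub>R x))"
    and "integrable lebesgue g \<Longrightarrow> integrable lebesgue (\<lambda>x. g (t + c *\<^sub>R x))"
proof -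
  note [measurable] = lebesgue_affine(2)[OF c]
  have "integral\<^sup>L lebesgue g = integral\<^sup>L (density (distr lebesgue lebesgue (\<lambda>x::real^2. t + c *\<^sub>R x)) (\<lambda>_. ennreal (c\<^sup>2))) g"
    using lebesgue_affine(1)[OF c] by metis
  also have "\<dots> = c\<^sup>2 *\<^sub>R integral\<^sup>L (distr lebesgue lebesgue (\<lambda>x::real^2. t + c *\<^sub>R x)) g"
    by (subst integral_density) auto
  also have "\<dots> = c\<^sup>2 *\<^sub>R integral\<^sup>L lebesgue (\<lambda>x. g (t + c *\<^sub>R x))"
    by (subst integral_distr) auto
  finally show "integral\<^sup>L lebesgue g = c\<^sup>2 *\<^sub>R integral\<^sup>L lebesgue (\<lambda>x. g (t + c *\<^sub>R x))" .
  assume "integrable lebesgue g"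
  then have "integrable (density (distr lebesgue lebesgue (\<lambda>x::real^2. t + c *\<^sub>R x)) (\<lambda>_. ennreal (c\<^sup>2))) g"
    using lebesgue_affine(1)[OF c] by metis
  then have "integrable (distr lebesgue lebesgue (\<lambda>x::real^2. t + c *\<^sub>R x)) (\<lambda>x. c\<^sup>2 *\<^sub>R g x)"
    by (subst (asm) integrable_density) auto
  then have "integrable (distr lebesgue lebesgue (\<lambda>x::real^2. t + c *\<^sub>R x)) (\<lambda>x. (1 / c\<^sup>2) *\<^sub>R (c\<^sup>2 *\<^sub>R g x))"
    by (rule integrable_scaleR_right)
  then have "integrable (distr lebesgue lebesgue (\<lambda>x::real^2. t + c *\<^sub>R x)) g" using c by simp
  then show "integrable lebesgue (\<lambda>x. g (t + c *\<^sub>R x))" by (subst (asm) integrable_distr_eq) auto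
qed

lemma lebesgue_affine_AE:
  assumes c: "c \<noteq> 0" and P: "AE x in lebesgue. P (x::real^2)"
  shows "AE x in lebesgue. P (t + c *\<^sub>R x)"
proof -
  have "AE x in density (distr lebesgue lebesgue (\<lambda>x::real^2. t + c *\<^sub>R x)) (\<lambda>_. ennreal (c\<^sup>2)). P x"
    using P lebesgue_affine(1)[OF c] by metis
  then have "AE x in distr lebesgue lebesgue (\<lambda>x::real^2. t + c *\<^sub>R x). P x"
    using c by (subst (asm) AE_density) auto
  then show ?thesis by (rule AE_distrD[OF lebesgue_affine(2)[OF c]])
qed

lemma affine_inverse:
  fixes a x :: "'a::real_vector"
  assumes "s > 0" shows "a + s *\<^sub>R (- (1 / s) *\<^sub>R a + (1 / s) *\<^sub>R x) = x"
  using assms unfolding scaleR_add_right scaleR_scaleR by simp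

text \<open>The function u transplanted from \<open>\<Omega>\<close> to \<open>a + s
  \<Omega>\<close>. Since \<open>A (a + s y) = A a + s A y\<close> for the vector potential A,
  the constant part A a is removed by a plane wave, and the factor s in front of A y rescales
  the field.\<close>

definition gauge_scale :: "real \<Rightarrow> real \<Rightarrow> real^2 \<Rightarrow> (real^2 \<Rightarrow> complex) \<Rightarrow> real^2 \<Rightarrow> complex" where
  "gauge_scale B s a u x = plane_wave (- vector_potential B a) x * u (- (1 / s) *\<^sub>R a + (1 / s) *\<^sub>R x)"

lemma gauge_scale_linear:
  "gauge_scale B s a (u - v) = gauge_scale B s a u - gauge_scale B s a v"
  "gauge_scale B s a (fun_scale c u) = fun_scale c (gauge_scale B s a u)"
  "gauge_scale B s a (lin_comb fun_scale n d w) = lin_comb fun_scale n d (\<lambda>j. gauge_scale B s a (w j))"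
  by (simp_all add: gauge_scale_def fun_eq_iff right_diff_distrib lin_comb_apply sum_distrib_left mult_ac)

lemma gauge_scale_L2:
  assumes s: "s > 0" and u: "u \<in> L2" shows "gauge_scale B s a u \<in> L2"
proof -
  have s': "1 / s \<noteq> 0" using s by simp
  note [measurable] = L2_measurable[OF u] lebesgue_affine(2)[OF s']
  have [measurable]: "plane_wave \<theta> \<in> borel_measurable lebesgue" for \<theta>
    by (intro continuous_measurable_lebesgue smooth_continuous smooth_plane_wave)
  have "gauge_scale B s a u \<in> borel_measurable lebesgue" unfolding gauge_scale_def[abs_def] by measurable
  moreover have "(\<lambda>x. (cmod (gauge_scale B s a u x))\<^sup>2) = (\<lambda>x. (\<lambda>x. (cmod (u x))\<^sup>2) (- (1 / s) *\<^sub>R a + (1 / s) *\<^sub>R x))"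
    by (simp add: gauge_scale_def norm_mult)
  moreover have "integrable lebesgue (\<lambda>x. (\<lambda>x. (cmod (u x))\<^sup>2) (- (1 / s) *\<^sub>R a + (1 / s) *\<^sub>R x))"
    by (rule lebesgue_affine_integral(2)[OF _ s' L2_integrable[OF u]]) measurable
  ultimately show ?thesis by (simp add: L2_iff)
qed

lemma gauge_scale_ip:
  assumes s: "s > 0" and u: "u \<in> L2" and v: "v \<in> L2"
  shows "L2ip (gauge_scale B s a u) (gauge_scale B s a v) = of_real (s\<^sup>2) * L2ip u v"
proof -
  have s': "1 / s \<noteq> 0" using s by simp
  note [measurable] = L2_measurable[OF u] L2_measurable[OF v]
  define g where "g = (\<lambda>x. u x * cnj (v x))"
  have [measurable]: "g \<in> borel_measurable lebesgue" unfolding g_def by measurable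
  have "gauge_scale B s a u x * cnj (gauge_scale B s a v x) = g (- (1 / s) *\<^sub>R a + (1 / s) *\<^sub>R x)" for x
  proof -
    have "plane_wave \<theta> x * cnj (plane_wave \<theta> x) = 1" for \<theta>
      by (simp flip: complex_norm_square of_real_power)
    then have one: "plane_wave \<theta> x * cnj (plane_wave \<theta> x) * z = z" for \<theta> z by simp
    have "p * y * (cnj p * z) = p * cnj p * (y * z)" for p y z :: complex by (simp add: mult_ac)
    then show ?thesis unfolding gauge_scale_def g_def complex_cnj_mult by (simp only: one)
  qed
  then have "L2ip (gauge_scale B s a u) (gauge_scale B s a v) = integral\<^sup>L lebesgue (\<lambda>x. g (- (1 / s) *\<^sub>R a + (1 / s) *\<^sub>R x))"
    by (simp add: L2ip_eq)
  moreover have "integral\<^sup>L lebesgue g = (1 / s)\<^sup>2 *\<^sub>R integral\<^sup>L lebesgue (\<lambda>x. g (- (1 / s) *\<^sub>R a + (1 / s) *\<^sub>R x))"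
    by (rule lebesgue_affine_integral(1)) (use s' in auto)
  ultimately show ?thesis using s by (simp add: L2ip_eq g_def scaleR_conv_of_real field_simps)
qed

lemma gauge_scale_norm:
  assumes s: "s > 0" and u: "u \<in> L2" shows "L2norm (gauge_scale B s a u) = s * L2norm u"
  using gauge_scale_ip[OF s u u, of B a] s by (simp add: form_norm_def real_sqrt_mult)

lemma vector_potential_affine:
  "vector_potential B (a + s *\<^sub>R x) = vector_potential B a + s *\<^sub>R vector_potential B x"
  by (simp add: vector_potential_def vec_eq_iff forall_2 vector_2 algebra_simps)

lemma vector_potential_scale: "vector_potential (r * B) x = r *\<^sub>R vector_potential B x"
  by (simp add: vector_potential_def)

lemma gauge_scale_test:
  assumes s: "s > 0" and u: "test_fun \<Omega> u"
  shows "test_fun (scaled_translate s a \<Omega>) (gauge_scale B s a u)"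
proof -
  obtain K where K: "compact K" "K \<subseteq> \<Omega>" "\<And>x. x \<notin> K \<Longrightarrow> u x = 0" using test_support[OF u] by metis
  have "smooth_fun (gauge_scale B s a u)"
    unfolding gauge_scale_def[abs_def] using u
    by (intro smooth_mult smooth_plane_wave smooth_affine test_smooth) auto
  moreover have "compact ((\<lambda>x. a + s *\<^sub>R x) ` K)" using K(1) by (intro compact_continuous_image continuous_intros)
  moreover have "gauge_scale B s a u x = 0" if "x \<notin> (\<lambda>x. a + s *\<^sub>R x) ` K" for x
  proof -
    have "- (1 / s) *\<^sub>R a + (1 / s) *\<^sub>R x \<notin> K"
    proof
      assume "- (1 / s) *\<^sub>R a + (1 / s) *\<^sub>R x \<in> K"
      then have "a + s *\<^sub>R (- (1 / s) *\<^sub>R a + (1 / s) *\<^sub>R x) \<in> (\<lambda>x. a + s *\<^sub>R x) ` K" by (rule imageI)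
      then show False using that by (simp only: affine_inverse[OF s])
    qed
    then show ?thesis using K(3) by (simp add: gauge_scale_def)
  qed
  ultimately show ?thesis
    unfolding test_fun_iff scaled_translate_def using K(2) by (intro conjI exI[of _ "(\<lambda>x. a + s *\<^sub>R x) ` K"]) auto
qed

lemma gauge_scale_gradient:
  assumes s: "s > 0" and u: "smooth_fun u"
  shows "magnetic_gradient B (gauge_scale B s a u) j = fun_scale (of_real (1 / s)) (gauge_scale B s a (magnetic_gradient (s\<^sup>2 * B) u j))"
proof
  fix x
  define y where "y = - (1 / s) *\<^sub>R a + (1 / s) *\<^sub>R x"
  define \<theta> where "\<theta> = - vector_potential B a"
  have x: "x = a + s *\<^sub>R y" unfolding y_def by (rule affine_inverse[OF s, symmetric])
  note aff = partial_affine[of u "- (1 / s) *\<^sub>R a" "1 / s" x, OF smooth_differentiable[OF u]]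
  have d: "partial j (gauge_scale B s a u) x =
      plane_wave \<theta> x * (of_real (1 / s) * partial j u y) + \<i> * of_real (\<theta> $ j) * plane_wave \<theta> x * u y"
    unfolding gauge_scale_def[abs_def] \<theta>_def[symmetric]
    using aff smooth_differentiable[OF smooth_plane_wave]
    by (subst partial_mult) (auto simp: y_def partial_plane_wave)
  have v: "complex_of_real (vector_potential B x $ j) = - of_real (\<theta> $ j) + of_real s * of_real (vector_potential B y $ j)"
    unfolding \<theta>_def by (subst x) (simp add: vector_potential_affine)
  have "magnetic_gradient B (gauge_scale B s a u) j x =
      plane_wave \<theta> x * (- \<i> * of_real (1 / s) * partial j u y + of_real s * of_real (vector_potential B y $ j) * u y)"
    unfolding magnetic_gradient_def gauge_scale_def[of B s a u x] \<theta>_def[symmetric] y_def[symmetric] d v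
    by (simp add: algebra_simps)
  also have "\<dots> = of_real (1 / s) * (plane_wave \<theta> x * (- \<i> * partial j u y + of_real (s\<^sup>2 * vector_potential B y $ j) * u y))"
    using s by (simp add: algebra_simps power2_eq_square)
  also have "\<dots> = fun_scale (of_real (1 / s)) (gauge_scale B s a (magnetic_gradient (s\<^sup>2 * B) u j)) x"
    by (simp add: gauge_scale_def magnetic_gradient_def vector_potential_scale \<theta>_def y_def)
  finally show "magnetic_gradient B (gauge_scale B s a u) j x =
    fun_scale (of_real (1 / s)) (gauge_scale B s a (magnetic_gradient (s\<^sup>2 * B) u j)) x" .
qed

lemma gauge_scale_mform:
  assumes s: "s > 0" and u: "test_fun \<Omega> u" and v: "test_fun \<Omega> v"
  shows "mform B (gauge_scale B s a u) (gauge_scale B s a v) = mform (s\<^sup>2 * B) u v"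
proof -
  let ?g = "\<lambda>u j. magnetic_gradient (s\<^sup>2 * B) u j"
  have L: "?g u j \<in> L2" "?g v j \<in> L2" for j using u v test_L2 test_magnetic_gradient by blast+
  have "mform B (gauge_scale B s a u) (gauge_scale B s a v) =
      (\<Sum>j\<in>UNIV. L2ip (magnetic_gradient B (gauge_scale B s a u) j) (magnetic_gradient B (gauge_scale B s a v) j))"
    by (rule mform_eq[OF gauge_scale_test[OF s u] gauge_scale_test[OF s v]])
  also have "\<dots> = (\<Sum>j\<in>UNIV. L2ip (?g u j) (?g v j))"
  proof (rule sum.cong[OF refl])
    fix j
    have "L2ip (magnetic_gradient B (gauge_scale B s a u) j) (magnetic_gradient B (gauge_scale B s a v) j)
        = of_real (1 / s) * (of_real (1 / s) * (of_real (s\<^sup>2) * L2ip (?g u j) (?g v j)))"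
      using L u v s by (simp add: gauge_scale_gradient test_smooth L2.scale_left L2.scale_right gauge_scale_L2 gauge_scale_ip)
    then show "L2ip (magnetic_gradient B (gauge_scale B s a u) j) (magnetic_gradient B (gauge_scale B s a v) j) = L2ip (?g u j) (?g v j)"
      using s by (simp add: power2_eq_square)
  qed
  also have "\<dots> = mform (s\<^sup>2 * B) u v" by (rule mform_eq[OF u v, symmetric])
  finally show ?thesis .
qed

lemma gauge_scale_approx:
  assumes s: "s > 0" and u: "u \<in> L2" and ap: "approx_by \<Omega> (s\<^sup>2 * B) t u"
  shows "approx_by (scaled_translate s a \<Omega>) B (\<lambda>k. gauge_scale B s a (t k)) (gauge_scale B s a u)"
proof -
  have t: "test_fun \<Omega> (t k)" for k using ap by (simp add: approx_by_def tests_def)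
  have "L2norm (gauge_scale B s a (t k) - gauge_scale B s a u) = s * L2norm (t k - u)" for k
    using s test_L2[OF t] u by (simp add: gauge_scale_norm flip: gauge_scale_linear(1))
  moreover have "(\<lambda>k. s * L2norm (t k - u)) \<longlonglongrightarrow> 0"
    using ap tendsto_mult_left[of "\<lambda>k. L2norm (t k - u)" 0 sequentially s] by (simp add: approx_by_def)
  moreover have "form_norm (mform B) (gauge_scale B s a (t k) - gauge_scale B s a (t l)) = form_norm (mform (s\<^sup>2 * B)) (t k - t l)" for k l
  proof -
    have "test_fun \<Omega> (t k - t l)" using test_diff[OF t t] by (simp add: fun_diff_def)
    then show ?thesis using gauge_scale_mform[OF s] by (simp add: form_norm_def flip: gauge_scale_linear(1))
  qed
  ultimately show ?thesis
    using ap gauge_scale_test[OF s t] by (simp add: approx_by_def tests_def form_Cauchy_def)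
qed

lemma gauge_scale_fdom:
  assumes s: "s > 0" and u: "u \<in> fdom \<Omega> (s\<^sup>2 * B)"
  shows "gauge_scale B s a u \<in> fdom (scaled_translate s a \<Omega>) B"
proof -
  obtain t where t: "approx_by \<Omega> (s\<^sup>2 * B) t u" using u by (auto simp: fdom_def)
  have uL: "u \<in> L2" using u by (rule fdom_L2)
  have "gauge_scale B s a u x = 0" if "x \<notin> scaled_translate s a \<Omega>" for x
  proof -
    have "- (1 / s) *\<^sub>R a + (1 / s) *\<^sub>R x \<notin> \<Omega>"
    proof
      assume "- (1 / s) *\<^sub>R a + (1 / s) *\<^sub>R x \<in> \<Omega>"
      then have "a + s *\<^sub>R (- (1 / s) *\<^sub>R a + (1 / s) *\<^sub>R x) \<in> scaled_translate s a \<Omega>" unfolding scaled_translate_def by (rule imageI)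
      then show False using that by (simp only: affine_inverse[OF s])
    qed
    then show ?thesis using fdom_outside[OF u] by (simp add: gauge_scale_def)
  qed
  then show ?thesis
    using gauge_scale_approx[OF s uL t] gauge_scale_L2[OF s uL] unfolding fdom_def L2_on_def by blast
qed

lemma gauge_scale_qform:
  assumes s: "s > 0" and u: "u \<in> fdom \<Omega> (s\<^sup>2 * B)" and v: "v \<in> fdom \<Omega> (s\<^sup>2 * B)"
  shows "qform B (gauge_scale B s a u) (gauge_scale B s a v) = qform (s\<^sup>2 * B) u v"
proof -
  obtain t r where t: "approx_by \<Omega> (s\<^sup>2 * B) t u" and r: "approx_by \<Omega> (s\<^sup>2 * B) r v" using u v by (auto simp: fdom_def)
  have uL: "u \<in> L2" "v \<in> L2" using u v fdom_L2 by auto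
  have "mform B (gauge_scale B s a (t k)) (gauge_scale B s a (r k)) = mform (s\<^sup>2 * B) (t k) (r k)" for k
    using t r by (intro gauge_scale_mform[OF s, of \<Omega>]) (auto simp: approx_by_def tests_def)
  then have "(\<lambda>k. mform (s\<^sup>2 * B) (t k) (r k)) \<longlonglongrightarrow> qform B (gauge_scale B s a u) (gauge_scale B s a v)"
    using qform_limit[OF gauge_scale_L2[OF s uL(1)] gauge_scale_L2[OF s uL(2)]
        gauge_scale_approx[OF s uL(1) t] gauge_scale_approx[OF s uL(2) r], of a a] by simp
  moreover have "(\<lambda>k. mform (s\<^sup>2 * B) (t k) (r k)) \<longlonglongrightarrow> qform (s\<^sup>2 * B) u v" by (rule qform_limit[OF uL t r])
  ultimately show ?thesis using LIMSEQ_unique by blast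
qed

lemma gauge_scale_Rayleigh:
  assumes s: "s > 0" and ms: "\<Omega> \<in> sets lebesgue" and R: "Rayleigh_le \<Omega> (s\<^sup>2 * B) n \<mu> u"
  shows "Rayleigh_le (scaled_translate s a \<Omega>) B n (\<mu> / s\<^sup>2) (\<lambda>j. gauge_scale B s a (u j))"
proof -
  interpret f: hermitian_form fun_scale "fdom \<Omega> (s\<^sup>2 * B)" L2ip using ms by (rule hermitian_L2_fdom)
  have u: "u j \<in> fdom \<Omega> (s\<^sup>2 * B)" if "j < n" for j using R that by (simp add: Rayleigh_le_def)
  have w: "lin_comb fun_scale n c u \<in> fdom \<Omega> (s\<^sup>2 * B)" for c using u by (rule f.lin_comb_in)
  have wL: "lin_comb fun_scale n c u \<in> L2" for c using w by (rule fdom_L2)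
  have "L2.indep n (\<lambda>j. gauge_scale B s a (u j))"
    using R s wL by (simp add: L2.indep_def Rayleigh_le_def gauge_scale_norm flip: gauge_scale_linear(3))
  moreover have "Re (qform B (lin_comb fun_scale n c (\<lambda>j. gauge_scale B s a (u j))) (lin_comb fun_scale n c (\<lambda>j. gauge_scale B s a (u j))))
      \<le> \<mu> / s\<^sup>2 * Re (L2ip (lin_comb fun_scale n c (\<lambda>j. gauge_scale B s a (u j))) (lin_comb fun_scale n c (\<lambda>j. gauge_scale B s a (u j))))" for c
  proof -
    have "Re (qform (s\<^sup>2 * B) (lin_comb fun_scale n c u) (lin_comb fun_scale n c u)) \<le> \<mu> * Re (L2ip (lin_comb fun_scale n c u) (lin_comb fun_scale n c u))"
      using R by (simp add: Rayleigh_le_def)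
    then show ?thesis
      using s by (simp add: gauge_scale_qform[OF s w w] gauge_scale_ip[OF s wL wL] flip: gauge_scale_linear(3))
  qed
  ultimately show ?thesis
    unfolding Rayleigh_le_def using gauge_scale_fdom[OF s u] by blast
qed

lemma scaled_translate_inverse:
  "s > 0 \<Longrightarrow> scaled_translate (1 / s) (- (1 / s) *\<^sub>R a) (scaled_translate s a \<Omega>) = \<Omega>"
  unfolding scaled_translate_def image_image by (simp add: scaleR_add_right)

lemma scaled_translate_domain:
  assumes "s > 0" "is_domain \<Omega>" shows "is_domain (scaled_translate s a \<Omega>)"
proof -
  have "open ((+) a ` ((*\<^sub>R) s ` \<Omega>))" using assms by (intro open_translation open_scaling) (auto simp: is_domain_def)
  moreover have "bounded ((+) a ` ((*\<^sub>R) s ` \<Omega>))" using assms by (intro bounded_translation bounded_scaling) (auto simp: is_domain_def)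
  moreover have "scaled_translate s a \<Omega> = (+) a ` ((*\<^sub>R) s ` \<Omega>)" by (simp add: scaled_translate_def image_image)
  ultimately show ?thesis using assms(2) by (simp add: is_domain_def)
qed

lemma scaled_translate_measure:
  assumes "s > 0" "\<Omega> \<in> sets lebesgue"
  shows "measure lebesgue (scaled_translate s a \<Omega>) = s\<^sup>2 * measure lebesgue \<Omega>"
proof -
  have "(\<lambda>x. s *\<^sub>R x + a) ` \<Omega> = scaled_translate s a \<Omega>"
    unfolding scaled_translate_def by (rule image_cong) (auto simp: add.commute)
  then show ?thesis using measure_lebesgue_affine[of s a \<Omega>] by simp
qed

text \<open>The transplantation maps trial spaces to trial spaces, and its inverse is a
  transplantation of the same kind.\<close>

theorem eigenvalue_scaling:
  assumes s: "s > 0" and \<Omega>: "is_domain \<Omega>" and n: "n \<ge> 1"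
  shows "magnetic_eigenvalue n (scaled_translate s a \<Omega>) B = magnetic_eigenvalue n \<Omega> (s\<^sup>2 * B) / s\<^sup>2"
proof (rule antisym)
  have ms: "\<Omega> \<in> sets lebesgue" using \<Omega> by (rule domain_lebesgue)
  show "magnetic_eigenvalue n (scaled_translate s a \<Omega>) B \<le> magnetic_eigenvalue n \<Omega> (s\<^sup>2 * B) / s\<^sup>2"
    using eigenvalue_le_iff[OF \<Omega> n, of "s\<^sup>2 * B" "magnetic_eigenvalue n \<Omega> (s\<^sup>2 * B)"]
      eigenvalue_le_iff[OF scaled_translate_domain[OF s \<Omega>] n] gauge_scale_Rayleigh[OF s ms] by blast
next
  let ?\<Omega>' = "scaled_translate s a \<Omega>" and ?s = "1 / s" and ?a = "- (1 / s) *\<^sub>R a"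
  have s': "?s > 0" using s by simp
  have \<Omega>': "is_domain ?\<Omega>'" by (rule scaled_translate_domain[OF s \<Omega>])
  have ms: "?\<Omega>' \<in> sets lebesgue" using \<Omega>' by (rule domain_lebesgue)
  have eq: "?s\<^sup>2 * (s\<^sup>2 * B) = B" using s by (simp add: power2_eq_square)
  obtain u where "Rayleigh_le ?\<Omega>' B n (magnetic_eigenvalue n ?\<Omega>' B) u"
    using eigenvalue_le_iff[OF \<Omega>' n, of B "magnetic_eigenvalue n ?\<Omega>' B"] by blast
  then have "Rayleigh_le ?\<Omega>' (?s\<^sup>2 * (s\<^sup>2 * B)) n (magnetic_eigenvalue n ?\<Omega>' B) u" by (simp only: eq)
  from gauge_scale_Rayleigh[OF s' ms this, of ?a]
  have "\<exists>v. Rayleigh_le \<Omega> (s\<^sup>2 * B) n (magnetic_eigenvalue n ?\<Omega>' B / ?s\<^sup>2) v"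
    unfolding scaled_translate_inverse[OF s] by blast
  then have "magnetic_eigenvalue n \<Omega> (s\<^sup>2 * B) \<le> magnetic_eigenvalue n ?\<Omega>' B / ?s\<^sup>2"
    using eigenvalue_le_iff[OF \<Omega> n] by blast
  then show "magnetic_eigenvalue n \<Omega> (s\<^sup>2 * B) / s\<^sup>2 \<le> magnetic_eigenvalue n ?\<Omega>' B"
    using s by (simp add: field_simps power_divide)
qed

section \<open>Disjoint unions of domains\<close>

lemma disjoint_supports_orthogonal:
  assumes S: "S \<inter> S' = {}" and u: "u \<in> fdom S B" and v: "v \<in> fdom S' B"
  shows "L2ip u v = 0" "qform B u v = 0"
proof -
  have "(\<lambda>x. u x * cnj (v x)) = (\<lambda>x. 0)"
  proof
    fix x show "u x * cnj (v x) = 0"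
      using S fdom_outside[OF u, of x] fdom_outside[OF v, of x] by (cases "x \<in> S") auto
  qed
  then show "L2ip u v = 0" unfolding L2ip_eq by simp
  obtain s t where s: "approx_by S B s u" and t: "approx_by S' B t v" using u v by (auto simp: fdom_def)
  have "mform B (s k) (t k) = 0" for k
  proof -
    have st: "test_fun S (s k)" "test_fun S' (t k)" using s t by (auto simp: approx_by_def tests_def)
    have "(\<lambda>x. \<Sum>j\<in>UNIV. magnetic_gradient B (s k) j x * cnj (magnetic_gradient B (t k) j x)) = (\<lambda>x. 0)"
    proof
      fix x
      have "magnetic_gradient B (s k) j x * cnj (magnetic_gradient B (t k) j x) = 0" for j
        using S test_zero_outside[OF test_magnetic_gradient[OF st(1)], of x B j]
          test_zero_outside[OF test_magnetic_gradient[OF st(2)], of x B j] by (cases "x \<in> S") auto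
      then show "(\<Sum>j\<in>UNIV. magnetic_gradient B (s k) j x * cnj (magnetic_gradient B (t k) j x)) = 0"
        by (intro sum.neutral) blast
    qed
    then show ?thesis unfolding magnetic_form_def by simp
  qed
  then have "(\<lambda>k. 0) \<longlonglongrightarrow> qform B u v"
    using qform_limit[OF fdom_L2[OF u] fdom_L2[OF v] s t] by simp
  then show "qform B u v = 0" by (simp add: LIMSEQ_const_iff)
qed

lemma restrict_fun_diff: "restrict_fun S (u - v) = restrict_fun S u - restrict_fun S v"
  by (auto simp: restrict_fun_def fun_eq_iff)

lemma restrict_form_norm_le:
  assumes S: "open S" "open S'" "S \<inter> S' = {}" and w: "test_fun (S \<union> S') w"
  shows "form_norm (mform B) (restrict_fun S w) \<le> form_norm (mform B) w"
proof -
  note rw = restrict_test[OF w S]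
  have L: "magnetic_gradient B w j \<in> L2" for j using test_L2[OF test_magnetic_gradient[OF w]] .
  have L': "magnetic_gradient B (restrict_fun S w) j \<in> L2" for j using test_L2[OF test_magnetic_gradient[OF rw(1)]] .
  have "Re (mform B (restrict_fun S w) (restrict_fun S w)) = (\<Sum>j\<in>UNIV. (L2norm (magnetic_gradient B (restrict_fun S w) j))\<^sup>2)"
    using L' by (simp add: mform_eq[OF rw(1) rw(1)] L2.form_norm_sq)
  also have "\<dots> \<le> (\<Sum>j\<in>UNIV. (L2norm (magnetic_gradient B w j))\<^sup>2)"
  proof (rule sum_mono)
    fix j
    have "cmod (magnetic_gradient B (restrict_fun S w) j x) \<le> cmod (magnetic_gradient B w j x)" for x
      unfolding rw(2) by (simp add: restrict_fun_def)
    then have "L2norm (magnetic_gradient B (restrict_fun S w) j) \<le> L2norm (magnetic_gradient B w j)"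
      by (rule L2norm_mono[OF L])
    then show "(L2norm (magnetic_gradient B (restrict_fun S w) j))\<^sup>2 \<le> (L2norm (magnetic_gradient B w j))\<^sup>2"
      using L2.form_norm_nonneg[OF L'] by (rule power_mono)
  qed
  also have "\<dots> = Re (mform B w w)"
    using L by (simp add: mform_eq[OF w w] L2.form_norm_sq)
  finally show ?thesis unfolding form_norm_def[of "mform B"] by (rule real_sqrt_le_mono)
qed

text \<open>Restricting to S decreases both norms of a test function on \<open>S \<union>
  S'\<close>, so it maps approximating sequences to approximating sequences.\<close>

lemma restrict_fdom:
  assumes S: "open S" "open S'" "S \<inter> S' = {}" and u: "u \<in> fdom (S \<union> S') B"
  shows "restrict_fun S u \<in> fdom S B"
proof -
  obtain s where s: "approx_by (S \<union> S') B s u" using u by (auto simp: fdom_def)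
  have t: "test_fun (S \<union> S') (s k)" for k using s by (simp add: approx_by_def tests_def)
  have uL: "u \<in> L2" using u by (rule fdom_L2)
  have rL: "restrict_fun S u \<in> L2" using uL S by (intro L2_restrict) auto
  have rt: "restrict_fun S (s k) \<in> tests S" for k using restrict_test(1)[OF t S] by (simp add: tests_def)
  have ap: "approx_by S B (\<lambda>k. restrict_fun S (s k)) (restrict_fun S u)"
    unfolding approx_by_def
  proof (intro conjI allI)
    show "restrict_fun S (s k) \<in> tests S" for k by (rule rt)
    have le: "L2norm (restrict_fun S (s k) - restrict_fun S u) \<le> L2norm (s k - u)" for k
      unfolding restrict_fun_diff[symmetric] using test_L2[OF t] uL by (intro L2norm_mono) (auto simp: restrict_fun_def)
    have nn: "0 \<le> L2norm (restrict_fun S (s k) - restrict_fun S u)" for k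
      using tests_L2[OF rt] rL by simp
    have lim: "(\<lambda>k. L2norm (s k - u)) \<longlonglongrightarrow> 0" using s by (simp add: approx_by_def)
    show "(\<lambda>k. L2norm (restrict_fun S (s k) - restrict_fun S u)) \<longlonglongrightarrow> 0"
      by (rule Lim_null_comparison[OF always_eventually lim]) (use le nn in simp)
    have "form_norm (mform B) (restrict_fun S (s k) - restrict_fun S (s l)) \<le> form_norm (mform B) (s k - s l)" for k l
      unfolding restrict_fun_diff[symmetric] using test_diff[OF t t]
      by (intro restrict_form_norm_le[OF S]) (simp add: fun_diff_def)
    then show "form_Cauchy (mform B) (\<lambda>k. restrict_fun S (s k))"
      using s unfolding approx_by_def form_Cauchy_def by (meson le_less_trans)
  qed
  have out: "restrict_fun S u x = 0" if "x \<notin> S" for x using that by (simp add: restrict_fun_def)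
  show ?thesis
    unfolding fdom_def L2_on_def mem_Collect_eq
    by (intro conjI allI impI exI) (rule rL, erule out, rule ap)
qed

lemma lin_comb_append:
  "lin_comb fun_scale (i + j) c (\<lambda>k. if k < i then e k else f (k - i)) =
   lin_comb fun_scale i c e + lin_comb fun_scale j (\<lambda>k. c (i + k)) f"
proof
  fix x
  have "(\<Sum>k<i + j. c k * (if k < i then e k else f (k - i)) x) =
      (\<Sum>k<i. c k * (if k < i then e k else f (k - i)) x) + (\<Sum>k<j. c (i + k) * (if i + k < i then e (i + k) else f (i + k - i)) x)"
    by (induction j) auto
  then show "lin_comb fun_scale (i + j) c (\<lambda>k. if k < i then e k else f (k - i)) x =
      (lin_comb fun_scale i c e + lin_comb fun_scale j (\<lambda>k. c (i + k)) f) x"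
    by (simp add: lin_comb_apply)
qed

lemma union_domain: "is_domain S \<Longrightarrow> is_domain S' \<Longrightarrow> is_domain (S \<union> S')"
  by (auto simp: is_domain_def)

text \<open>The two trial spaces have disjoint supports, so they are orthogonal for both forms
  and their sum is a trial space of dimension i + j.\<close>

theorem union_eigenvalue_le:
  assumes S: "is_domain S" "is_domain S'" "S \<inter> S' = {}" and ij: "i \<ge> 1" "j \<ge> 1"
  shows "magnetic_eigenvalue (i + j) (S \<union> S') B \<le> max (magnetic_eigenvalue i S B) (magnetic_eigenvalue j S' B)"
proof -
  let ?\<mu> = "max (magnetic_eigenvalue i S B) (magnetic_eigenvalue j S' B)"
  obtain e where e: "Rayleigh_le S B i ?\<mu> e" using eigenvalue_le_iff[OF S(1) ij(1), of B ?\<mu>] by auto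
  obtain f where f: "Rayleigh_le S' B j ?\<mu> f" using eigenvalue_le_iff[OF S(2) ij(2), of B ?\<mu>] by auto
  interpret s: hermitian_form fun_scale "fdom S B" L2ip using domain_lebesgue[OF S(1)] by (rule hermitian_L2_fdom)
  interpret s': hermitian_form fun_scale "fdom S' B" L2ip using domain_lebesgue[OF S(2)] by (rule hermitian_L2_fdom)
  interpret q: hermitian_form fun_scale "fdom (S \<union> S') B" "qform B"
    using domain_lebesgue[OF union_domain[OF S(1,2)]] by (rule hermitian_qform)
  define u where "u = (\<lambda>k. if k < i then e k else f (k - i))"
  have D: "lin_comb fun_scale i c e \<in> fdom S B" "lin_comb fun_scale j c f \<in> fdom S' B" for c
    using e f by (auto simp: Rayleigh_le_def intro!: s.lin_comb_in s'.lin_comb_in)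
  have DU: "lin_comb fun_scale i c e \<in> fdom (S \<union> S') B" "lin_comb fun_scale j c f \<in> fdom (S \<union> S') B" for c
    using D fdom_mono[of S "S \<union> S'" B] fdom_mono[of S' "S \<union> S'" B] by blast+
  have DL: "lin_comb fun_scale i c e \<in> L2" "lin_comb fun_scale j c f \<in> L2" for c using D fdom_L2 by blast+
  have orth: "L2ip (lin_comb fun_scale i c e) (lin_comb fun_scale j d f) = 0" "L2ip (lin_comb fun_scale j d f) (lin_comb fun_scale i c e) = 0"
    "qform B (lin_comb fun_scale i c e) (lin_comb fun_scale j d f) = 0" "qform B (lin_comb fun_scale j d f) (lin_comb fun_scale i c e) = 0" for c d
  proof -
    have S3': "S' \<inter> S = {}" using S(3) by blast
    show "L2ip (lin_comb fun_scale i c e) (lin_comb fun_scale j d f) = 0" "L2ip (lin_comb fun_scale j d f) (lin_comb fun_scale i c e) = 0"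
      "qform B (lin_comb fun_scale i c e) (lin_comb fun_scale j d f) = 0" "qform B (lin_comb fun_scale j d f) (lin_comb fun_scale i c e) = 0"
      by (rule disjoint_supports_orthogonal[OF S(3) D] disjoint_supports_orthogonal[OF S3' D(2) D(1)])+
  qed
  have split: "lin_comb fun_scale (i + j) c u = lin_comb fun_scale i c e + lin_comb fun_scale j (\<lambda>k. c (i + k)) f" for c
    unfolding u_def by (rule lin_comb_append)
  have ipU: "Re (L2ip (lin_comb fun_scale (i + j) c u) (lin_comb fun_scale (i + j) c u)) =
      (L2norm (lin_comb fun_scale i c e))\<^sup>2 + (L2norm (lin_comb fun_scale j (\<lambda>k. c (i + k)) f))\<^sup>2" for c
    unfolding split using DL by (simp add: L2.add_left L2.add_right orth L2.form_norm_sq)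
  have "Rayleigh_le (S \<union> S') B (i + j) ?\<mu> u"
    unfolding Rayleigh_le_def
  proof (intro conjI allI impI)
    fix k assume "k < i + j"
    then show "u k \<in> fdom (S \<union> S') B"
      using e f fdom_mono[of S "S \<union> S'" B] fdom_mono[of S' "S \<union> S'" B] unfolding u_def Rayleigh_le_def
      by (cases "k < i") (auto simp: subset_iff)
  next
    show "L2.indep (i + j) u"
      unfolding L2.indep_def
    proof (intro allI impI)
      fix c k assume 0: "L2norm (lin_comb fun_scale (i + j) c u) = 0" and k: "k < i + j"
      have "(L2norm (lin_comb fun_scale i c e))\<^sup>2 + (L2norm (lin_comb fun_scale j (\<lambda>k. c (i + k)) f))\<^sup>2 = 0"
        using 0 ipU[of c] by (simp add: form_norm_def)
      then have 00: "L2norm (lin_comb fun_scale i c e) = 0" "L2norm (lin_comb fun_scale j (\<lambda>k. c (i + k)) f) = 0"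
        by (simp_all add: add_nonneg_eq_0_iff)
      show "c k = 0"
      proof (cases "k < i")
        case True
        then show ?thesis using 00(1) e by (auto simp: Rayleigh_le_def L2.indep_def)
      next
        case False
        have "L2.indep j f" using f by (simp add: Rayleigh_le_def)
        then have "\<forall>k<j. c (i + k) = 0" using 00(2) unfolding L2.indep_def by blast
        moreover have "k - i < j" using False k by simp
        ultimately have "c (i + (k - i)) = 0" by blast
        then show ?thesis using False by simp
      qed
    qed
  next
    fix c
    have "Re (qform B (lin_comb fun_scale (i + j) c u) (lin_comb fun_scale (i + j) c u)) =
        Re (qform B (lin_comb fun_scale i c e) (lin_comb fun_scale i c e))
        + Re (qform B (lin_comb fun_scale j (\<lambda>k. c (i + k)) f) (lin_comb fun_scale j (\<lambda>k. c (i + k)) f))"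
      unfolding split using DU by (simp add: q.add_left q.add_right orth)
    also have "\<dots> \<le> ?\<mu> * (L2norm (lin_comb fun_scale i c e))\<^sup>2 + ?\<mu> * (L2norm (lin_comb fun_scale j (\<lambda>k. c (i + k)) f))\<^sup>2"
      unfolding L2.form_norm_sq[OF DL(1)] L2.form_norm_sq[OF DL(2)]
      using e f unfolding Rayleigh_le_def by (intro add_mono) blast+
    also have "\<dots> = ?\<mu> * Re (L2ip (lin_comb fun_scale (i + j) c u) (lin_comb fun_scale (i + j) c u))"
      unfolding ipU by (simp only: distrib_left)
    finally show "Re (qform B (lin_comb fun_scale (i + j) c u) (lin_comb fun_scale (i + j) c u))
      \<le> ?\<mu> * Re (L2ip (lin_comb fun_scale (i + j) c u) (lin_comb fun_scale (i + j) c u))" .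
  qed
  then show ?thesis using eigenvalue_le_iff[OF union_domain[OF S(1,2)]] ij by (metis le_add1 le_trans)
qed

lemma sublevel_initial_segment:
  fixes l :: "nat \<Rightarrow> real"
  assumes l: "mono l" and fin: "finite {k. l k \<le> \<mu>}"
  shows "l k \<le> \<mu> \<longleftrightarrow> k < card {k. l k \<le> \<mu>}"
proof
  assume k: "l k \<le> \<mu>"
  have "{..k} \<subseteq> {k. l k \<le> \<mu>}"
  proof
    fix j assume "j \<in> {..k}"
    then have "l j \<le> l k" using monoD[OF l] by simp
    then show "j \<in> {k. l k \<le> \<mu>}" using k by simp
  qed
  from card_mono[OF fin this] show "k < card {k. l k \<le> \<mu>}" by simp
next
  assume k: "k < card {k. l k \<le> \<mu>}"
  show "l k \<le> \<mu>"
  proof (rule ccontr)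
    assume n: "\<not> l k \<le> \<mu>"
    have "{k. l k \<le> \<mu>} \<subseteq> {..<k}"
    proof
      fix j assume "j \<in> {k. l k \<le> \<mu>}"
      then show "j \<in> {..<k}" using n monoD[OF l, of k j] by (cases "j < k") auto
    qed
    from card_mono[OF _ this] k show False by simp
  qed
qed

text \<open>Let i and j be the numbers of eigenvalues of S and S' up to the n-th eigenvalue
  \<open>\<mu>\<close> of the union. If i + j < n, some nonzero element of an n-dimensional
  trial space for \<open>\<mu>\<close> is orthogonal to the corresponding eigenfunctions of S
  and S'; the Rayleigh quotients of its two restrictions exceed \<open>\<mu>\<close>, a
  contradiction.\<close>

theorem union_eigenvalue_ge:
  assumes S: "is_domain S" "is_domain S'" "S \<inter> S' = {}" and n: "n \<ge> 1"
  obtains i where "i \<le> n" "i \<ge> 1 \<Longrightarrow> magnetic_eigenvalue i S B \<le> magnetic_eigenvalue n (S \<union> S') B"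
    "i < n \<Longrightarrow> magnetic_eigenvalue (n - i) S' B \<le> magnetic_eigenvalue n (S \<union> S') B"
proof -
  have U: "is_domain (S \<union> S')" using S(1,2) by (rule union_domain)
  have op: "open S" "open S'" using S by (auto simp: is_domain_def)
  interpret a: compact_form_pair fun_scale "fdom S B" L2ip "qform B" using S(1) by (rule domain_pair)
  interpret b: compact_form_pair fun_scale "fdom S' B" L2ip "qform B" using S(2) by (rule domain_pair)
  interpret u: compact_form_pair fun_scale "fdom (S \<union> S') B" L2ip "qform B" using U by (rule domain_pair)
  define \<mu> where "\<mu> = magnetic_eigenvalue n (S \<union> S') B"
  obtain e l where e: "a.spectral e l" "\<And>n. magnetic_eigenvalue n S B = l (n - 1)"
    using domain_spectral[OF S(1), of B] unfolding spectral_of_def by metis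
  obtain f m where f: "b.spectral f m" "\<And>n. magnetic_eigenvalue n S' B = m (n - 1)"
    using domain_spectral[OF S(2), of B] unfolding spectral_of_def by metis
  obtain g where g: "Rayleigh_le (S \<union> S') B n \<mu> g" using eigenvalue_le_iff[OF U n] \<mu>_def by blast
  \<comment> \<open>the numbers of eigenvalues of S and of S' up to \<open>\<mu>\<close>; both
    sublevel sets are initial segments\<close>
  define i where "i = card {k. l k \<le> \<mu>}"
  define j where "j = card {k. m k \<le> \<mu>}"
  have i: "l k \<le> \<mu> \<longleftrightarrow> k < i" for k
    unfolding i_def using e(1) a.spectral_finite[OF e(1)] by (intro sublevel_initial_segment) (auto simp: a.spectral_def)
  have j: "m k \<le> \<mu> \<longleftrightarrow> k < j" for k
    unfolding j_def using f(1) b.spectral_finite[OF f(1)] by (intro sublevel_initial_segment) (auto simp: b.spectral_def)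
  have "n \<le> i + j"
  proof (rule ccontr)
    assume "\<not> n \<le> i + j"
    then have less: "i + j < n" by simp
    define p where "p = (\<lambda>k. if k < i then e k else f (k - i))"
    have eL: "e k \<in> L2" and fL: "f k \<in> L2" for k
      using fdom_L2[OF a.spectral_D[OF e(1)]] fdom_L2[OF b.spectral_D[OF f(1)]] by auto
    then have pL: "p k \<in> L2" for k by (simp add: p_def)
    have gU: "g k \<in> fdom (S \<union> S') B" if "k < n" for k using g that by (simp add: Rayleigh_le_def)
    have gL: "g k \<in> L2" if "k < n" for k using gU[OF that] by (rule fdom_L2)
    obtain c where c: "lin_comb fun_scale n c g \<in> L2.perp p (i + j)" "L2norm (lin_comb fun_scale n c g) > 0"
      using L2.indep_imp_perp_vector[of n g "i + j" p, OF gL _ less pL] g unfolding Rayleigh_le_def by metis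
    define w where "w = lin_comb fun_scale n c g"
    have wU: "w \<in> fdom (S \<union> S') B" unfolding w_def using gU by (rule u.ip.lin_comb_in)
    have wL: "w \<in> L2" using wU by (rule fdom_L2)
    have wp: "L2ip w (p k) = 0" if "k < i + j" for k using c(1) that unfolding L2.perp_def w_def by blast
    define w1 where "w1 = restrict_fun S w"
    define w2 where "w2 = restrict_fun S' w"
    have w1: "w1 \<in> fdom S B" unfolding w1_def using restrict_fdom[OF op S(3) wU] .
    have w2: "w2 \<in> fdom S' B"
      unfolding w2_def using restrict_fdom[OF op(2,1), of w B] S(3) wU by (simp add: Un_commute Int_commute)
    have L: "w1 \<in> L2" "w2 \<in> L2" using w1 w2 fdom_L2 by auto
    have wsum: "w = w1 + w2"
      using fdom_outside[OF wU] S(3) by (auto simp: w1_def w2_def restrict_fun_def fun_eq_iff)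
    have S3': "S' \<inter> S = {}" using S(3) by blast
    have "L2ip w1 (e k) = 0" if "k < i" for k
    proof -
      have "L2ip w (e k) = 0" using wp[of k] that by (simp add: p_def)
      moreover have "L2ip w2 (e k) = 0" by (rule disjoint_supports_orthogonal(1)[OF S3' w2 a.spectral_D[OF e(1)]])
      ultimately show ?thesis using L eL by (simp add: wsum L2.add_left)
    qed
    then have "w1 \<in> a.ip.perp e i" using w1 by (simp add: a.ip.perp_def)
    then have low1: "l i * Re (L2ip w1 w1) \<le> Re (qform B w1 w1)" by (rule a.spectral_low[OF e(1)])
    have "L2ip w2 (f k) = 0" if "k < j" for k
    proof -
      have "p (i + k) = f k" by (simp add: p_def)
      then have "L2ip w (f k) = 0" using wp[of "i + k"] that by simp
      moreover have "L2ip w1 (f k) = 0" by (rule disjoint_supports_orthogonal(1)[OF S(3) w1 b.spectral_D[OF f(1)]])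
      ultimately show ?thesis using L fL by (simp add: wsum L2.add_left)
    qed
    then have "w2 \<in> b.ip.perp f j" using w2 by (simp add: b.ip.perp_def)
    then have low2: "m j * Re (L2ip w2 w2) \<le> Re (qform B w2 w2)" by (rule b.spectral_low[OF f(1)])
    have orth: "L2ip w1 w2 = 0" "L2ip w2 w1 = 0" "qform B w1 w2 = 0" "qform B w2 w1 = 0"
      using disjoint_supports_orthogonal[OF S(3) w1 w2] disjoint_supports_orthogonal[OF S3' w2 w1] by auto
    have wU12: "w1 \<in> fdom (S \<union> S') B" "w2 \<in> fdom (S \<union> S') B"
      using w1 w2 fdom_mono[of S "S \<union> S'" B] fdom_mono[of S' "S \<union> S'" B] by blast+
    have ipw: "Re (L2ip w w) = Re (L2ip w1 w1) + Re (L2ip w2 w2)"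
      unfolding wsum using L by (simp add: L2.add_left L2.add_right orth)
    have qw: "Re (qform B w w) = Re (qform B w1 w1) + Re (qform B w2 w2)"
      unfolding wsum using wU12 by (simp add: u.q.add_left u.q.add_right orth)
    have le: "Re (qform B w w) \<le> \<mu> * Re (L2ip w w)" using g unfolding Rayleigh_le_def w_def by blast
    have gt: "l i > \<mu>" "m j > \<mu>" using i[of i] j[of j] by auto
    have nn: "Re (L2ip w1 w1) \<ge> 0" "Re (L2ip w2 w2) \<ge> 0" using L2.nonneg L by auto
    have "(l i - \<mu>) * Re (L2ip w1 w1) + (m j - \<mu>) * Re (L2ip w2 w2) \<le> 0"
      using low1 low2 le unfolding ipw qw by (simp add: algebra_simps)
    moreover have "(l i - \<mu>) * Re (L2ip w1 w1) \<ge> 0" "(m j - \<mu>) * Re (L2ip w2 w2) \<ge> 0"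
      using gt nn by (auto intro!: mult_nonneg_nonneg)
    ultimately have "(l i - \<mu>) * Re (L2ip w1 w1) = 0" "(m j - \<mu>) * Re (L2ip w2 w2) = 0" by linarith+
    then have "Re (L2ip w w) = 0" using gt ipw by simp
    then show False using c(2) unfolding w_def[symmetric] form_norm_def by simp
  qed
  then have "n - min i n \<le> j" by simp
  then have "min i n \<le> n" "min i n \<ge> 1 \<Longrightarrow> magnetic_eigenvalue (min i n) S B \<le> \<mu>"
    "min i n < n \<Longrightarrow> magnetic_eigenvalue (n - min i n) S' B \<le> \<mu>"
    unfolding e(2) f(2) i j by auto
  then show ?thesis using that unfolding \<mu>_def by blast
qed

section \<open>Slightly larger domains with smaller eigenvalues\<close>

definition vanishes_right :: "(real^2 \<Rightarrow> complex) \<Rightarrow> real \<Rightarrow> bool" where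
  "vanishes_right u t \<longleftrightarrow> (AE x in lebesgue. x $ 1 > t \<longrightarrow> u x = 0)"

text \<open>The supremum of the first coordinate on the essential support. Only for functions
  satisfying \<open>localized\<close> is the infimum taken over a nonempty set that is bounded
  below.\<close>

definition right_edge :: "(real^2 \<Rightarrow> complex) \<Rightarrow> real" where
  "right_edge u = Inf {t. vanishes_right u t}"

definition localized :: "(real^2 \<Rightarrow> complex) \<Rightarrow> bool" where
  "localized u \<longleftrightarrow> u \<in> L2 \<and> L2norm u > 0 \<and> bounded {x. u x \<noteq> 0}"

lemma vanishes_right_mono: "vanishes_right u s \<Longrightarrow> s \<le> t \<Longrightarrow> vanishes_right u t"
  unfolding vanishes_right_def by (erule eventually_mono) auto

lemma localized_edges:
  assumes "localized u"
  shows "{t. vanishes_right u t} \<noteq> {}" "bdd_below {t. vanishes_right u t}"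
proof -
  obtain R where R: "\<And>x. u x \<noteq> 0 \<Longrightarrow> norm x \<le> R" using assms by (auto simp: localized_def bounded_iff)
  have R1: "\<bar>x $ 1\<bar> \<le> R" if "u x \<noteq> 0" for x using R[OF that] component_le_norm_cart[of x 1] by linarith
  have "vanishes_right u R" unfolding vanishes_right_def using R1 by (intro AE_I2) fastforce
  then show "{t. vanishes_right u t} \<noteq> {}" by blast
  have "- R \<le> t" if t: "vanishes_right u t" for t
  proof (rule ccontr)
    assume "\<not> - R \<le> t"
    then have "AE x in lebesgue. u x = 0"
      using t R1 unfolding vanishes_right_def by (elim eventually_mono) fastforce
    then show False using assms L2norm_zero_iff[of u] by (simp add: localized_def)
  qed
  then show "bdd_below {t. vanishes_right u t}" by (intro bdd_belowI[of _ "- R"]) simp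
qed

lemma right_edge_less: "localized u \<Longrightarrow> right_edge u < t \<Longrightarrow> vanishes_right u t"
  unfolding right_edge_def using cInf_lessD[OF localized_edges(1)] vanishes_right_mono by (metis less_imp_le mem_Collect_eq)

lemma right_edge_le: "localized u \<Longrightarrow> vanishes_right u t \<Longrightarrow> right_edge u \<le> t"
  unfolding right_edge_def using localized_edges(2) by (intro cInf_lower) auto

text \<open>In a nontrivial combination, the summand with the largest right edge is alone on a
  strip to the left of that edge, so the combination cannot vanish there.\<close>

lemma distinct_edges_indep:
  assumes u: "\<And>j. j < n \<Longrightarrow> localized (u j)" and inj: "inj_on (\<lambda>j. right_edge (u j)) {..<n}"
  shows "L2.indep n u"
  unfolding L2.indep_def
proof (rule ccontr)
  assume "\<not> (\<forall>c. L2norm (lin_comb fun_scale n c u) = 0 \<longrightarrow> (\<forall>j<n. c j = 0))"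
  then obtain c j0 where c: "L2norm (lin_comb fun_scale n c u) = 0" "j0 < n" "c j0 \<noteq> 0" by blast
  have uL: "u j \<in> L2" if "j < n" for j using u[OF that] by (simp add: localized_def)
  define J where "J = {j. j < n \<and> c j \<noteq> 0}"
  have J: "finite J" "J \<noteq> {}" using c by (auto simp: J_def)
  define E where "E = (\<lambda>j. right_edge (u j))"
  have "Max (E ` J) \<in> E ` J" using J by (intro Max_in) auto
  then obtain m where m: "m \<in> J" "E m = Max (E ` J)" by auto
  have less: "E j < E m" if "j \<in> J - {m}" for j
  proof -
    have "E j \<le> E m" using that J m(2) by simp
    moreover have "E j \<noteq> E m" using that m(1) inj unfolding inj_on_def J_def E_def by auto
    ultimately show ?thesis by simp
  qed
  have "Max (insert (E m - 1) (E ` (J - {m}))) < E m" using less J by simp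
  then obtain t where t: "Max (insert (E m - 1) (E ` (J - {m}))) < t" "t < E m" using dense by blast
  have tj: "E j < t" if "j \<in> J - {m}" for j using t(1) that J by simp
  have "AE x in lebesgue. lin_comb fun_scale n c u x = 0"
    using c(1) uL L2.lin_comb_in[of n u c] by (subst (asm) L2norm_zero_iff) auto
  moreover have "AE x in lebesgue. \<forall>j\<in>J - {m}. x $ 1 > t \<longrightarrow> u j x = 0"
  proof (rule AE_finite_allI)
    show "finite (J - {m})" using J by simp
    fix j assume j: "j \<in> J - {m}"
    then have "localized (u j)" using u by (simp add: J_def)
    then have "vanishes_right (u j) t" using tj[OF j] by (intro right_edge_less) (auto simp: E_def)
    then show "AE x in lebesgue. x $ 1 > t \<longrightarrow> u j x = 0" by (simp add: vanishes_right_def)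
  qed
  ultimately have "AE x in lebesgue. x $ 1 > t \<longrightarrow> u m x = 0"
  proof eventually_elim
    case (elim x)
    show ?case
    proof
      assume "x $ 1 > t"
      then have "c j * u j x = 0" if "j \<in> {..<n} - {m}" for j using elim(2) that by (auto simp: J_def)
      then have "(\<Sum>j<n. c j * u j x) = c m * u m x"
        using m(1) sum.neutral[of "{..<n} - {m}" "\<lambda>j. c j * u j x"] by (subst sum.remove[of _ m]) (simp_all add: J_def)
      then show "u m x = 0" using elim(1) m(1) by (simp add: lin_comb_apply J_def)
    qed
  qed
  then have "right_edge (u m) \<le> t" using m(1) u by (intro right_edge_le) (auto simp: vanishes_right_def J_def)
  then show False using t(2) by (simp add: E_def)
qed

text \<open>More than n distinct edges would give more than n independent vectors in a space
  spanned by n vectors.\<close>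

lemma finitely_many_edges:
  assumes u: "\<And>j. j < n \<Longrightarrow> u j \<in> L2" and loc: "\<And>k. localized (lin_comb fun_scale n (c k) u)"
  shows "finite (range (\<lambda>k::nat. right_edge (lin_comb fun_scale n (c k) u)))"
proof (rule ccontr)
  let ?h = "\<lambda>k. right_edge (lin_comb fun_scale n (c k) u)"
  assume "infinite (range ?h)"
  then obtain H where H: "finite H" "card H = Suc n" "H \<subseteq> range ?h" using infinite_arbitrarily_large by blast
  then obtain f where f: "bij_betw f {..<Suc n} H" using ex_bij_betw_nat_finite[OF H(1)] by (auto simp: atLeast0LessThan)
  have "\<exists>k. ?h k = f j" if "j < Suc n" for j
  proof -
    have "f j \<in> range ?h" using f that H(3) unfolding bij_betw_def by auto
    then obtain k where "f j = ?h k" by (rule rangeE)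
    then show ?thesis by metis
  qed
  then obtain k where k: "\<And>j. j < Suc n \<Longrightarrow> ?h (k j) = f j" by metis
  have "inj_on (\<lambda>j. right_edge (lin_comb fun_scale n (c (k j)) u)) {..<Suc n}"
    using f k unfolding bij_betw_def inj_on_def by auto
  then have ind: "L2.indep (Suc n) (\<lambda>j. lin_comb fun_scale n (c (k j)) u)"
    using loc by (intro distinct_edges_indep) auto
  obtain d where d: "\<exists>j\<in>{..<Suc n}. d j \<noteq> 0" "\<And>i. i < n \<Longrightarrow> (\<Sum>j\<in>{..<Suc n}. c (k j) i * d j) = 0"
    using homogeneous_system_nontrivial[of "{..<Suc n}" n "\<lambda>i j. c (k j) i"] by auto
  have "lin_comb fun_scale (Suc n) d (\<lambda>j. lin_comb fun_scale n (c (k j)) u) = 0"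
  proof
    fix x
    have "lin_comb fun_scale (Suc n) d (\<lambda>j. lin_comb fun_scale n (c (k j)) u) x = (\<Sum>j\<in>{..<Suc n}. \<Sum>i<n. d j * (c (k j) i * u i x))"
      by (simp only: lin_comb_apply sum_distrib_left)
    also have "\<dots> = (\<Sum>i<n. \<Sum>j\<in>{..<Suc n}. d j * (c (k j) i * u i x))" by (rule sum.swap)
    also have "\<dots> = (\<Sum>i<n. (\<Sum>j\<in>{..<Suc n}. c (k j) i * d j) * u i x)"
      unfolding sum_distrib_right by (intro sum.cong refl) (simp add: mult_ac)
    also have "\<dots> = 0" using d(2) by (intro sum.neutral) (auto simp del: sum.lessThan_Suc)
    finally show "lin_comb fun_scale (Suc n) d (\<lambda>j. lin_comb fun_scale n (c (k j)) u) x = 0 x" by simp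
  qed
  then have "L2norm (lin_comb fun_scale (Suc n) d (\<lambda>j. lin_comb fun_scale n (c (k j)) u)) = 0" by simp
  then show False using ind d(1) unfolding L2.indep_def by blast
qed

lemma right_edge_translate:
  assumes v: "localized v"
  shows "localized (gauge_scale B 1 (r *\<^sub>R axis 1 1) v)"
    and "right_edge (gauge_scale B 1 (r *\<^sub>R axis 1 1) v) = right_edge v + r"
proof -
  let ?a = "r *\<^sub>R axis 1 1 :: real^2" and ?T = "gauge_scale B 1 (r *\<^sub>R axis 1 1)"
  have T0: "?T v x = 0 \<longleftrightarrow> v (- ?a + x) = 0" for x by (simp add: gauge_scale_def)
  have "{x. ?T v x \<noteq> 0} \<subseteq> (+) ?a ` {x. v x \<noteq> 0}"
    unfolding T0 by (auto intro: image_eqI[of _ _ "- ?a + _"])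
  then have "bounded {x. ?T v x \<noteq> 0}"
    using v bounded_translation[of "{x. v x \<noteq> 0}" ?a] bounded_subset by (auto simp: localized_def)
  then show "localized (?T v)"
    using v gauge_scale_L2[of 1 v B ?a] gauge_scale_norm[of 1 v B ?a] by (simp add: localized_def)
  have "vanishes_right (?T v) (t + r) \<longleftrightarrow> vanishes_right v t" for t
  proof
    assume "vanishes_right (?T v) (t + r)"
    then have "AE x in lebesgue. (x $ 1 > t + r \<longrightarrow> v (- ?a + x) = 0)" unfolding vanishes_right_def T0 .
    from lebesgue_affine_AE[OF _ this, of 1 ?a] show "vanishes_right v t"
      unfolding vanishes_right_def by (simp add: axis_def add.commute)
  next
    assume "vanishes_right v t"
    then have "AE x in lebesgue. (x $ 1 > t \<longrightarrow> v x = 0)" unfolding vanishes_right_def .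
    from lebesgue_affine_AE[OF _ this, of 1 "- ?a"] show "vanishes_right (?T v) (t + r)"
      unfolding vanishes_right_def T0 by (simp add: axis_def less_diff_eq algebra_simps)
  qed
  then have *: "vanishes_right (?T v) t \<longleftrightarrow> vanishes_right v (t - r)" for t by (metis diff_add_cancel)
  have "{t. vanishes_right (?T v) t} = (\<lambda>t. t + r) ` {t. vanishes_right v t}"
  proof (intro set_eqI iffI)
    fix t assume "t \<in> {t. vanishes_right (?T v) t}"
    then show "t \<in> (\<lambda>t. t + r) ` {t. vanishes_right v t}"
      using * by (intro image_eqI[of t _ "t - r"]) simp_all
  next
    fix t assume "t \<in> (\<lambda>t. t + r) ` {t. vanishes_right v t}"
    then obtain s where "vanishes_right v s" "t = s + r" by blast
    then show "t \<in> {t. vanishes_right (?T v) t}" using * by simp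
  qed
  then have "right_edge (?T v) = Inf ((\<lambda>t. t + r) ` {t. vanishes_right v t})" by (simp add: right_edge_def)
  also have "\<dots> = right_edge v + r"
  proof (rule cInf_eq_non_empty)
    show "(\<lambda>t. t + r) ` {t. vanishes_right v t} \<noteq> {}" using localized_edges(1)[OF v] by simp
    show "right_edge v + r \<le> x" if "x \<in> (\<lambda>t. t + r) ` {t. vanishes_right v t}" for x
      using that right_edge_le[OF v] by auto
    show "y \<le> right_edge v + r" if y: "\<And>x. x \<in> (\<lambda>t. t + r) ` {t. vanishes_right v t} \<Longrightarrow> y \<le> x" for y
    proof -
      have "y - r \<le> Inf {t. vanishes_right v t}"
        using localized_edges(1)[OF v] by (rule cInf_greatest) (use y in fastforce)
      then show ?thesis by (simp add: right_edge_def)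
    qed
  qed
  finally show "right_edge (?T v) = right_edge v + r" .
qed

text \<open>Inner regularity: up to a small measure \<open>\<Omega>\<close> is a compact set K,
  and small translates of K stay inside \<open>\<Omega>\<close>.\<close>

lemma small_translation:
  assumes \<Omega>: "is_domain \<Omega>" and \<epsilon>: "\<epsilon> > 0"
  obtains \<delta> where "\<delta> > 0" "\<And>v. norm v < \<delta> \<Longrightarrow> emeasure lebesgue ((+) v ` \<Omega> - \<Omega>) \<le> ennreal \<epsilon>"
proof -
  obtain K where K: "closed K" "K \<subseteq> \<Omega>" "emeasure lebesgue (\<Omega> - K) < ennreal \<epsilon>"
    using sets_lebesgue_inner_closed[OF domain_lebesgue[OF \<Omega>] \<epsilon>] by metis
  have "compact K" using K(1,2) \<Omega> bounded_subset by (auto simp: is_domain_def compact_eq_bounded_closed)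
  then obtain \<delta> where \<delta>: "\<delta> > 0" "(\<Union>x\<in>K. ball x \<delta>) \<subseteq> \<Omega>"
    using compact_subset_open_imp_ball_epsilon_subset[of K \<Omega>] K(2) \<Omega> by (auto simp: is_domain_def)
  have "emeasure lebesgue ((+) v ` \<Omega> - \<Omega>) \<le> ennreal \<epsilon>" if v: "norm v < \<delta>" for v
  proof -
    have sub: "(+) v ` \<Omega> - \<Omega> \<subseteq> (+) v ` (\<Omega> - K)"
    proof
      fix x assume x: "x \<in> (+) v ` \<Omega> - \<Omega>"
      then obtain y where y: "y \<in> \<Omega>" "x = v + y" by blast
      have "y \<notin> K"
      proof
        assume "y \<in> K"
        moreover have "x \<in> ball y \<delta>" using y(2) v by (simp add: dist_norm)
        ultimately show False using \<delta>(2) x by blast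
      qed
      then show "x \<in> (+) v ` (\<Omega> - K)" using y by blast
    qed
    have ms: "\<Omega> - K \<in> sets lebesgue" using K(1) domain_lebesgue[OF \<Omega>] by auto
    have im: "(\<lambda>x. 1 *\<^sub>R x + v) ` (\<Omega> - K) = (+) v ` (\<Omega> - K)" by (rule image_cong) (auto simp: add.commute)
    have "emeasure lebesgue ((+) v ` (\<Omega> - K)) = emeasure lebesgue (\<Omega> - K)"
      using emeasure_lebesgue_affine[of 1 v "\<Omega> - K"] unfolding im by simp
    moreover have "(+) v ` (\<Omega> - K) \<in> sets lebesgue" using ms by (rule lebesgue_sets_translation)
    ultimately have "emeasure lebesgue ((+) v ` \<Omega> - \<Omega>) \<le> emeasure lebesgue (\<Omega> - K)"
      using emeasure_mono[OF sub] by metis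
    then show ?thesis using K(3) by simp
  qed
  then show ?thesis using that \<delta>(1) by blast
qed

lemma many_translates:
  assumes \<Omega>: "is_domain \<Omega>" and \<epsilon>: "\<epsilon> > 0"
  obtains r where "inj (r :: nat \<Rightarrow> real)" "is_domain (\<Union>k. (+) (r k *\<^sub>R axis 1 1) ` \<Omega>)"
    "measure lebesgue (\<Union>k. (+) (r k *\<^sub>R axis 1 1) ` \<Omega>) < measure lebesgue \<Omega> + \<epsilon>"
proof -
  have "\<exists>\<delta>>0. \<forall>v. norm v < \<delta> \<longrightarrow> emeasure lebesgue ((+) v ` \<Omega> - \<Omega>) \<le> ennreal (\<epsilon> / 4 * (1/2)^k)" for k
    using small_translation[OF \<Omega>, of "\<epsilon> / 4 * (1/2)^k"] \<epsilon> by (metis divide_pos_pos mult_pos_pos zero_less_numeral zero_less_one zero_less_power)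
  then obtain \<delta> where \<delta>: "\<And>k. \<delta> k > 0"
    "\<And>k v. norm v < \<delta> k \<Longrightarrow> emeasure lebesgue ((+) v ` \<Omega> - \<Omega>) \<le> ennreal (\<epsilon> / 4 * (1/2)^k)" by metis
  \<comment> \<open>decreasing, hence injective, and \<open>r k < \<delta> k\<close>\<close>
  define r where "r = rec_nat (min 1 (\<delta> 0) / 2) (\<lambda>k r. min r (\<delta> (Suc k)) / 2)"
  have r0: "r 0 = min 1 (\<delta> 0) / 2" and rS: "r (Suc k) = min (r k) (\<delta> (Suc k)) / 2" for k by (simp_all add: r_def)
  have rpos: "r k > 0" for k
  proof (induction k)
    case 0 then show ?case using \<delta>(1)[of 0] by (simp add: r0)
  next
    case (Suc k) then show ?case using \<delta>(1)[of "Suc k"] by (simp add: rS)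
  qed
  have "r (Suc k) < r k" for k using rpos[of k] by (simp add: rS min_def)
  then have dec: "strict_mono (\<lambda>k. - r k)" by (simp add: strict_mono_Suc_iff)
  then have inj: "inj r" using strict_mono_imp_inj_on[OF dec] by (auto simp: inj_on_def)
  have r\<delta>: "r k < \<delta> k" for k using \<delta>(1)[of k] by (cases k) (auto simp: r0 rS min_def)
  have r1: "r k \<le> 1" for k
  proof (induction k)
    case 0 then show ?case by (simp add: r0)
  next
    case (Suc k) then show ?case using rpos[of k] by (simp add: rS min_def)
  qed
  have nv: "norm (r k *\<^sub>R axis 1 1 :: real^2) = r k" for k using rpos[of k] by (simp add: norm_axis_1)
  define T where "T = (\<lambda>k. (+) (r k *\<^sub>R axis 1 1) ` \<Omega>)"
  define W where "W = (\<Union>k. T k)"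
  have Top: "open (T k)" for k unfolding T_def using \<Omega> by (intro open_translation) (simp add: is_domain_def)
  obtain R where R: "\<And>x. x \<in> \<Omega> \<Longrightarrow> norm x \<le> R" using \<Omega> by (auto simp: is_domain_def bounded_iff)
  have "norm x \<le> R + 1" if "x \<in> W" for x
  proof -
    obtain k y where k: "y \<in> \<Omega>" "x = r k *\<^sub>R axis 1 1 + y" using \<open>x \<in> W\<close> by (auto simp: W_def T_def)
    have "norm x \<le> norm (r k *\<^sub>R axis 1 1 :: real^2) + norm y" unfolding k(2) by (rule norm_triangle_ineq)
    then show ?thesis using nv[of k] r1[of k] R[OF k(1)] by linarith
  qed
  then have Wb: "bounded W" by (auto simp: bounded_iff)
  have Wd: "is_domain W" using Wb Top \<Omega> by (auto simp: is_domain_def W_def T_def)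
  have fin: "emeasure lebesgue \<Omega> < \<infinity>" "emeasure lebesgue W < \<infinity>"
    using \<Omega> Wd bounded_set_imp_lmeasurable[OF _ domain_lebesgue] unfolding is_domain_def fmeasurable_def by blast+
  have "emeasure lebesgue W \<le> emeasure lebesgue (\<Omega> \<union> (\<Union>k. T k - \<Omega>))"
    using domain_lebesgue[OF \<Omega>] Top by (intro emeasure_mono) (auto simp: W_def)
  also have "\<dots> \<le> emeasure lebesgue \<Omega> + emeasure lebesgue (\<Union>k. T k - \<Omega>)"
    using domain_lebesgue[OF \<Omega>] Top by (intro emeasure_subadditive) auto
  also have "emeasure lebesgue (\<Union>k. T k - \<Omega>) \<le> (\<Sum>k. emeasure lebesgue (T k - \<Omega>))"
    using domain_lebesgue[OF \<Omega>] Top by (intro emeasure_subadditive_countably) auto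
  also have "\<dots> \<le> (\<Sum>k. ennreal (\<epsilon> / 4 * (1/2)^k))"
    unfolding T_def using nv r\<delta> by (intro suminf_le \<delta>(2)) auto
  also have "\<dots> = ennreal (\<Sum>k. \<epsilon> / 4 * (1/2)^k)"
    using \<epsilon> by (intro suminf_ennreal2 summable_mult) auto
  also have "(\<Sum>k. \<epsilon> / 4 * (1/2)^k) = \<epsilon> / 2" by (subst suminf_mult) (auto simp: suminf_geometric)
  finally have "emeasure lebesgue W \<le> emeasure lebesgue \<Omega> + ennreal (\<epsilon> / 2)" by (simp add: add_left_mono)
  then have "ennreal (measure lebesgue W) \<le> ennreal (measure lebesgue \<Omega> + \<epsilon> / 2)"
    using fin \<epsilon> by (simp add: emeasure_eq_ennreal_measure less_top[symmetric] ennreal_plus)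
  then have "measure lebesgue W \<le> measure lebesgue \<Omega> + \<epsilon> / 2"
    using \<epsilon> by (subst (asm) ennreal_le_iff) auto
  then have "measure lebesgue W < measure lebesgue \<Omega> + \<epsilon>" using \<epsilon> by simp
  then show ?thesis using that[OF inj] Wd unfolding W_def T_def by blast
qed

text \<open>The argument by infinitely many translates described at the beginning: all
  translates have the same eigenvalues as \<open>\<Omega>\<close>, and each of them supplies an
  eigenfunction of the union W if the n-th eigenvalue does not drop.\<close>

theorem enlarged_domain_smaller_eigenvalue:
  assumes \<Omega>: "is_domain \<Omega>" and \<epsilon>: "\<epsilon> > 0" and n: "n \<ge> 1"
  obtains W where "is_domain W" "measure lebesgue W < measure lebesgue \<Omega> + \<epsilon>"
    "magnetic_eigenvalue n W B < magnetic_eigenvalue n \<Omega> B"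
proof -
  define \<mu> where "\<mu> = magnetic_eigenvalue n \<Omega> B"
  obtain r where r: "inj (r :: nat \<Rightarrow> real)" "is_domain (\<Union>k. (+) (r k *\<^sub>R axis 1 1) ` \<Omega>)"
    "measure lebesgue (\<Union>k. (+) (r k *\<^sub>R axis 1 1) ` \<Omega>) < measure lebesgue \<Omega> + \<epsilon>"
    using many_translates[OF \<Omega> \<epsilon>] by metis
  define W where "W = (\<Union>k. (+) (r k *\<^sub>R axis 1 1) ` \<Omega>)"
  have W: "is_domain W" using r(2) by (simp add: W_def)
  interpret w: compact_form_pair fun_scale "fdom W B" L2ip "qform B" using W by (rule domain_pair)
  obtain e l where e: "w.spectral e l" "\<And>n. magnetic_eigenvalue n W B = l (n - 1)"
    using domain_spectral[OF W, of B] unfolding spectral_of_def by metis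
  have "magnetic_eigenvalue n W B < \<mu>"
  proof (rule ccontr)
    assume "\<not> magnetic_eigenvalue n W B < \<mu>"
    then have ge: "\<mu> \<le> l (n - 1)" by (simp add: e(2))
    obtain u where u: "Rayleigh_le \<Omega> B n \<mu> u" using eigenvalue_le_iff[OF \<Omega> n] \<mu>_def by blast
    interpret o: hermitian_form fun_scale "fdom \<Omega> B" L2ip using domain_lebesgue[OF \<Omega>] by (rule hermitian_L2_fdom)
    have uD: "u j \<in> fdom \<Omega> B" if "j < n" for j using u that by (simp add: Rayleigh_le_def)
    have uL: "u j \<in> L2" if "j < n" for j using uD[OF that] by (rule fdom_L2)
    define T where "T = (\<lambda>k. gauge_scale B 1 (r k *\<^sub>R axis 1 1))"
    have "\<exists>c. L2norm (T k (lin_comb fun_scale n c u)) > 0 \<and> w.eigvec \<mu> (T k (lin_comb fun_scale n c u))" for k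
    proof -
      have "Rayleigh_le (scaled_translate 1 (r k *\<^sub>R axis 1 1) \<Omega>) B n (\<mu> / 1\<^sup>2) (\<lambda>j. T k (u j))"
        unfolding T_def using u by (intro gauge_scale_Rayleigh domain_lebesgue[OF \<Omega>]) auto
      moreover have "scaled_translate 1 (r k *\<^sub>R axis 1 1) \<Omega> \<subseteq> W" by (auto simp: scaled_translate_def W_def)
      ultimately have R: "Rayleigh_le W B n \<mu> (\<lambda>j. T k (u j))" using Rayleigh_le_mono by fastforce
      have "\<exists>c. L2norm (lin_comb fun_scale n c (\<lambda>j. T k (u j))) > 0 \<and> w.eigvec \<mu> (lin_comb fun_scale n c (\<lambda>j. T k (u j)))"
        using R unfolding Rayleigh_le_def by (intro w.minmax_equality[OF e(1) _ _ n _ ge]) auto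
      then show ?thesis unfolding T_def gauge_scale_linear(3) .
    qed
    then obtain c where c: "\<And>k. L2norm (T k (lin_comb fun_scale n (c k) u)) > 0"
      "\<And>k. w.eigvec \<mu> (T k (lin_comb fun_scale n (c k) u))" by metis
    define v where "v = (\<lambda>k. lin_comb fun_scale n (c k) u)"
    have vD: "v k \<in> fdom \<Omega> B" for k unfolding v_def using uD by (rule o.lin_comb_in)
    have loc: "localized (v k)" for k
    proof -
      have "bounded {x. v k x \<noteq> 0}"
      proof (rule bounded_subset)
        show "bounded \<Omega>" using \<Omega> by (simp add: is_domain_def)
        show "{x. v k x \<noteq> 0} \<subseteq> \<Omega>" using fdom_outside[OF vD[of k]] by blast
      qed
      moreover have "L2norm (v k) > 0"
        using c(1)[of k] gauge_scale_norm[of 1 "v k" B "r k *\<^sub>R axis 1 1"] fdom_L2[OF vD[of k]] by (simp add: T_def v_def)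
      ultimately show ?thesis using fdom_L2[OF vD] by (simp add: localized_def)
    qed
    have "finite (range (\<lambda>k. right_edge (v k)))"
      unfolding v_def using uL loc[unfolded v_def] by (rule finitely_many_edges)
    then obtain k0 where k0: "infinite {k. right_edge (v k) = right_edge (v k0)}"
      using pigeonhole_infinite[of UNIV "\<lambda>k. right_edge (v k)"] by auto
    \<comment> \<open>one more than the multiplicity of \<open>\<mu>\<close> on W allows\<close>
    define m where "m = Suc (card {k. l k = \<mu>})"
    obtain K where K: "finite K" "card K = m" "K \<subseteq> {k. right_edge (v k) = right_edge (v k0)}"
      using infinite_arbitrarily_large[OF k0] by blast
    then obtain f where f: "bij_betw f {..<m} K" using ex_bij_betw_nat_finite[OF K(1)] by (auto simp: atLeast0LessThan)
    have edge: "right_edge (T k (v k)) = right_edge (v k) + r k" "localized (T k (v k))" for k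
      unfolding T_def using right_edge_translate[OF loc] by auto
    have "inj_on (\<lambda>j. right_edge (T (f j) (v (f j)))) {..<m}"
    proof (rule inj_onI)
      fix i j assume ij: "i \<in> {..<m}" "j \<in> {..<m}" "right_edge (T (f i) (v (f i))) = right_edge (T (f j) (v (f j)))"
      have "f i \<in> K" "f j \<in> K" using f ij unfolding bij_betw_def by auto
      from subsetD[OF K(3) this(1)] subsetD[OF K(3) this(2)]
      have "right_edge (v (f i)) = right_edge (v (f j))" unfolding mem_Collect_eq by (rule trans[OF _ sym])
      then have "r (f i) = r (f j)" using ij(3) unfolding edge(1) by simp
      then have "f i = f j" using r(1) by (simp add: inj_eq)
      then show "i = j" using f ij unfolding bij_betw_def inj_on_def by blast
    qed
    then have "L2.indep m (\<lambda>j. T (f j) (v (f j)))" using edge(2) by (intro distinct_edges_indep) auto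
    moreover have "w.eigvec \<mu> (T (f j) (v (f j)))" for j using c(2) unfolding v_def .
    ultimately have "m \<le> card {k. l k = \<mu>}" by (intro w.multiplicity_upper[OF e(1)]) auto
    then show False by (simp add: m_def)
  qed
  then show ?thesis using that W r(3) unfolding \<mu>_def W_def by blast
qed

section \<open>Minimal eigenvalues and splitting\<close>

lemma admissible_domain: "admissible \<Omega> \<Longrightarrow> is_domain \<Omega>"
  unfolding admissible_def is_domain_def by auto

lemma minimizer_admissible: "is_minimizer n B \<Omega> \<Longrightarrow> admissible \<Omega>"
  by (simp add: is_minimizer_def is_arg_min_def)

lemma minimizer_le: "is_minimizer n B \<Omega> \<Longrightarrow> admissible \<Omega>' \<Longrightarrow> magnetic_eigenvalue n \<Omega> B \<le> magnetic_eigenvalue n \<Omega>' B"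
  unfolding is_minimizer_def is_arg_min_def by (meson not_le)

lemma minimizer_value:
  assumes "is_minimizer n B \<Omega>" shows "minimal_eigenvalue n B = magnetic_eigenvalue n \<Omega> B"
  unfolding minimal_eigenvalue_def
proof (rule Least_equality)
  show "\<exists>\<Omega>'. admissible \<Omega>' \<and> magnetic_eigenvalue n \<Omega> B = magnetic_eigenvalue n \<Omega>' B"
    using assms minimizer_admissible by blast
  show "magnetic_eigenvalue n \<Omega> B \<le> y" if "\<exists>\<Omega>'. admissible \<Omega>' \<and> y = magnetic_eigenvalue n \<Omega>' B" for y
    using that minimizer_le[OF assms] by blast
qed

lemma minimizer_iff:
  assumes "is_minimizer n B \<Omega>" "admissible \<Omega>'" "magnetic_eigenvalue n \<Omega>' B \<le> minimal_eigenvalue n B"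
  shows "is_minimizer n B \<Omega>'" "magnetic_eigenvalue n \<Omega>' B = minimal_eigenvalue n B"
proof -
  show eq: "magnetic_eigenvalue n \<Omega>' B = minimal_eigenvalue n B"
    using assms minimizer_value minimizer_le by (metis antisym)
  show "is_minimizer n B \<Omega>'"
    unfolding is_minimizer_def is_arg_min_def
    using assms(2) eq minimizer_value[OF assms(1)] minimizer_le[OF assms(1)] by (metis not_le)
qed

lemma disjoint_placement:
  assumes "bounded X" "bounded \<Omega>" "s > 0"
  obtains b where "X \<inter> scaled_translate s b \<Omega> = {}"
proof -
  obtain R where R: "\<And>x. x \<in> X \<Longrightarrow> norm x \<le> R" using assms(1) by (auto simp: bounded_iff)
  obtain R' where R': "\<And>x. x \<in> \<Omega> \<Longrightarrow> norm x \<le> R'" using assms(2) by (auto simp: bounded_iff)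
  \<comment> \<open>far enough to the right to separate the two bounded sets\<close>
  define b :: "real^2" where "b = (\<bar>R\<bar> + s * \<bar>R'\<bar> + 1) *\<^sub>R axis 1 1"
  have nb: "norm b = \<bar>R\<bar> + s * \<bar>R'\<bar> + 1" using assms(3) by (simp add: b_def norm_axis_1)
  have "x \<notin> X" if x: "x \<in> scaled_translate s b \<Omega>" for x
  proof
    assume "x \<in> X"
    then have "norm x \<le> R" by (rule R)
    obtain y where y: "y \<in> \<Omega>" "x = b + s *\<^sub>R y" using x by (auto simp: scaled_translate_def)
    have "norm (s *\<^sub>R y) \<le> s * \<bar>R'\<bar>" using R'[OF y(1)] assms(3) by simp
    moreover have "norm b \<le> norm x + norm (s *\<^sub>R y)" using norm_triangle_ineq4[of x "s *\<^sub>R y"] y(2) by simp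
    ultimately show False using nb \<open>norm x \<le> R\<close> by linarith
  qed
  then show ?thesis using that[of b] by blast
qed

lemma domain_finite_measure: "is_domain \<Omega> \<Longrightarrow> \<Omega> \<in> lmeasurable"
  unfolding is_domain_def by (intro bounded_set_imp_lmeasurable) auto

lemma domain_measure_pos:
  assumes "is_domain \<Omega>" shows "measure lebesgue \<Omega> > 0"
proof -
  have "\<not> negligible \<Omega>" using assms open_not_negligible by (auto simp: is_domain_def)
  then have "measure lebesgue \<Omega> \<noteq> 0" using negligible_iff_measure[of \<Omega>] domain_finite_measure[OF assms] by blast
  then show ?thesis using measure_nonneg[of lebesgue \<Omega>] by linarith
qed

lemma measure_disjoint_union:
  assumes "is_domain S" "is_domain S'" "S \<inter> S' = {}"
  shows "measure lebesgue (S \<union> S') = measure lebesgue S + measure lebesgue S'"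
  using fmeasurableD2[OF domain_finite_measure[OF assms(1)]] fmeasurableD2[OF domain_finite_measure[OF assms(2)]]
    domain_lebesgue[OF assms(1)] domain_lebesgue[OF assms(2)] assms(3) by (intro measure_Union) auto

text \<open>Adding a disjoint square of the missing area makes the set admissible and does not
  raise its eigenvalues.\<close>

lemma smaller_domain_value:
  assumes W: "is_domain W" "measure lebesgue W < 1" and n: "n \<ge> 1" and min: "is_minimizer n B U"
  shows "magnetic_eigenvalue n U B \<le> magnetic_eigenvalue n W B"
proof -
  \<comment> \<open>the side of the square that is added\<close>
  define s where "s = sqrt (1 - measure lebesgue W)"
  have s: "s > 0" "s\<^sup>2 = 1 - measure lebesgue W" using W(2) by (auto simp: s_def)
  define Q :: "(real^2) set" where "Q = box 0 1"
  have "Q \<noteq> {}" by (auto simp: Q_def box_ne_empty Basis_vec_def inner_axis)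
  then have Q: "is_domain Q" unfolding is_domain_def Q_def by (intro conjI open_box bounded_box)
  have mQ: "measure lebesgue Q = 1"
  proof -
    have "emeasure lborel Q = 1" using content_square(2)[of 1 0] by (simp add: Q_def)
    then show ?thesis by (simp add: measure_def Q_def)
  qed
  obtain b where b: "W \<inter> scaled_translate s b Q = {}"
    using disjoint_placement[of W Q s] W(1) Q s(1) by (auto simp: is_domain_def)
  have sQ: "is_domain (scaled_translate s b Q)" using s(1) Q by (rule scaled_translate_domain)
  have V: "is_domain (W \<union> scaled_translate s b Q)" using W(1) sQ by (rule union_domain)
  have "measure lebesgue (W \<union> scaled_translate s b Q) = 1"
    using measure_disjoint_union[OF W(1) sQ b] scaled_translate_measure[OF s(1) domain_lebesgue[OF Q]] s(2) mQ by simp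
  then have "admissible (W \<union> scaled_translate s b Q)" using V by (simp add: admissible_def is_domain_def)
  then have "magnetic_eigenvalue n U B \<le> magnetic_eigenvalue n (W \<union> scaled_translate s b Q) B" by (rule minimizer_le[OF min])
  also have "\<dots> \<le> magnetic_eigenvalue n W B" by (rule eigenvalue_antimono[OF W(1) V _ n]) simp
  finally show ?thesis .
qed

text \<open>If the n-th eigenvalue of S were not above the optimal value, a set of slightly
  larger measure than S, still less than 1, would beat the minimizer.\<close>

lemma component_not_optimal:
  assumes S: "is_domain S" "measure lebesgue S < 1" and n: "n \<ge> 1" and min: "is_minimizer n B U"
  shows "magnetic_eigenvalue n U B < magnetic_eigenvalue n S B"
proof -
  obtain W where W: "is_domain W" "measure lebesgue W < measure lebesgue S + (1 - measure lebesgue S)"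
    "magnetic_eigenvalue n W B < magnetic_eigenvalue n S B"
    using enlarged_domain_smaller_eigenvalue[OF S(1) _ n, of "1 - measure lebesgue S" B] S(2) by auto
  then show ?thesis using smaller_domain_value[OF W(1) _ n min] by simp
qed

lemma splitting_configuration:
  assumes i: "i \<ge> 1" "i < n" and t: "0 < t" "t < 1"
    and min: "is_minimizer i (t * B) \<Omega>" "is_minimizer (n - i) ((1 - t) * B) \<Omega>'"
    and disj: "scaled_translate (sqrt t) a \<Omega> \<inter> scaled_translate (sqrt (1 - t)) b \<Omega>' = {}"
  defines "U \<equiv> scaled_translate (sqrt t) a \<Omega> \<union> scaled_translate (sqrt (1 - t)) b \<Omega>'"
  shows "admissible U" "magnetic_eigenvalue n U B \<le> splitting_value n B (i, t)"
proof -
  have s: "sqrt t > 0" "(sqrt t)\<^sup>2 = t" "sqrt (1 - t) > 0" "(sqrt (1 - t))\<^sup>2 = 1 - t" using t by auto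
  have ad: "admissible \<Omega>" "admissible \<Omega>'" using min minimizer_admissible by auto
  then have D: "is_domain \<Omega>" "is_domain \<Omega>'" using admissible_domain by auto
  have m: "measure lebesgue \<Omega> = 1" "measure lebesgue \<Omega>' = 1" using ad by (auto simp: admissible_def)
  let ?V = "scaled_translate (sqrt t) a \<Omega>" and ?V' = "scaled_translate (sqrt (1 - t)) b \<Omega>'"
  have V: "is_domain ?V" "is_domain ?V'" using scaled_translate_domain s D by auto
  have "measure lebesgue U = 1"
    unfolding U_def measure_disjoint_union[OF V disj]
    using scaled_translate_measure[OF s(1) domain_lebesgue[OF D(1)]] scaled_translate_measure[OF s(3) domain_lebesgue[OF D(2)]] m s by simp
  then show "admissible U" using union_domain[OF V] by (simp add: admissible_def is_domain_def U_def)
  have "magnetic_eigenvalue i ?V B = minimal_eigenvalue i (t * B) / t"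
    using eigenvalue_scaling[OF s(1) D(1) i(1), of a B] minimizer_value[OF min(1)] s(2) by simp
  moreover have "magnetic_eigenvalue (n - i) ?V' B = minimal_eigenvalue (n - i) ((1 - t) * B) / (1 - t)"
    using eigenvalue_scaling[OF s(3) D(2), of "n - i" b B] minimizer_value[OF min(2)] s(4) i by simp
  moreover have "magnetic_eigenvalue (i + (n - i)) U B \<le> max (magnetic_eigenvalue i ?V B) (magnetic_eigenvalue (n - i) ?V' B)"
    unfolding U_def using i by (intro union_eigenvalue_le V disj) auto
  ultimately show "magnetic_eigenvalue n U B \<le> splitting_value n B (i, t)"
    using i by (simp add: splitting_value_def)
qed

text \<open>S is rescaled to measure 1 and compared with the minimizer at the rescaled
  field.\<close>

lemma component_lower_bound:
  assumes S: "is_domain S" and i: "i \<ge> 1" and min: "is_minimizer i (measure lebesgue S * B) \<Omega>"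
  shows "minimal_eigenvalue i (measure lebesgue S * B) / measure lebesgue S \<le> magnetic_eigenvalue i S B"
proof -
  define t where "t = measure lebesgue S"
  have t: "t > 0" unfolding t_def using S by (rule domain_measure_pos)
  define s where "s = 1 / sqrt t"
  have s: "s > 0" "s\<^sup>2 = 1 / t" using t by (auto simp: s_def power_divide)
  have D: "is_domain (scaled_translate s 0 S)" using s(1) S by (rule scaled_translate_domain)
  have "measure lebesgue (scaled_translate s 0 S) = 1"
    using scaled_translate_measure[OF s(1) domain_lebesgue[OF S]] s(2) t by (simp add: t_def)
  then have "admissible (scaled_translate s 0 S)" using D by (simp add: admissible_def is_domain_def)
  then have "minimal_eigenvalue i (t * B) \<le> magnetic_eigenvalue i (scaled_translate s 0 S) (t * B)"
    using minimizer_le[OF min] minimizer_value[OF min] by (simp add: t_def)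
  also have "\<dots> = magnetic_eigenvalue i S B * t"
    using eigenvalue_scaling[OF s(1) S i, of 0 "t * B"] s(2) t by simp
  finally show ?thesis using t unfolding t_def[symmetric] by (simp add: field_simps)
qed

theorem theorem2p7:
  fixes n :: nat and B :: real
  assumes minima_attained: "\<And>m \<beta>. m \<ge> 1 \<Longrightarrow> \<beta> \<ge> 0 \<Longrightarrow> \<exists>\<Omega>. is_minimizer m \<beta> \<Omega>"
    and "n \<ge> 2" and "B \<ge> 0"
    and "\<exists>\<Omega>\<^sub>1 \<Omega>\<^sub>2. open \<Omega>\<^sub>1 \<and> open \<Omega>\<^sub>2 \<and> \<Omega>\<^sub>1 \<inter> \<Omega>\<^sub>2 = {} \<and>
           measure lebesgue \<Omega>\<^sub>1 > 0 \<and> measure lebesgue \<Omega>\<^sub>2 > 0 \<and> is_minimizer n B (\<Omega>\<^sub>1 \<union> \<Omega>\<^sub>2)"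
  shows "(\<exists>p \<in> splitting_pairs n. minimal_eigenvalue n B = splitting_value n B p) \<and>
         (\<forall>p \<in> splitting_pairs n. minimal_eigenvalue n B \<le> splitting_value n B p) \<and>
         (\<forall>i t \<Omega> \<Omega>' a b.
            is_arg_min (splitting_value n B) (\<lambda>p. p \<in> splitting_pairs n) (i, t) \<longrightarrow>
            is_minimizer i (t * B) \<Omega> \<longrightarrow>
            is_minimizer (n - i) ((1 - t) * B) \<Omega>' \<longrightarrow>
            scaled_translate (sqrt t) a \<Omega> \<inter> scaled_translate (sqrt (1 - t)) b \<Omega>' = {} \<longrightarrow>
            (let U = scaled_translate (sqrt t) a \<Omega> \<union> scaled_translate (sqrt (1 - t)) b \<Omega>'
             in is_minimizer n B U \<and> magnetic_eigenvalue n U B = minimal_eigenvalue n B))"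
proof -
  obtain S S' where S: "open S" "open S'" "S \<inter> S' = {}" "measure lebesgue S > 0" "measure lebesgue S' > 0"
    and min: "is_minimizer n B (S \<union> S')" using assms(4) by blast
  have "bounded (S \<union> S')" using minimizer_admissible[OF min] by (simp add: admissible_def)
  then have D: "is_domain S" "is_domain S'" using S by (auto simp: is_domain_def)
  have mU: "measure lebesgue S + measure lebesgue S' = 1"
    using minimizer_admissible[OF min] measure_disjoint_union[OF D S(3)] by (simp add: admissible_def)
  have n: "n \<ge> 1" using assms(2) by simp
  have val: "minimal_eigenvalue n B = magnetic_eigenvalue n (S \<union> S') B" using min by (rule minimizer_value)
  have pair: "i \<ge> 1 \<and> i < n \<and> 0 < t \<and> t < 1" if "(i, t) \<in> splitting_pairs n" for i t
    using that assms(2) by (auto simp: splitting_pairs_def)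
  have upper: "minimal_eigenvalue n B \<le> splitting_value n B p" if p: "p \<in> splitting_pairs n" for p
  proof -
    obtain i t where it: "p = (i, t)" by fastforce
    have i: "i \<ge> 1" "i < n" and t: "0 < t" "t < 1" using pair p it by auto
    obtain \<Omega> where \<Omega>: "is_minimizer i (t * B) \<Omega>" using minima_attained[of i "t * B"] i t assms(3) by auto
    have ni: "n - i \<ge> 1" using i by simp
    have "(1 - t) * B \<ge> 0" using t assms(3) by simp
    then obtain \<Omega>' where \<Omega>': "is_minimizer (n - i) ((1 - t) * B) \<Omega>'" using minima_attained[OF ni] by blast
    have "is_domain \<Omega>" "is_domain \<Omega>'" using \<Omega> \<Omega>' minimizer_admissible admissible_domain by blast+
    then have "is_domain (scaled_translate (sqrt t) 0 \<Omega>)" "bounded \<Omega>'"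
      using t scaled_translate_domain by (auto simp: is_domain_def)
    then obtain b where b: "scaled_translate (sqrt t) 0 \<Omega> \<inter> scaled_translate (sqrt (1 - t)) b \<Omega>' = {}"
      using disjoint_placement[of "scaled_translate (sqrt t) 0 \<Omega>" \<Omega>' "sqrt (1 - t)"] t by (auto simp: is_domain_def)
    note conf = splitting_configuration[OF i t \<Omega> \<Omega>' b]
    show ?thesis using minimizer_le[OF min conf(1)] conf(2) it val by simp
  qed
  have split: "splitting_value n B (i, measure lebesgue X) \<le> minimal_eigenvalue n B"
    if i: "1 \<le> i" "i < n" and X: "is_domain X" "is_domain X'" "measure lebesgue X + measure lebesgue X' = 1"
      and le: "magnetic_eigenvalue i X B \<le> minimal_eigenvalue n B" "magnetic_eigenvalue (n - i) X' B \<le> minimal_eigenvalue n B"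
    for i X X'
  proof -
    have m: "measure lebesgue X' = 1 - measure lebesgue X" using X(3) by simp
    obtain \<Omega> where \<Omega>: "is_minimizer i (measure lebesgue X * B) \<Omega>"
      using minima_attained[of i "measure lebesgue X * B"] i assms(3) by auto
    have ni: "n - i \<ge> 1" using i by simp
    have "measure lebesgue X' * B \<ge> 0" using assms(3) by simp
    then obtain \<Omega>' where \<Omega>': "is_minimizer (n - i) (measure lebesgue X' * B) \<Omega>'"
      using minima_attained[OF ni] by blast
    show ?thesis
      using component_lower_bound[OF X(1) i(1) \<Omega>] component_lower_bound[OF X(2) ni \<Omega>'] le
      unfolding splitting_value_def m by simp
  qed
  obtain i where i: "i \<le> n" "i \<ge> 1 \<Longrightarrow> magnetic_eigenvalue i S B \<le> minimal_eigenvalue n B"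
    "i < n \<Longrightarrow> magnetic_eigenvalue (n - i) S' B \<le> minimal_eigenvalue n B"
    using union_eigenvalue_ge[OF D S(3) n, of B] unfolding val by metis
  have "i \<noteq> 0"
  proof
    assume "i = 0"
    then show False using i(3) n component_not_optimal[OF D(2) _ n min] mU S(4) val by simp
  qed
  moreover have "i \<noteq> n"
  proof
    assume "i = n"
    then show False using i(2) n component_not_optimal[OF D(1) _ n min] mU S(5) val by simp
  qed
  ultimately have i1: "1 \<le> i" "i < n" using i(1) by auto
  have attained: "\<exists>p\<in>splitting_pairs n. splitting_value n B p \<le> minimal_eigenvalue n B"
  proof (cases "i \<le> n div 2")
    case True
    then have "(i, measure lebesgue S) \<in> splitting_pairs n" using i1 mU S by (simp add: splitting_pairs_def)
    then show ?thesis using split[OF i1 D mU i(2)[OF i1(1)] i(3)[OF i1(2)]] by blast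
  next
    case False
    then have "(n - i, measure lebesgue S') \<in> splitting_pairs n" using i1 mU S by (auto simp: splitting_pairs_def)
    moreover have "splitting_value n B (n - i, measure lebesgue S') \<le> minimal_eigenvalue n B"
      using i1 mU i(2)[OF i1(1)] i(3)[OF i1(2)] by (intro split[OF _ _ D(2,1)]) auto
    ultimately show ?thesis by blast
  qed
  then obtain p where p: "p \<in> splitting_pairs n" "splitting_value n B p \<le> minimal_eigenvalue n B" by blast
  have third: "is_minimizer n B U \<and> magnetic_eigenvalue n U B = minimal_eigenvalue n B"
    if am: "is_arg_min (splitting_value n B) (\<lambda>p. p \<in> splitting_pairs n) (i, t)"
      and \<Omega>: "is_minimizer i (t * B) \<Omega>" and \<Omega>': "is_minimizer (n - i) ((1 - t) * B) \<Omega>'"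
      and disj: "scaled_translate (sqrt t) a \<Omega> \<inter> scaled_translate (sqrt (1 - t)) b \<Omega>' = {}"
      and U: "U = scaled_translate (sqrt t) a \<Omega> \<union> scaled_translate (sqrt (1 - t)) b \<Omega>'"
    for i t \<Omega> \<Omega>' a b U
  proof -
    have it: "(i, t) \<in> splitting_pairs n" using am by (simp add: is_arg_min_def)
    have "splitting_value n B (i, t) \<le> splitting_value n B p"
      using am p(1) unfolding is_arg_min_def by (meson not_le)
    then have le: "splitting_value n B (i, t) \<le> minimal_eigenvalue n B" using p(2) by simp
    have i: "i \<ge> 1" "i < n" and t: "0 < t" "t < 1" using pair[OF it] by auto
    note conf = splitting_configuration[OF i t \<Omega> \<Omega>' disj, folded U]
    show ?thesis using minimizer_iff[OF min conf(1)] conf(2) le by auto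
  qed
  show ?thesis
  proof (intro conjI allI impI ballI)
    show "\<exists>p\<in>splitting_pairs n. minimal_eigenvalue n B = splitting_value n B p"
      using p upper[OF p(1)] by (intro bexI[of _ p]) auto
  next
    show "minimal_eigenvalue n B \<le> splitting_value n B p" if "p \<in> splitting_pairs n" for p using upper[OF that] .
  next
    fix i t \<Omega> \<Omega>' a b
    assume "is_arg_min (splitting_value n B) (\<lambda>p. p \<in> splitting_pairs n) (i, t)"
      "is_minimizer i (t * B) \<Omega>" "is_minimizer (n - i) ((1 - t) * B) \<Omega>'"
      "scaled_translate (sqrt t) a \<Omega> \<inter> scaled_translate (sqrt (1 - t)) b \<Omega>' = {}"
    from third[OF this refl] show "let U = scaled_translate (sqrt t) a \<Omega> \<union> scaled_translate (sqrt (1 - t)) b \<Omega>'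
      in is_minimizer n B U \<and> magnetic_eigenvalue n U B = minimal_eigenvalue n B" unfolding Let_def .
  qed
qed

end
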